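(* Suppose there exists a function $v\colon [0,T]\times \mathbb{R}^n\to \mathbb{R}$ that is continuously differentiable in $t$ and twice continuously differentiable in $x$, satisfying $$\begin{cases}\mathcal{L}v(t,x)\leq 0, & \forall x\in \mathcal{X}\setminus \mathcal{X}_s,\ \forall t \in [0,T],\\ \frac{\partial v(t,x)}{\partial t}\leq 0, & \forall x\in \partial \mathcal{X}\cup \partial \mathcal{X}_s,\ \forall t\in [0,T],\\ v(T,x)\geq 1_{\partial \mathcal{X}_s}(x), & \forall x\in \overline{\mathcal{X}\setminus \mathcal{X}_s}.\end{cases}$$ Then $\mathbb{P}_{x_0}^{[0,T]}\leq v(0,x_0)$ for every $x_0\in \mathcal{X}\setminus \mathcal{X}_s$.
   Context: Let $b\colon\mathbb{R}^n\to\mathbb{R}^n$ and $\sigma\colon\mathbb{R}^n\to\mathbb{R}^{n\times k}$ be locally Lipschitz continuous, and let $W$ be a standard $k$-dimensional Wiener process on a probability space $(\Omega,\mathbb{P})$. For $x_0\in\mathbb{R}^n$, the SDE $dX=b(X)\,dt+\sigma(X)\,dW$ with initial state $x_0$ has a unique maximal local strong solution $X_{x_0}^{w}(t)$, $t\in[0,T^{x_0}(w))$, with continuous sample paths, where $T^{x_0}(w)\in(0,\infty]$. Let $\mathcal{X}\subseteq\mathbb{R}^n$ be open and bounded, $\mathcal{X}_s\subseteq\mathcal{X}$ a closed set, and $0<T<\infty$. An overline denotes closure, $\partial$ denotes topological boundary, and $1_A$ is the indicator function of $A$. For $x_0\in\mathcal{X}\setminus\mathcal{X}_s$ define $$\mathbb{P}_{x_0}^{[0,T]}:=\mathbb{P}\big(\{w\in\Omega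 \mid \exists t\in[0,T].\ X_{x_0}^{w}(t)\in\mathcal{X}_s\ \wedge\ \forall\tau\in[0,t).\ X_{x_0}^{w}(\tau)\in\mathcal{X}\}\big),$$ where the path is required to be defined at the times involved. For a function $v(t,x)$ that is continuously differentiable in $t$ and twice continuously differentiable in $x$ (class $C^{1,2}$), $$\mathcal{L}v(t,x)=\frac{\partial v(t,x)}{\partial t}+\frac{\partial v(t,x)}{\partial x}b(x)+\frac12\mathrm{tr}\Big(\sigma(x)^{\top}\frac{\partial^2 v(t,x)}{\partial x^2}\sigma(x)\Big).$$ *)

theory Defs
  imports "HOL-Probability.Probability"
begin

section \<open>Wiener processes and their filtrations\<close>

text \<open>
  Time is the half line \<open>{0..}\<close> inside \<^typ>\<open>real\<close>; values of processes at negative times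
  are never used.
\<close>

definition wiener_process :: "'w measure \<Rightarrow> (real \<Rightarrow> 'w \<Rightarrow> real ^ 'k) \<Rightarrow> bool" where
  "wiener_process M W \<longleftrightarrow>
     prob_space M \<and>
     (\<forall>t\<ge>0. W t \<in> borel_measurable M) \<and>
     (\<forall>w\<in>space M. continuous_on {0..} (\<lambda>t. W t w)) \<and>
     (AE w in M. W 0 w = 0) \<and>
     (\<forall>(t :: nat \<Rightarrow> real) m. 0 \<le> t 0 \<and> mono t \<longrightarrow>
        prob_space.indep_vars M (\<lambda>_. borel) (\<lambda>i w. W (t (Suc i)) w - W (t i) w) {..<m}) \<and>
     (\<forall>s t. 0 \<le> s \<and> s < t \<longrightarrow>
        prob_space.indep_vars M (\<lambda>_. borel) (\<lambda>j w. (W t w - W s w) $ j) UNIV \<and>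
        (\<forall>j. distributed M lborel (\<lambda>w. (W t w - W s w) $ j) (normal_density 0 (sqrt (t - s)))))"

text \<open>
  The augmented natural filtration. Augmentation is by the null sets belonging to \<open>M\<close>, so that
  every member is a measurable set even if \<open>M\<close> is not complete.
\<close>

definition wiener_filtration :: "'w measure \<Rightarrow> (real \<Rightarrow> 'w \<Rightarrow> real ^ 'k) \<Rightarrow> real \<Rightarrow> 'w measure" where
  "wiener_filtration M W t =
     sigma (space M) ({W s -` B \<inter> space M | s B. 0 \<le> s \<and> s \<le> t \<and> B \<in> sets borel} \<union> null_sets M)"

definition progressive :: "(real \<Rightarrow> 'w measure) \<Rightarrow> (real \<Rightarrow> 'w \<Rightarrow> 'b::topological_space) \<Rightarrow> bool" where
  "progressive F H \<longleftrightarrow>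
     (\<forall>t\<ge>0. (\<lambda>(s, w). H s w) \<in> borel_measurable (restrict_space borel {0..t} \<Otimes>\<^sub>M F t))"


section \<open>The stochastic integral\<close>

text \<open>
  A simple process is given by \<open>m\<close> steps on the grid \<open>p 0 \<le> \<dots> \<le> p m\<close> with bounded matrix values
  \<open>\<xi> i\<close>, known at time \<open>p i\<close> and taken on the interval \<open>(p i, p (i + 1)]\<close>.
\<close>

definition simple_process ::
  "'w measure \<Rightarrow> (real \<Rightarrow> 'w measure) \<Rightarrow> nat \<Rightarrow> (nat \<Rightarrow> real) \<Rightarrow> (nat \<Rightarrow> 'w \<Rightarrow> real ^ 'k ^ 'n) \<Rightarrow> bool" where
  "simple_process M F m p \<xi> \<longleftrightarrow>
     0 \<le> p 0 \<and>
     (\<forall>i<m. p i \<le> p (Suc i) \<and> \<xi> i \<in> borel_measurable (F (p i)) \<and>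
            bounded (\<xi> i ` space M))"

definition simple_value ::
  "nat \<Rightarrow> (nat \<Rightarrow> real) \<Rightarrow> (nat \<Rightarrow> 'w \<Rightarrow> real ^ 'k ^ 'n) \<Rightarrow> real \<Rightarrow> 'w \<Rightarrow> real ^ 'k ^ 'n" where
  "simple_value m p \<xi> t w = (\<Sum>i<m. indicator {p i<..p (Suc i)} t *\<^sub>R \<xi> i w)"

definition simple_integral ::
  "(real \<Rightarrow> 'w \<Rightarrow> real ^ 'k) \<Rightarrow> nat \<Rightarrow> (nat \<Rightarrow> real) \<Rightarrow> (nat \<Rightarrow> 'w \<Rightarrow> real ^ 'k ^ 'n) \<Rightarrow>
   real \<Rightarrow> 'w \<Rightarrow> real ^ 'n" where
  "simple_integral W m p \<xi> t w = (\<Sum>i<m. \<xi> i w *v (W (min (p (Suc i)) t) w - W (min (p i) t) w))"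

text \<open>
  \<open>I\<close> is (a continuous version of) the Ito integral process of \<open>H\<close>, for progressively
  measurable \<open>H\<close> with almost surely locally square integrable paths: both the simple integrands
  and their integrals converge in probability. The first integral is the extended nonnegative
  one, hence never spuriously zero. The norm on matrices is the Frobenius norm.
\<close>

definition has_ito_integral ::
  "'w measure \<Rightarrow> (real \<Rightarrow> 'w \<Rightarrow> real ^ 'k) \<Rightarrow> (real \<Rightarrow> 'w \<Rightarrow> real ^ 'k ^ 'n) \<Rightarrow>
   (real \<Rightarrow> 'w \<Rightarrow> real ^ 'n) \<Rightarrow> bool" where
  "has_ito_integral M W H I \<longleftrightarrow>
     progressive (wiener_filtration M W) H \<and>
     (AE w in M. \<forall>t\<ge>0. (\<integral>\<^sup>+s\<in>{0..t}. ennreal ((norm (H s w))\<^sup>2) \<partial>lborel) < \<infinity>) \<and>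
     (\<forall>t\<ge>0. I t \<in> borel_measurable (wiener_filtration M W t)) \<and>
     (\<forall>w\<in>space M. continuous_on {0..} (\<lambda>t. I t w)) \<and>
     (\<exists>m p \<xi>.
        (\<forall>n. simple_process M (wiener_filtration M W) (m n) (p n) (\<xi> n)) \<and>
        (\<forall>t\<ge>0. \<forall>\<epsilon>>0.
           (\<lambda>n. measure M {w \<in> space M.
              (\<integral>\<^sup>+s\<in>{0..t}. ennreal ((norm (simple_value (m n) (p n) (\<xi> n) s w - H s w))\<^sup>2) \<partial>lborel)
                > ennreal \<epsilon>}) \<longlonglongrightarrow> 0) \<and>
        (\<forall>t\<ge>0. \<forall>\<epsilon>>0.
           (\<lambda>n. measure M {w \<in> space M.
              norm (simple_integral W (m n) (p n) (\<xi> n) t w - I t w) > \<epsilon>}) \<longlonglongrightarrow> 0))"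


section \<open>Stochastic differential equations\<close>

text \<open>
  \<open>X t w\<close> is meaningful for \<open>0 \<le> t < \<zeta> w\<close> only, where \<open>\<zeta>\<close> is the (possibly infinite) lifetime.
  The equation is required up to each member of a sequence of stopping times
  that increases to \<open>\<zeta>\<close> and stays strictly below it:
  \<open>X (t \<and> \<tau>) = x0 + (integral of b(X) over [0, t \<and> \<tau>]) + (integral of 1\<^bsub>[0,\<tau>]\<^esub> \<sigma>(X) dW over [0, t])\<close>.
\<close>

definition local_strong_solution ::
  "'w measure \<Rightarrow> (real \<Rightarrow> 'w \<Rightarrow> real ^ 'k) \<Rightarrow> (real ^ 'n \<Rightarrow> real ^ 'n) \<Rightarrow> (real ^ 'n \<Rightarrow> real ^ 'k ^ 'n) \<Rightarrow>
   real ^ 'n \<Rightarrow> (real \<Rightarrow> 'w \<Rightarrow> real ^ 'n) \<Rightarrow> ('w \<Rightarrow> ereal) \<Rightarrow> bool" where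
  "local_strong_solution M W b \<sigma> x0 X \<zeta> \<longleftrightarrow>
     (\<forall>w\<in>space M. 0 < \<zeta> w) \<and>
     (\<forall>t\<ge>0. Measurable.pred (wiener_filtration M W t) (\<lambda>w. \<zeta> w \<le> ereal t)) \<and>
     (\<forall>t\<ge>0. (\<lambda>w. if ereal t < \<zeta> w then X t w else 0) \<in> borel_measurable (wiener_filtration M W t)) \<and>
     (\<forall>w\<in>space M. continuous_on {t. 0 \<le> t \<and> ereal t < \<zeta> w} (\<lambda>t. X t w)) \<and>
     (AE w in M. X 0 w = x0) \<and>
     (\<exists>\<tau> :: nat \<Rightarrow> 'w \<Rightarrow> real.
        (\<forall>m. stopping_time (wiener_filtration M W) (\<tau> m)) \<and>
        (AE w in M. (\<forall>m. 0 \<le> \<tau> m w \<and> \<tau> m w \<le> \<tau> (Suc m) w \<and> ereal (\<tau> m w) < \<zeta> w) \<and>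
                    (\<lambda>m. ereal (\<tau> m w)) \<longlonglongrightarrow> \<zeta> w) \<and>
        (\<forall>m. \<exists>I.
           has_ito_integral M W
             (\<lambda>s w. if s \<le> \<tau> m w \<and> ereal s < \<zeta> w then \<sigma> (X s w) else 0) I \<and>
           (AE w in M. \<forall>t\<ge>0.
              X (min t (\<tau> m w)) w
                = x0 + integral {0..min t (\<tau> m w)} (\<lambda>s. b (X s w)) + I t w)))"

text \<open>Maximality with respect to extension of local solutions, up to almost sure equality.\<close>

definition maximal_local_strong_solution ::
  "'w measure \<Rightarrow> (real \<Rightarrow> 'w \<Rightarrow> real ^ 'k) \<Rightarrow> (real ^ 'n \<Rightarrow> real ^ 'n) \<Rightarrow> (real ^ 'n \<Rightarrow> real ^ 'k ^ 'n) \<Rightarrow>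
   real ^ 'n \<Rightarrow> (real \<Rightarrow> 'w \<Rightarrow> real ^ 'n) \<Rightarrow> ('w \<Rightarrow> ereal) \<Rightarrow> bool" where
  "maximal_local_strong_solution M W b \<sigma> x0 X \<zeta> \<longleftrightarrow>
     local_strong_solution M W b \<sigma> x0 X \<zeta> \<and>
     (\<forall>X' \<zeta>'.
        local_strong_solution M W b \<sigma> x0 X' \<zeta>' \<and>
        (AE w in M. \<zeta> w \<le> \<zeta>' w \<and> (\<forall>t. 0 \<le> t \<and> ereal t < \<zeta> w \<longrightarrow> X' t w = X t w)) \<longrightarrow>
        (AE w in M. \<zeta>' w = \<zeta> w))"

text \<open>
  Probability of reaching \<open>S\<close> by time \<open>T\<close> while remaining in \<open>D\<close> before; the path has to be alive
  at the reaching time (and hence at all earlier times).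
\<close>

definition reach_avoid_prob ::
  "'w measure \<Rightarrow> (real \<Rightarrow> 'w \<Rightarrow> real ^ 'n) \<Rightarrow> ('w \<Rightarrow> ereal) \<Rightarrow>
   (real ^ 'n) set \<Rightarrow> (real ^ 'n) set \<Rightarrow> real \<Rightarrow> real" where
  "reach_avoid_prob M X \<zeta> D S T =
     measure M {w \<in> space M.
       \<exists>t\<in>{0..T}. ereal t < \<zeta> w \<and> X t w \<in> S \<and> (\<forall>r\<in>{0..<t}. X r w \<in> D)}"


section \<open>The class $C^{1,2}$ and the generator\<close>

text \<open>
  The time derivative is taken within \<open>{0..T}\<close>, i.e. it is one-sided at the two end points.
\<close>

definition time_deriv :: "real \<Rightarrow> (real \<Rightarrow> real ^ 'n \<Rightarrow> real) \<Rightarrow> real \<Rightarrow> real ^ 'n \<Rightarrow> real" where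
  "time_deriv T v t x = vector_derivative (\<lambda>s. v s x) (at t within {0..T})"

definition gradient :: "(real ^ 'n \<Rightarrow> real) \<Rightarrow> real ^ 'n \<Rightarrow> real ^ 'n" where
  "gradient f x = (\<chi> i. frechet_derivative f (at x) (axis i 1))"

definition hessian :: "(real ^ 'n \<Rightarrow> real) \<Rightarrow> real ^ 'n \<Rightarrow> real ^ 'n ^ 'n" where
  "hessian f x = jacobian (gradient f) (at x)"

definition C12 :: "real \<Rightarrow> (real \<Rightarrow> real ^ 'n \<Rightarrow> real) \<Rightarrow> bool" where
  "C12 T v \<longleftrightarrow>
     (\<forall>t\<in>{0..T}. \<forall>x.
        (\<lambda>s. v s x) differentiable (at t within {0..T}) \<and>
        v t differentiable (at x) \<and>
        gradient (v t) differentiable (at x)) \<and>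
     continuous_on ({0..T} \<times> UNIV) (\<lambda>(t, x). v t x) \<and>
     continuous_on ({0..T} \<times> UNIV) (\<lambda>(t, x). time_deriv T v t x) \<and>
     continuous_on ({0..T} \<times> UNIV) (\<lambda>(t, x). gradient (v t) x) \<and>
     continuous_on ({0..T} \<times> UNIV) (\<lambda>(t, x). hessian (v t) x)"

definition generator ::
  "real \<Rightarrow> (real ^ 'n \<Rightarrow> real ^ 'n) \<Rightarrow> (real ^ 'n \<Rightarrow> real ^ 'k ^ 'n) \<Rightarrow>
   (real \<Rightarrow> real ^ 'n \<Rightarrow> real) \<Rightarrow> real \<Rightarrow> real ^ 'n \<Rightarrow> real" where
  "generator T b \<sigma> v t x =
     time_deriv T v t x + gradient (v t) x \<bullet> b x
       + 1 / 2 * trace (transpose (\<sigma> x) ** hessian (v t) x ** \<sigma> x)"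

end

theory Submission
  imports Defs
begin

text \<open>
  By the weak maximum principle \<open>v \<ge> 0\<close> on \<open>[0, T]\<close> times the closure of \<open>D - S\<close>. Replace the Ito
  integral by the integral of an approximating simple process \<open>\<xi>\<close> and consider the resulting Euler scheme on
  a fine grid. By Taylor expansion, and since Brownian increments are independent of the past, \<open>v\<close> grows in
  mean along the scheme by no more than a multiple of the integral of \<open>\<bar>\<xi> - \<sigma>(X)\<bar>\<^sup>2\<close>, up to errors that
  vanish with the mesh; no Ito formula is needed. Lenglart's inequality keeps the scheme uniformly close to
  the path. So, stopping the scheme shortly before the path leaves \<open>D - S\<close>, one gets variables of mean at most
  \<open>v(0, x0)\<close> in the limit. They are eventually at least \<open>-\<epsilon>\<close> almost surely, and at least \<open>1 - \<epsilon>\<close> when the path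
  reaches \<open>S\<close>, say first at time \<open>\<theta>\<close>: the stopped values then tend to \<open>v(\<theta>, X(\<theta>))\<close>, and
  \<open>v(\<theta>, X(\<theta>)) \<ge> v(T, X(\<theta>)) \<ge> 1\<close> by the sign of the time derivative on the boundary of \<open>S\<close>. Fatou's
  lemma concludes.
\<close>

section \<open>Increments of the Wiener process\<close>

text \<open>The integral \<open>I\<close> is known only as a limit in probability at each fixed
  time, the integrand has no moments, and \<open>v\<close> is unbounded. This shapes three choices.
  The scheme takes its drift from the true path and its noise from a simple process, not from
  \<open>\<sigma>\<close> at grid points: its stochastic part is then exactly a
  \<open>simple_integral\<close>, whose distance to \<open>I\<close> is controlled, and the sign of
  the generator is used at a point of the path. Values of \<open>v\<close> are cut off outside a
  ball, and the fourth power of the step pays for large Gaussian steps; its mean is quadratic in the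
  cell length, so the total is of the order of the mesh. Finally the constants are chosen in a
  strict order: the budget for the noise error depends on \<open>v\<close>, \<open>b\<close> and
  \<open>\<sigma>\<close> only; the simple process is fixed next; its supremum \<open>N\<close>,
  which enters as \<open>N ^ 4\<close>, is beaten by the mesh, chosen last. The approximation must
  therefore hold on every finite set of times with the same simple process, which is where
  Lenglart's inequality is indispensable. All stopping rules look one step ahead, which is
  legitimate because the coefficient of the coming step is already known.\<close>

lemma borel_measurable_vec_nth:
  fixes f :: "'a \<Rightarrow> 'b::real_normed_vector ^ 'n"
  shows "f \<in> borel_measurable N \<Longrightarrow> (\<lambda>w. f w $ j) \<in> borel_measurable N"
  by (rule measurable_compose[of f N borel]) (auto intro!: borel_measurable_continuous_onI continuous_intros)

locale wiener = prob_space M for M :: "'w measure" +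
  fixes W :: "real \<Rightarrow> 'w \<Rightarrow> real ^ 'k"
  assumes wiener: "wiener_process M W"
begin

abbreviation F :: "real \<Rightarrow> 'w measure" where
  "F \<equiv> wiener_filtration M W"

lemma W_measurable [measurable]: "0 \<le> t \<Longrightarrow> W t \<in> borel_measurable M"
  using wiener unfolding wiener_process_def by blast

lemma filtration_generator_subset:
  "{W s -` B \<inter> space M | s B. 0 \<le> s \<and> s \<le> t \<and> B \<in> sets borel} \<union> null_sets M \<subseteq> sets M"
  by (auto intro: measurable_sets[OF W_measurable])

lemma space_F [simp]: "space (F t) = space M"
  unfolding wiener_filtration_def by (simp add: space_measure_of_conv)

lemma sets_F:
  "sets (F t) = sigma_sets (space M)
     ({W s -` B \<inter> space M | s B. 0 \<le> s \<and> s \<le> t \<and> B \<in> sets borel} \<union> null_sets M)"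
  unfolding wiener_filtration_def
  using filtration_generator_subset sets.space_closed[of M] by (intro sets_measure_of) blast

lemma sets_F_subset: "sets (F t) \<subseteq> sets M"
  unfolding sets_F by (rule sets.sigma_sets_subset[OF filtration_generator_subset])

lemma sets_F_mono: "s \<le> t \<Longrightarrow> sets (F s) \<subseteq> sets (F t)"
  unfolding sets_F by (rule sigma_sets_mono', rule Un_mono[OF _ order_refl], blast intro: order_trans)

lemma F_measurable_mono: "f \<in> measurable (F s) N \<Longrightarrow> s \<le> t \<Longrightarrow> f \<in> measurable (F t) N"
  using sets_F_mono[of s t] by (auto simp: measurable_def)

lemma F_measurable_M: "f \<in> measurable (F s) N \<Longrightarrow> f \<in> measurable M N"
  using sets_F_subset[of s] by (auto simp: measurable_def)

lemma W_F_measurable: "0 \<le> s \<Longrightarrow> s \<le> t \<Longrightarrow> W s \<in> borel_measurable (F t)"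
  by (rule measurableI) (auto simp: sets_F intro!: sigma_sets.Basic)

text \<open>Sets almost surely equal to a cylinder over times up to \<open>s\<close>; unlike the generator of
  \<open>F s\<close> this family is closed under intersection, and it contains the null sets.\<close>

definition cylinders :: "real \<Rightarrow> 'w set set" where
  "cylinders s = {A \<in> sets M. \<exists>U B. finite U \<and> U \<subseteq> {0..s} \<and> (\<forall>u\<in>U. B u \<in> sets borel) \<and>
     (AE w in M. w \<in> A \<longleftrightarrow> (\<forall>u\<in>U. W u w \<in> B u))}"

lemma Int_stable_cylinders: "Int_stable (cylinders s)"
proof (rule Int_stableI)
  fix A A' assume "A \<in> cylinders s" "A' \<in> cylinders s"
  from \<open>A \<in> cylinders s\<close> obtain U B where A: "A \<in> sets M"
    "finite U" "U \<subseteq> {0..s}" "\<And>u. u\<in>U \<Longrightarrow> B u \<in> sets borel"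
    "AE w in M. w \<in> A \<longleftrightarrow> (\<forall>u\<in>U. W u w \<in> B u)"
    unfolding cylinders_def by blast
  from \<open>A' \<in> cylinders s\<close> obtain U' B' where A': "A' \<in> sets M"
    "finite U'" "U' \<subseteq> {0..s}" "\<And>u. u\<in>U' \<Longrightarrow> B' u \<in> sets borel"
    "AE w in M. w \<in> A' \<longleftrightarrow> (\<forall>u\<in>U'. W u w \<in> B' u)"
    unfolding cylinders_def by blast
  \<comment> \<open>\<open>B\<close> and \<open>B'\<close> say nothing outside \<open>U\<close> and
    \<open>U'\<close>, so each is extended by \<open>UNIV\<close> before intersecting.\<close>
  let ?C = "\<lambda>u. (if u \<in> U then B u else UNIV) \<inter> (if u \<in> U' then B' u else UNIV)"
  have "AE w in M. w \<in> A \<inter> A' \<longleftrightarrow> (\<forall>u\<in>U \<union> U'. W u w \<in> ?C u)"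
    using A(5) A'(5) by eventually_elim auto
  then show "A \<inter> A' \<in> cylinders s"
    unfolding cylinders_def using A A'
    by (intro CollectI conjI exI[of _ "U \<union> U'"] exI[of _ ?C]) auto
qed

lemma generator_subset_cylinders:
  assumes "0 \<le> s"
  shows "{W u -` B \<inter> space M | u B. 0 \<le> u \<and> u \<le> s \<and> B \<in> sets borel} \<union> null_sets M \<subseteq> cylinders s"
proof
  fix A assume "A \<in> {W u -` B \<inter> space M | u B. 0 \<le> u \<and> u \<le> s \<and> B \<in> sets borel} \<union> null_sets M"
  then consider u B where "A = W u -` B \<inter> space M" "0 \<le> u" "u \<le> s" "B \<in> sets borel" | "A \<in> null_sets M"
    by auto
  then show "A \<in> cylinders s"
  proof cases
    case 1
    then show ?thesis unfolding cylinders_def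
      by (intro CollectI conjI exI[of _ "{u}"] exI[of _ "\<lambda>_. B"]) (auto intro: measurable_sets)
  next
    case 2
    then have "AE w in M. w \<notin> A" by (rule AE_not_in)
    \<comment> \<open>A null set is almost surely the cylinder with the impossible condition
      \<open>{}\<close>; one time is needed to carry it, since the condition over no times is always
      true.\<close>
    then show ?thesis unfolding cylinders_def using assms 2
      by (intro CollectI conjI exI[of _ "{0}"] exI[of _ "\<lambda>_. {}"]) auto
  qed
qed

text \<open>Independence is given for increments along monotone sequences, while cylinders speak of
  values of \<open>W\<close>. Since \<open>W 0\<close> vanishes almost surely, each value is a
  partial sum of increments, and placing \<open>s'\<close> right after \<open>s\<close> makes the
  increment of interest the one with index \<open>m\<close>.\<close>

lemma cylinder_as_increments:
  assumes s: "0 \<le> s" and A: "A \<in> cylinders s" and ss': "s < s'"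
  obtains t m B where "0 \<le> t (0::nat)" "mono t" "t m = s" "t (Suc m) = s'" "\<forall>i. B i \<in> sets borel"
    "AE w in M. w \<in> A \<longleftrightarrow> (\<forall>i\<le>m. (\<Sum>l<i. W (t (Suc l)) w - W (t l) w) \<in> B i)"
proof -
  from A obtain U B where U: "finite U" "U \<subseteq> {0..s}" "\<And>u. u\<in>U \<Longrightarrow> B u \<in> sets borel"
    and AE: "AE w in M. w \<in> A \<longleftrightarrow> (\<forall>u\<in>U. W u w \<in> B u)"
    unfolding cylinders_def by blast
  \<comment> \<open>The time 0 starts the telescoping sums, and \<open>s\<close> becomes the last
    time before \<open>s'\<close>.\<close>
  define V where "V = insert 0 (insert s U)"
  define xs where "xs = sorted_list_of_set V"
  have V: "finite V" "V \<subseteq> {0..s}" "0 \<in> V" "s \<in> V" using U s by (auto simp: V_def)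
  have xs: "set xs = V" "sorted xs" "xs \<noteq> []" using V by (auto simp: xs_def)
  define m where "m = length xs - 1"
  have lm: "length xs = Suc m" using xs(3) by (cases xs) (auto simp: m_def)
  \<comment> \<open>Constant from \<open>Suc m\<close> on, because \<open>wiener_process\<close>
    asks for a monotone sequence on all naturals.\<close>
  define t where "t i = (if i \<le> m then xs ! i else s')" for i
  have le: "t i \<le> s" "0 \<le> t i" "t i \<in> V" if "i \<le> m" for i
  proof -
    show "t i \<in> V" using that lm xs(1) nth_mem[of i xs] by (auto simp: t_def)
    with V show "t i \<le> s" "0 \<le> t i" by auto
  qed
  have mono: "mono t"
  proof (rule monoI)
    fix i j :: nat assume "i \<le> j"
    then show "t i \<le> t j"
      using le[of i] ss' sorted_nth_mono[OF xs(2), of i j] lm by (auto simp: t_def)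
  qed
  have ex: "\<exists>i\<le>m. t i = u" if "u \<in> V" for u
    using that xs(1) lm by (metis in_set_conv_nth less_Suc_eq_le t_def)
  have t0: "t 0 = 0"
    using ex[OF V(3)] le[of 0] mono by (metis antisym bot_nat_0.extremum monoD)
  have tm: "t m = s"
    using ex[OF V(4)] le[of m] mono by (metis antisym monoD order_refl)
  define B' where "B' i = (if t i \<in> U then B (t i) else UNIV)" for i
  have W0: "AE w in M. W 0 w = 0" using wiener unfolding wiener_process_def by blast
  have "AE w in M. w \<in> A \<longleftrightarrow> (\<forall>i\<le>m. (\<Sum>l<i. W (t (Suc l)) w - W (t l) w) \<in> B' i)"
    using AE W0
  proof eventually_elim
    fix w assume *: "w \<in> A \<longleftrightarrow> (\<forall>u\<in>U. W u w \<in> B u)" "W 0 w = 0"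
    have "(\<Sum>l<i. W (t (Suc l)) w - W (t l) w) = W (t i) w" for i
      using * t0 sum_lessThan_telescope[of "\<lambda>l. W (t l) w" i] by simp
    moreover have "(\<forall>u\<in>U. W u w \<in> B u) \<longleftrightarrow> (\<forall>i\<le>m. W (t i) w \<in> B' i)"
      using ex by (auto simp: B'_def V_def) 
    ultimately show "w \<in> A \<longleftrightarrow> (\<forall>i\<le>m. (\<Sum>l<i. W (t (Suc l)) w - W (t l) w) \<in> B' i)"
      using * by simp
  qed
  moreover have "B' i \<in> sets borel" for i using U(3) by (simp add: B'_def)
  moreover have "t (Suc m) = s'" by (simp add: t_def)
  ultimately show thesis using that[of t m B'] t0 tm mono by auto
qed

text \<open>The first event depends only on the increments with indices below \<open>m\<close>, the
  second only on increment \<open>m\<close>; disjoint groups of an independent family are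
  independent.\<close>

lemma increments_indep:
  assumes "0 \<le> t (0::nat)" "mono t" "\<And>i. B i \<in> sets borel" "Z \<in> sets borel"
  shows "prob {w \<in> space M. (\<forall>i\<le>m. (\<Sum>l<i. W (t (Suc l)) w - W (t l) w) \<in> B i) \<and>
              W (t (Suc m)) w - W (t m) w \<in> Z}
       = prob {w \<in> space M. \<forall>i\<le>m. (\<Sum>l<i. W (t (Suc l)) w - W (t l) w) \<in> B i} *
         prob {w \<in> space M. W (t (Suc m)) w - W (t m) w \<in> Z}"
proof -
  let ?D = "\<lambda>i w. W (t (Suc i)) w - W (t i) w"
  have "indep_vars (\<lambda>_. borel) ?D {..<Suc m}"
    using wiener assms(1,2) unfolding wiener_process_def by blast
  from indep_var_restrict[OF this, of "{..<m}" "{m}"]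
  have iv: "indep_var (Pi\<^sub>M {..<m} (\<lambda>_. borel)) (\<lambda>w. restrict (\<lambda>i. ?D i w) {..<m})
      (Pi\<^sub>M {m} (\<lambda>_. borel)) (\<lambda>w. restrict (\<lambda>i. ?D i w) {m})" by auto
  let ?Pm = "\<lambda>I::nat set. (Pi\<^sub>M I (\<lambda>_. borel)) :: (nat \<Rightarrow> real^'k) measure"
  let ?B = "{f \<in> space (?Pm {..<m}). \<forall>i\<le>m. (\<Sum>l<i. f l) \<in> B i}"
  let ?Z = "{f \<in> space (?Pm {m}). f m \<in> Z}"
  have "(\<lambda>f. \<Sum>l<i. f l) \<in> borel_measurable (?Pm {..<m})" if "i \<le> m" for i
    using that by (intro borel_measurable_sum measurable_component_singleton) auto
  then have "(\<Inter>i\<in>{..m}. (\<lambda>f. \<Sum>l<i. f l) -` B i \<inter> space (?Pm {..<m})) \<in> sets (?Pm {..<m})"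
    using assms(3) by (intro sets.finite_INT) (auto intro: measurable_sets)
  also have "(\<Inter>i\<in>{..m}. (\<lambda>f. \<Sum>l<i. f l) -` B i \<inter> space (?Pm {..<m})) = ?B"
    by auto
  finally have B: "?B \<in> sets (?Pm {..<m})" .
  have Z: "?Z \<in> sets (?Pm {m})"
    using measurable_sets[OF measurable_component_singleton[of m "{m}" "\<lambda>_. borel"] assms(4)]
    by (simp add: vimage_def Int_def conj_commute)
  show ?thesis
    using indep_varD[OF iv B Z]
    by (simp add: vimage_def Int_def conj_ac space_PiM PiE_def Pi_def cong: conj_cong)
qed

text \<open>Dynkin's argument: the sets satisfying the product formula are closed under complements
  and disjoint unions, and the intersection-stable family \<open>cylinders s\<close> generates at
  least \<open>F s\<close>.\<close>

lemma increment_indep: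
  assumes s: "0 \<le> s" "s < s'" and A: "A \<in> sets (F s)" and Z: "Z \<in> sets borel"
  shows "prob (A \<inter> {w \<in> space M. W s' w - W s w \<in> Z}) = prob A * prob {w \<in> space M. W s' w - W s w \<in> Z}"
proof -
  let ?E = "{w \<in> space M. W s' w - W s w \<in> Z}"
  have [measurable]: "W s \<in> borel_measurable M" "W s' \<in> borel_measurable M" "Z \<in> sets borel" 
    using s Z by auto
  have E [measurable]: "?E \<in> sets M" by measurable
  have sub: "cylinders s \<subseteq> Pow (space M)"
    unfolding cylinders_def using sets.space_closed by blast
  have cM: "sigma_sets (space M) (cylinders s) \<subseteq> sets M"
    by (rule sets.sigma_sets_subset) (auto simp: cylinders_def)
  have "A \<in> sigma_sets (space M) (cylinders s)"
    using A sigma_sets_mono'[OF generator_subset_cylinders[OF s(1)]] unfolding sets_F by blast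
  from Int_stable_cylinders sub this show ?thesis
  proof (induction rule: sigma_sets_induct_disjoint)
    case (basic A)
    obtain t m B where t: "0 \<le> t (0::nat)" "mono t" "t m = s" "t (Suc m) = s'" "\<forall>i. B i \<in> sets borel"
      and AE: "AE w in M. w \<in> A \<longleftrightarrow> (\<forall>i\<le>m. (\<Sum>l<i. W (t (Suc l)) w - W (t l) w) \<in> B i)"
      by (rule cylinder_as_increments[OF s(1) basic s(2)], rule that)
    let ?C = "\<lambda>w. \<forall>i\<le>m. (\<Sum>l<i. W (t (Suc l)) w - W (t l) w) \<in> B i"
    have [measurable]: "W (t i) \<in> borel_measurable M" for i
      using t(1) monoD[OF t(2), of 0 i] by auto
    have [measurable]: "B i \<in> sets borel" for i using t(5) by simp
    have Am [measurable]: "A \<in> sets M" using basic by (simp add: cylinders_def)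
    have C [measurable]: "{w \<in> space M. ?C w} \<in> sets M" by measurable
    have "prob (A \<inter> ?E) = prob {w \<in> space M. ?C w \<and> W s' w - W s w \<in> Z}"
      using AE by (intro finite_measure_eq_AE) auto
    moreover have "prob A = prob {w \<in> space M. ?C w}"
      using AE AE_space by (intro finite_measure_eq_AE) (auto elim: eventually_elim2)
    ultimately show ?case
      using increments_indep[OF t(1,2) _ Z, of B m] t(3,4) by simp
  next
    case empty
    then show ?case by simp
  next
    case (compl A)
    then have Am: "A \<in> sets M" using cM by blast
    have "(space M - A) \<inter> ?E = ?E - A \<inter> ?E" by auto
    then have "prob ((space M - A) \<inter> ?E) = prob ?E - prob (A \<inter> ?E)"
      using Am E by (simp add: finite_measure_Diff)
    moreover have "prob (space M - A) = 1 - prob A" using prob_compl[OF Am] .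
    ultimately show ?case by (simp only: compl left_diff_distrib mult_1_left)
  next
    case (union A)
    then have Am: "range A \<subseteq> sets M" using cM by blast
    have "(\<lambda>i. prob (A i \<inter> ?E)) sums prob (\<Union>i. A i \<inter> ?E)"
      using Am E union(1) by (intro finite_measure_UNION) (auto simp: disjoint_family_on_def)
    moreover have "(\<lambda>i. prob (A i) * prob ?E) sums (prob (\<Union>i. A i) * prob ?E)"
      using Am union(1) by (intro sums_mult2 finite_measure_UNION) auto
    ultimately have "prob (\<Union>i. A i \<inter> ?E) = prob (\<Union>i. A i) * prob ?E"
      unfolding union(3) by (rule sums_unique2)
    then show ?case by (simp add: Int_UN_distrib2)
  qed
qed

lemma increment_indep_var:
  fixes a :: "'w \<Rightarrow> real" and g :: "real ^ 'k \<Rightarrow> real"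
  assumes s: "0 \<le> s" "s < s'" and a: "a \<in> borel_measurable (F s)" and g: "g \<in> borel_measurable borel"
  shows "indep_var borel a borel (\<lambda>w. g (W s' w - W s w))"
proof -
  have [measurable]: "W s \<in> borel_measurable M" "W s' \<in> borel_measurable M" using s by auto
  note [measurable] = g
  have Z: "(\<lambda>w. g (W s' w - W s w)) \<in> borel_measurable M" by measurable
  have aM: "a \<in> borel_measurable M" using a by (rule F_measurable_M)
  have "indep_set {a -` A \<inter> space M | A. A \<in> sets borel} {(\<lambda>w. g (W s' w - W s w)) -` A \<inter> space M | A. A \<in> sets borel}"
  proof (rule indep_setI)
    fix A B assume "A \<in> {a -` A \<inter> space M | A. A \<in> sets borel}"
      "B \<in> {(\<lambda>w. g (W s' w - W s w)) -` A \<inter> space M | A. A \<in> sets borel}"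
    then obtain A' B' where AB: "A = a -` A' \<inter> space M" "A' \<in> sets borel" "B' \<in> sets borel"
      and B: "B = (\<lambda>w. g (W s' w - W s w)) -` B' \<inter> space M" by auto
    have "A \<in> sets (F s)" using measurable_sets[OF a AB(2)] AB(1) by simp
    from increment_indep[OF s this measurable_sets_borel[OF g AB(3)]] show "prob (A \<inter> B) = prob A * prob B"
      by (simp add: B vimage_def Int_def conj_commute)
  qed (use aM Z in \<open>auto intro: measurable_sets\<close>)
  moreover have "Int_stable {X -` A \<inter> space M | A. A \<in> sets borel}" for X :: "'w \<Rightarrow> real"
    by (rule Int_stableI) (auto, metis sets.Int vimage_Int Int_assoc Int_left_commute inf.idem)
  ultimately show ?thesis
    unfolding indep_var_eq using aM Z by (intro conjI indep_set_sigma_sets) auto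
qed

section \<open>Moments of increments weighted by coefficients known at their start\<close>

lemma expectation_mult_increment:
  fixes a :: "'w \<Rightarrow> real" and g :: "real ^ 'k \<Rightarrow> real"
  assumes s: "0 \<le> s" "s < s'" and a: "a \<in> borel_measurable (F s)" "integrable M a"
    and g: "g \<in> borel_measurable borel" "integrable M (\<lambda>w. g (W s' w - W s w))"
  shows "has_bochner_integral M (\<lambda>w. a w * g (W s' w - W s w))
    (expectation a * expectation (\<lambda>w. g (W s' w - W s w)))"
proof -
  note iv = increment_indep_var[OF s a(1) g(1)]
  from indep_var_lebesgue_integral[OF iv a(2) g(2)] indep_var_integrable[OF iv a(2) g(2)]
  show ?thesis by (simp add: has_bochner_integral_iff)
qed


lemma increment_component:
  assumes "0 \<le> s" "s < s'"
  shows "distributed M lborel (\<lambda>w. (W s' w - W s w) $ j) (normal_density 0 (sqrt (s' - s)))"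
    and "indep_vars (\<lambda>_. borel) (\<lambda>j w. (W s' w - W s w) $ j) UNIV"
  using wiener assms unfolding wiener_process_def by blast+

lemma increment_component_power:
  assumes s: "0 \<le> s" "s < s'"
  shows "integrable M (\<lambda>w. ((W s' w - W s w) $ j) ^ i)"
    and "expectation (\<lambda>w. ((W s' w - W s w) $ j) ^ i) =
      (\<integral>x. normal_density 0 (sqrt (s' - s)) x * x ^ i \<partial>lborel)"
proof -
  note D = increment_component(1)[OF s, of j]
  have "integrable lborel (\<lambda>x. normal_density 0 (sqrt (s' - s)) x * (x - 0) ^ i)"
    using s by (intro integrable_normal_moment) auto
  then show "integrable M (\<lambda>w. ((W s' w - W s w) $ j) ^ i)"
    using distributed_integrable[OF D, of "\<lambda>x. x ^ i"] by simp
  show "expectation (\<lambda>w. ((W s' w - W s w) $ j) ^ i) =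
      (\<integral>x. normal_density 0 (sqrt (s' - s)) x * x ^ i \<partial>lborel)"
    using distributed_integral[OF D, of "\<lambda>x. x ^ i"] by simp
qed

text \<open>Gaussian moments: the variance makes the compensators below exact, and the fourth
  moment, being quadratic in \<open>s' - s\<close>, makes remainders negligible on fine
  grids.\<close>

lemma increment_moments:
  assumes s: "0 \<le> s" "s < s'"
  shows "expectation (\<lambda>w. (W s' w - W s w) $ j) = 0"
    and "expectation (\<lambda>w. ((W s' w - W s w) $ j)\<^sup>2) = s' - s"
    and "expectation (\<lambda>w. ((W s' w - W s w) $ j) ^ 4) = 3 * (s' - s)\<^sup>2"
proof -
  have p: "0 < sqrt (s' - s)" and sq: "(sqrt (s' - s)) ^ 4 = (s' - s)\<^sup>2"
    using s by (auto simp: power4_eq_xxxx power2_eq_square)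
  show "expectation (\<lambda>w. (W s' w - W s w) $ j) = 0"
    using increment_component_power(2)[OF s, of j 1] integral_normal_moment_odd[OF p, of 0 0] by simp
  show "expectation (\<lambda>w. ((W s' w - W s w) $ j)\<^sup>2) = s' - s"
    using increment_component_power(2)[OF s, of j 2] integral_normal_moment_even[OF p, of 0 1] s
    by (simp add: fact_numeral)
  show "expectation (\<lambda>w. ((W s' w - W s w) $ j) ^ 4) = 3 * (s' - s)\<^sup>2"
    using increment_component_power(2)[OF s, of j 4] integral_normal_moment_even[OF p, of 0 2] s
    by (simp add: fact_numeral power_divide power2_eq_square)
qed

lemma increment_mixed_moment:
  assumes s: "0 \<le> s" "s < s'"
  shows "has_bochner_integral M (\<lambda>w. (W s' w - W s w) $ i * (W s' w - W s w) $ j) (if i = j then s' - s else 0)"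
proof (cases "i = j")
  case True
  then show ?thesis using increment_component_power(1)[OF s, of j 2] increment_moments(2)[OF s, of j]
    by (simp add: has_bochner_integral_iff power2_eq_square)
next
  case False
  have iv: "indep_vars (\<lambda>_. borel) (\<lambda>j w. (W s' w - W s w) $ j) {i, j}"
    using increment_component(2)[OF s] by (rule indep_vars_subset) auto
  have int: "integrable M (\<lambda>w. (W s' w - W s w) $ j)" for j
    using increment_component_power(1)[OF s, of j 1] by simp
  show ?thesis
    using indep_vars_lebesgue_integral[OF _ iv] indep_vars_integrable[OF _ iv] int False
      increment_moments(1)[OF s]
    by (simp add: has_bochner_integral_iff)
qed

lemma norm_vec_power2: "(norm (z :: real ^ 'a))\<^sup>2 = (\<Sum>j\<in>UNIV. (z $ j)\<^sup>2)"
  unfolding norm_vec_def L2_set_def by (simp add: sum_nonneg)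

lemma norm_vec_power4_le: "(norm (z :: real ^ 'a)) ^ 4 \<le> CARD('a) * (\<Sum>j\<in>UNIV. (z $ j) ^ 4)"
proof -
  have "(norm z) ^ 4 = (\<Sum>j\<in>UNIV. (z $ j)\<^sup>2)\<^sup>2"
    unfolding norm_vec_power2[symmetric] by (simp flip: power_mult)
  also have "\<dots> \<le> CARD('a) * (\<Sum>j\<in>UNIV. ((z $ j)\<^sup>2)\<^sup>2)"
    using sum_squared_le_sum_of_squares[of "\<lambda>j. (z $ j)\<^sup>2" UNIV] by (simp add: mult.commute)
  finally show ?thesis by (simp flip: power_mult)
qed

lemma bounded_F_integrable:
  fixes a :: "'w \<Rightarrow> real"
  assumes "a \<in> borel_measurable (F s)" "\<And>w. w \<in> space M \<Longrightarrow> \<bar>a w\<bar> \<le> B"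
  shows "integrable M a"
  using assms by (intro integrable_const_bound[of _ B]) (auto intro: F_measurable_M)

text \<open>A martingale difference: each coordinate of \<open>c\<close> is independent of the
  corresponding centred coordinate of the increment, and boundedness provides integrability.\<close>

lemma inner_increment:
  fixes c :: "'w \<Rightarrow> real ^ 'k"
  assumes s: "0 \<le> s" "s < s'" and c: "c \<in> borel_measurable (F s)" "\<And>w. w \<in> space M \<Longrightarrow> norm (c w) \<le> B"
  shows "has_bochner_integral M (\<lambda>w. c w \<bullet> (W s' w - W s w)) 0"
proof -
  have "has_bochner_integral M (\<lambda>w. c w $ j * (W s' w - W s w) $ j) 0" for j
  proof -
    have m: "(\<lambda>w. c w $ j) \<in> borel_measurable (F s)"
      using c(1) by (rule borel_measurable_vec_nth)
    have "integrable M (\<lambda>w. c w $ j)"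
      using c(2) component_le_norm_cart order_trans by (intro bounded_F_integrable[OF m, of B]) blast
    from expectation_mult_increment[OF s m this, of "\<lambda>z. z $ j"] show ?thesis
      using increment_component_power(1)[OF s, of j 1] increment_moments(1)[OF s, of j]
      by (simp add: borel_measurable_continuous_onI continuous_on_component)
  qed
  then have "has_bochner_integral M (\<lambda>w. \<Sum>j\<in>UNIV. c w $ j * (W s' w - W s w) $ j) (\<Sum>j\<in>(UNIV::'k set). 0)"
    by (intro has_bochner_integral_sum)
  then show ?thesis
    by (simp add: inner_vec_def)
qed

text \<open>Distinct coordinates of the increment are independent and centred, so only the diagonal
  of \<open>A\<close> contributes to the mean, each entry with weight \<open>s' - s\<close>.\<close>

lemma quadratic_increment:
  fixes A :: "'w \<Rightarrow> real ^ 'k ^ 'k"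
  assumes s: "0 \<le> s" "s < s'" and A: "A \<in> borel_measurable (F s)" "\<And>w. w \<in> space M \<Longrightarrow> norm (A w) \<le> B"
  shows "has_bochner_integral M (\<lambda>w. (W s' w - W s w) \<bullet> (A w *v (W s' w - W s w)) - (s' - s) * trace (A w)) 0"
proof -
  let ?z = "\<lambda>w. W s' w - W s w"
  have *: "integrable M (\<lambda>w. A w $ i $ j)"
    "has_bochner_integral M (\<lambda>w. A w $ i $ j * (?z w $ i * ?z w $ j))
      (expectation (\<lambda>w. A w $ i $ j) * (if i = j then s' - s else 0))" for i j
  proof -
    have m: "(\<lambda>w. A w $ i $ j) \<in> borel_measurable (F s)"
      using A(1) by (intro borel_measurable_vec_nth)
    have "\<bar>A w $ i $ j\<bar> \<le> B" if "w \<in> space M" for w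
      using A(2)[OF that] component_le_norm_cart[of "A w $ i" j] Finite_Cartesian_Product.norm_nth_le[of "A w" i] by linarith
    then show int: "integrable M (\<lambda>w. A w $ i $ j)"
      by (rule bounded_F_integrable[OF m])
    have g: "(\<lambda>z::real^'k. z $ i * z $ j) \<in> borel_measurable borel"
      by (intro borel_measurable_continuous_onI continuous_intros)
    show "has_bochner_integral M (\<lambda>w. A w $ i $ j * (?z w $ i * ?z w $ j))
      (expectation (\<lambda>w. A w $ i $ j) * (if i = j then s' - s else 0))"
      using expectation_mult_increment[OF s m int g] increment_mixed_moment[OF s, of i j]
      by (simp add: has_bochner_integral_iff)
  qed
  have "has_bochner_integral M (\<lambda>w. \<Sum>i\<in>UNIV. \<Sum>j\<in>UNIV. A w $ i $ j * (?z w $ i * ?z w $ j))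
    (\<Sum>i\<in>UNIV. \<Sum>j\<in>UNIV. expectation (\<lambda>w. A w $ i $ j) * (if i = j then s' - s else 0))"
    by (intro has_bochner_integral_sum *)
  also have "(\<Sum>i\<in>UNIV. \<Sum>j\<in>UNIV. expectation (\<lambda>w. A w $ i $ j) * (if i = j then s' - s else 0))
    = (s' - s) * (\<Sum>i\<in>UNIV. expectation (\<lambda>w. A w $ i $ i))"
    by (simp add: sum_distrib_left mult.commute[of "s' - s"] if_distrib[of "\<lambda>x. _ * x"] cong: if_cong)
  finally have 1: "has_bochner_integral M (\<lambda>w. \<Sum>i\<in>UNIV. \<Sum>j\<in>UNIV. A w $ i $ j * (?z w $ i * ?z w $ j))
    ((s' - s) * (\<Sum>i\<in>UNIV. expectation (\<lambda>w. A w $ i $ i)))" .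
  have 2: "has_bochner_integral M (\<lambda>w. (s' - s) * trace (A w)) ((s' - s) * (\<Sum>i\<in>UNIV. expectation (\<lambda>w. A w $ i $ i)))"
    unfolding trace_def using *(1)
    by (intro has_bochner_integral_mult_right has_bochner_integral_sum) (auto simp: has_bochner_integral_iff)
  have 3: "?z w \<bullet> (A w *v ?z w) = (\<Sum>i\<in>UNIV. \<Sum>j\<in>UNIV. A w $ i $ j * (?z w $ i * ?z w $ j))" for w
    by (simp add: inner_vec_def matrix_vector_mult_def sum_distrib_left mult_ac)
  from has_bochner_integral_diff[OF 1 2] show ?thesis by (simp add: 3)
qed

text \<open>\<open>real CARD('k) * (s' - s)\<close> is the mean of the squared norm. In the last
  bound one factor \<open>CARD('k)\<close> comes from \<open>norm_vec_power4_le\<close>, the other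
  from adding the coordinates, and the 3 from the Gaussian fourth moment.\<close>

lemma norm_increment:
  fixes q :: "'w \<Rightarrow> real"
  assumes s: "0 \<le> s" "s < s'" and q: "q \<in> borel_measurable (F s)" "\<And>w. w \<in> space M \<Longrightarrow> \<bar>q w\<bar> \<le> B"
  shows "has_bochner_integral M (\<lambda>w. q w * ((norm (W s' w - W s w))\<^sup>2 - real CARD('k) * (s' - s))) 0"
    and "integrable M (\<lambda>w. q w * norm (W s' w - W s w) ^ 4)"
    and "(\<And>w. 0 \<le> q w) \<Longrightarrow>
      expectation (\<lambda>w. q w * norm (W s' w - W s w) ^ 4) \<le> 3 * (real CARD('k))\<^sup>2 * (s' - s)\<^sup>2 * expectation q"
proof -
  let ?z = "\<lambda>w. W s' w - W s w"
  have [measurable]: "?z \<in> borel_measurable M" using s by auto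
  have iq: "integrable M q" by (rule bounded_F_integrable[OF q])
  have m: "(\<lambda>z::real^'k. (z $ j) ^ n) \<in> borel_measurable borel" for j n
    by (intro borel_measurable_continuous_onI continuous_intros)
  have pw: "has_bochner_integral M (\<lambda>w. q w * (?z w $ j) ^ n) (expectation q * expectation (\<lambda>w. (?z w $ j) ^ n))" for j n
    using expectation_mult_increment[OF s q(1) iq m] increment_component_power(1)[OF s] by blast
  have "has_bochner_integral M (\<lambda>w. \<Sum>j\<in>UNIV. q w * (?z w $ j)\<^sup>2) (\<Sum>j\<in>(UNIV::'k set). expectation q * (s' - s))"
    using pw[of _ 2] increment_moments(2)[OF s] by (intro has_bochner_integral_sum) simp
  also have "(\<Sum>j\<in>(UNIV::'k set). expectation q * (s' - s)) = expectation q * (real CARD('k) * (s' - s))"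
    by simp
  finally have 2: "has_bochner_integral M (\<lambda>w. \<Sum>j\<in>UNIV. q w * (?z w $ j)\<^sup>2) (expectation q * (real CARD('k) * (s' - s)))" .
  have "has_bochner_integral M (\<lambda>w. q w * (real CARD('k) * (s' - s))) (expectation q * (real CARD('k) * (s' - s)))"
    using iq by (intro has_bochner_integral_mult_left) (simp add: has_bochner_integral_iff)
  from has_bochner_integral_diff[OF 2 this]
  show "has_bochner_integral M (\<lambda>w. q w * ((norm (W s' w - W s w))\<^sup>2 - real CARD('k) * (s' - s))) 0"
    by (simp add: norm_vec_power2 flip: right_diff_distrib[of "q _"] sum_distrib_left)
  have 4: "has_bochner_integral M (\<lambda>w. \<Sum>j\<in>UNIV. q w * (?z w $ j) ^ 4) (\<Sum>j\<in>(UNIV::'k set). expectation q * (3 * (s' - s)\<^sup>2))"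
    using pw[of _ 4] increment_moments(3)[OF s] by (intro has_bochner_integral_sum) simp
  from has_bochner_integral_mult_right[OF this, of "real CARD('k)"]
  have 5: "has_bochner_integral M (\<lambda>w. CARD('k) * (\<Sum>j\<in>UNIV. q w * (?z w $ j) ^ 4)) (3 * (real CARD('k))\<^sup>2 * (s' - s)\<^sup>2 * expectation q)"
    by (simp add: power2_eq_square mult_ac)
  have le: "\<bar>q w * norm (?z w) ^ 4\<bar> \<le> \<bar>CARD('k) * (\<Sum>j\<in>UNIV. q w * (?z w $ j) ^ 4)\<bar>" for w
  proof -
    have "\<bar>q w\<bar> * norm (?z w) ^ 4 \<le> \<bar>q w\<bar> * (CARD('k) * (\<Sum>j\<in>UNIV. (?z w $ j) ^ 4))"
      by (intro mult_left_mono norm_vec_power4_le) auto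
    then show ?thesis
      by (simp add: abs_mult sum_nonneg abs_of_nonneg mult_ac flip: sum_distrib_left)
  qed
  show int: "integrable M (\<lambda>w. q w * norm (W s' w - W s w) ^ 4)"
    using 5 by (rule Bochner_Integration.integrable_bound[OF integrable.intros])
      (use le F_measurable_M[OF q(1)] in auto)
  assume "\<And>w. 0 \<le> q w"
  then have "q w * norm (?z w) ^ 4 \<le> CARD('k) * (\<Sum>j\<in>UNIV. q w * (?z w $ j) ^ 4)" for w
    using le[of w] by (simp add: sum_nonneg)
  from integral_mono[OF int integrable.intros[OF 5] this]
  show "expectation (\<lambda>w. q w * norm (W s' w - W s w) ^ 4) \<le> 3 * (real CARD('k))\<^sup>2 * (s' - s)\<^sup>2 * expectation q"
    unfolding has_bochner_integral_integral_eq[OF 5] .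
qed

end

section \<open>Taylor expansion and the maximum principle\<close>

lemma norm_matrix_vector_mult_le: "norm (A *v x) \<le> norm (A :: real ^ 'm ^ 'n) * norm x"
proof -
  have "norm (A *v x) \<le> L2_set (\<lambda>i. norm (A $ i) * norm x) UNIV"
    unfolding norm_vec_def[of "A *v x"]
  proof (rule L2_set_mono)
    fix i :: 'n
    have "(A *v x) $ i = A $ i \<bullet> x" by (simp add: matrix_vector_mult_def inner_vec_def)
    then show "norm ((A *v x) $ i) \<le> norm (A $ i) * norm x"
      using Cauchy_Schwarz_ineq2[of "A $ i" x] by simp
  qed simp
  also have "\<dots> = norm A * norm x"
    unfolding norm_vec_def[of A] by (simp add: L2_set_left_distrib)
  finally show ?thesis .
qed

text \<open>Turns the trace term of the generator into a quadratic form in the noise coefficient,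
  which norm inequalities can handle.\<close>

lemma inner_matrix_eq_trace: "(A :: real ^ 'm ^ 'n) \<bullet> B = trace (transpose A ** B)"
proof -
  have "A \<bullet> B = (\<Sum>i\<in>UNIV. \<Sum>j\<in>UNIV. A $ i $ j * B $ i $ j)"
    by (simp add: inner_vec_def)
  also have "\<dots> = (\<Sum>j\<in>UNIV. \<Sum>i\<in>UNIV. A $ i $ j * B $ i $ j)" by (rule sum.swap)
  finally show ?thesis by (simp add: trace_def matrix_matrix_mult_def transpose_def)
qed

lemma norm_transpose: "norm (transpose (A :: real ^ 'm ^ 'n)) = norm A"
proof -
  have "transpose A \<bullet> transpose A = (\<Sum>j\<in>UNIV. \<Sum>i\<in>UNIV. A $ i $ j * A $ i $ j)"
    by (simp add: inner_vec_def transpose_def)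
  also have "\<dots> = A \<bullet> A" by (subst sum.swap) (simp add: inner_vec_def)
  finally show ?thesis by (simp add: norm_eq)
qed

lemma norm_matrix_mult_le: "norm ((A :: real ^ 'm ^ 'n) ** (B :: real ^ 'l ^ 'm)) \<le> norm A * norm B"
proof -
  have "norm (A ** B) \<le> L2_set (\<lambda>i. norm (A $ i) * norm B) UNIV"
    unfolding norm_vec_def[of "A ** B"]
  proof (rule L2_set_mono)
    fix i :: 'n
    have "(A ** B) $ i = transpose B *v (A $ i)"
      by (simp add: vec_eq_iff matrix_matrix_mult_def matrix_vector_mult_def transpose_def mult.commute)
    then show "norm ((A ** B) $ i) \<le> norm (A $ i) * norm B"
      using norm_matrix_vector_mult_le[of "transpose B" "A $ i"] by (simp add: norm_transpose mult.commute)
  qed simp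
  also have "\<dots> = norm A * norm B"
    unfolding norm_vec_def[of A] by (simp add: L2_set_left_distrib)
  finally show ?thesis .
qed

section \<open>Gradient and Hessian along lines\<close>

lemma gradient_works:
  fixes f :: "real ^ 'n \<Rightarrow> real"
  assumes "f differentiable (at x)"
  shows "(f has_derivative (\<lambda>h. gradient f x \<bullet> h)) (at x)"
proof -
  let ?f' = "frechet_derivative f (at x)"
  have f': "(f has_derivative ?f') (at x)" using assms frechet_derivative_works by blast
  then have lin: "linear ?f'" by (simp add: has_derivative_bounded_linear bounded_linear.linear)
  have "?f' h = gradient f x \<bullet> h" for h
  proof -
    have "?f' h = ?f' (\<Sum>i\<in>UNIV. h $ i *s axis i 1)" by (simp add: basis_expansion)
    also have "\<dots> = (\<Sum>i\<in>UNIV. h $ i * ?f' (axis i 1))"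
      by (simp add: linear_sum[OF lin] linear_scale[OF lin] scalar_mult_eq_scaleR)
    finally show ?thesis by (simp add: gradient_def inner_vec_def mult.commute)
  qed
  then have "?f' = (\<lambda>h. gradient f x \<bullet> h)" by (rule ext)
  with f' show ?thesis by simp
qed

lemma hessian_works:
  assumes "gradient f differentiable (at x)"
  shows "(gradient f has_derivative (\<lambda>h. hessian f x *v h)) (at x)"
  using assms unfolding hessian_def by (simp add: jacobian_works)

lemma gradient_line:
  assumes "\<And>x. f differentiable (at x)"
  shows "((\<lambda>r. f (x + r *\<^sub>R y)) has_real_derivative gradient f (x + r *\<^sub>R y) \<bullet> y) (at r)"
proof -
  have "((\<lambda>r. f (x + r *\<^sub>R y)) has_derivative (\<lambda>h. gradient f (x + r *\<^sub>R y) \<bullet> (h *\<^sub>R y))) (at r)"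
    by (rule has_derivative_compose[where g=f, OF _ gradient_works[OF assms]])
       (auto intro!: derivative_eq_intros)
  then show ?thesis by (simp add: has_field_derivative_def mult.commute[of _ "_ \<bullet> _"])
qed

lemma hessian_line:
  assumes "\<And>x. gradient f differentiable (at x)"
  shows "((\<lambda>r. gradient f (x + r *\<^sub>R y) \<bullet> y) has_real_derivative y \<bullet> (hessian f (x + r *\<^sub>R y) *v y)) (at r)"
proof -
  have "((\<lambda>r. gradient f (x + r *\<^sub>R y)) has_derivative (\<lambda>h. hessian f (x + r *\<^sub>R y) *v (h *\<^sub>R y))) (at r)"
    by (rule has_derivative_compose[where g="gradient f", OF _ hessian_works[OF assms]])
       (auto intro!: derivative_eq_intros)
  from has_derivative_inner_left[OF this, of y] show ?thesis
    by (simp add: has_field_derivative_def matrix_vector_mult_scaleR inner_commute mult.commute[of _ "_ \<bullet> _"])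
qed

text \<open>Maclaurin's formula with Lagrange remainder for the restriction of \<open>f\<close> to
  the line through \<open>x\<close> in direction \<open>y\<close>.\<close>

lemma taylor_hessian:
  assumes "\<And>x. f differentiable (at x)" "\<And>x. gradient f differentiable (at x)"
  obtains r where "0 < r" "r < 1"
    "f (x + y) = f x + gradient f x \<bullet> y + 1 / 2 * (y \<bullet> (hessian f (x + r *\<^sub>R y) *v y))"
proof -
  \<comment> \<open>The restriction and its first two derivatives; members beyond index 2 are
    padding.\<close>
  let ?d = "\<lambda>m::nat. if m = 0 then (\<lambda>r. f (x + r *\<^sub>R y)) else if m = 1 then (\<lambda>r. gradient f (x + r *\<^sub>R y) \<bullet> y)
     else (\<lambda>r. y \<bullet> (hessian f (x + r *\<^sub>R y) *v y))"
  have "\<forall>m t. m < 2 \<and> 0 \<le> t \<and> t \<le> 1 \<longrightarrow> DERIV (?d m) t :> ?d (Suc m) t"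
    using gradient_line[OF assms(1)] hessian_line[OF assms(2)] by (auto simp: less_2_cases_iff)
  from Maclaurin[of 1 2 ?d "\<lambda>r. f (x + r *\<^sub>R y)", OF _ _ _ this]
  show thesis using that by (auto simp: numeral_2_eq_2)
qed

lemma C12D:
  assumes "C12 T v" "t \<in> {0..T}"
  shows "((\<lambda>s. v s x) has_real_derivative time_deriv T v t x) (at t within {0..T})"
    and "v t differentiable (at x)" and "gradient (v t) differentiable (at x)"
proof -
  have d: "(\<lambda>s. v s x) differentiable (at t within {0..T}) \<and> v t differentiable (at x) \<and>
      gradient (v t) differentiable (at x)"
    using assms unfolding C12_def by blast
  then show "((\<lambda>s. v s x) has_real_derivative time_deriv T v t x) (at t within {0..T})"
    unfolding time_deriv_def has_real_derivative_iff_has_vector_derivative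
    using vector_derivative_works by blast
  show "v t differentiable (at x)" "gradient (v t) differentiable (at x)" using d by auto
qed

text \<open>Tested on lines through \<open>x\<close>: the derivative vanishes at 0 by minimality.
  Were the second derivative negative, the first would be negative just to the right of 0, and by
  the mean value theorem \<open>f\<close> would drop below \<open>f x\<close>.\<close>

lemma local_min_second_order:
  assumes f: "\<And>x. f differentiable (at x)" "\<And>x. gradient f differentiable (at x)"
    and U: "open U" "x \<in> U" "\<And>z. z \<in> U \<Longrightarrow> f x \<le> f z"
  shows "gradient f x = 0" and "0 \<le> y \<bullet> (hessian f x *v y)"
proof -
  have near: "\<exists>d>0. \<forall>r. \<bar>r\<bar> < d \<longrightarrow> f x \<le> f (x + r *\<^sub>R y)" for y
  proof -
    have "open ((\<lambda>r. x + r *\<^sub>R y) -` U)"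
      by (intro open_vimage U continuous_intros)
    moreover have "0 \<in> (\<lambda>r. x + r *\<^sub>R y) -` U" using U by simp
    ultimately obtain d where "d > 0" "ball 0 d \<subseteq> (\<lambda>r. x + r *\<^sub>R y) -` U"
      using open_contains_ball by blast
    then show ?thesis using U(3) by (intro exI[of _ d]) (auto simp: subset_iff)
  qed
  have g0: "gradient f x \<bullet> y = 0" for y
  proof -
    obtain d where d: "d > 0" "\<And>r. \<bar>r\<bar> < d \<Longrightarrow> f x \<le> f (x + r *\<^sub>R y)" using near by blast
    show ?thesis
      using gradient_line[OF f(1), of x y 0] d by (intro DERIV_local_min[of _ _ 0 d]) auto
  qed
  then show "gradient f x = 0" using inner_eq_zero_iff by blast
  show "0 \<le> y \<bullet> (hessian f x *v y)"
  proof (rule ccontr)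
    assume "\<not> 0 \<le> y \<bullet> (hessian f x *v y)"
    then have "y \<bullet> (hessian f (x + 0 *\<^sub>R y) *v y) < 0" by simp
    from DERIV_neg_dec_right[OF hessian_line[OF f(2)] this]
    obtain d' where d': "d' > 0" "\<And>h. h > 0 \<Longrightarrow> h < d' \<Longrightarrow> gradient f (x + h *\<^sub>R y) \<bullet> y < 0"
      using g0 by auto
    obtain d where d: "d > 0" "\<And>r. \<bar>r\<bar> < d \<Longrightarrow> f x \<le> f (x + r *\<^sub>R y)" using near by blast
    define c where "c = min d d' / 2"
    have c: "0 < c" "c < d" "c < d'" using d(1) d'(1) by (auto simp: c_def)
    obtain l where l: "0 < l" "l < c"
      "f (x + c *\<^sub>R y) - f (x + 0 *\<^sub>R y) = (c - 0) * (gradient f (x + l *\<^sub>R y) \<bullet> y)"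
      using MVT2[OF c(1), of "\<lambda>r. f (x + r *\<^sub>R y)" "\<lambda>r. gradient f (x + r *\<^sub>R y) \<bullet> y"]
        gradient_line[OF f(1)] by auto
    have "c * (gradient f (x + l *\<^sub>R y) \<bullet> y) < 0"
      using c l d'(2)[of l] by (intro mult_pos_neg) auto
    then show False using l(3) d(2)[of c] c by simp
  qed
qed

text \<open>The weak parabolic maximum principle: at a minimum of \<open>v + \<epsilon> (T - t)\<close> before time \<open>T\<close> both the
  generator and the time derivative of \<open>v\<close> would be at least \<open>\<epsilon>\<close>.\<close>

lemma supersolution_nonneg:
  fixes v :: "real \<Rightarrow> real ^ 'n \<Rightarrow> real"
  assumes v: "C12 T v" and T: "0 < T" and C: "compact C" and U: "open U" "U \<subseteq> C"
    and gen: "\<And>t x. t \<in> {0..T} \<Longrightarrow> x \<in> U \<Longrightarrow> generator T b \<sigma> v t x \<le> 0"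
    and bd: "\<And>t x. t \<in> {0..T} \<Longrightarrow> x \<in> C - U \<Longrightarrow> time_deriv T v t x \<le> 0"
    and fin: "\<And>x. x \<in> C \<Longrightarrow> 0 \<le> v T x"
    and tx: "t \<in> {0..T}" "x \<in> C"
  shows "0 \<le> v t x"
proof -
  have key: "0 \<le> v t x + \<epsilon> * (T - t)" if e: "\<epsilon> > 0" for \<epsilon>
  proof -
    let ?u = "\<lambda>(t, x). v t x + \<epsilon> * (T - t)"
    have "continuous_on ({0..T} \<times> C) (\<lambda>(t, x). v t x)"
      using v unfolding C12_def by (auto intro: continuous_on_subset)
    then have "continuous_on ({0..T} \<times> C) ?u"
      unfolding case_prod_beta by (intro continuous_intros)
    then obtain p where p: "p \<in> {0..T} \<times> C" "\<And>q. q \<in> {0..T} \<times> C \<Longrightarrow> ?u p \<le> ?u q"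
      using continuous_attains_inf[of "{0..T} \<times> C" ?u] C tx compact_Times[OF compact_Icc C] by blast
    obtain t0 x0 where t0: "p = (t0, x0)" "t0 \<in> {0..T}" "x0 \<in> C" using p(1) by auto
    have min: "v t0 x0 + \<epsilon> * (T - t0) \<le> v s y + \<epsilon> * (T - s)" if "s \<in> {0..T}" "y \<in> C" for s y
      using p(2)[of "(s, y)"] that t0 by simp
    have "t0 = T"
    proof (rule ccontr)
      assume "t0 \<noteq> T"
      then have lt: "t0 < T" using t0 by simp
      \<comment> \<open>Only later times are compared, so \<open>s - t0\<close> is positive and
        minimality bounds the difference quotient from below by \<open>\<epsilon>\<close>. This also
        covers \<open>t0 = 0\<close>.\<close>
      have "((\<lambda>s. v s x0) has_real_derivative time_deriv T v t0 x0) (at t0 within {t0..T})"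
        using C12D(1)[OF v t0(2)] by (rule has_field_derivative_subset) (use t0 in auto)
      then have lim: "((\<lambda>s. (v s x0 - v t0 x0) / (s - t0)) \<longlongrightarrow> time_deriv T v t0 x0) (at t0 within {t0..T})"
        by (simp add: has_field_derivative_iff)
      have ev: "\<forall>\<^sub>F s in at t0 within {t0..T}. \<epsilon> \<le> (v s x0 - v t0 x0) / (s - t0)"
        unfolding eventually_at
      proof (intro exI[of _ 1] conjI ballI impI)
        fix s assume s: "s \<in> {t0..T}" "s \<noteq> t0 \<and> dist s t0 < 1"
        then have "\<epsilon> * (s - t0) \<le> v s x0 - v t0 x0"
          using min[of s x0] t0 by (auto simp: algebra_simps)
        then show "\<epsilon> \<le> (v s x0 - v t0 x0) / (s - t0)" using s by (auto simp: field_simps)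
      qed simp
      have nt: "at t0 within {t0..T} \<noteq> bot" using lt by (simp add: at_within_Icc_at_right)
      have td: "\<epsilon> \<le> time_deriv T v t0 x0" by (rule tendsto_lowerbound[OF lim ev nt])
      show False
      proof (cases "x0 \<in> U")
        case False
        then show False using bd[OF t0(2), of x0] t0(3) td e by auto
      next
        case True
        have m: "v t0 x0 \<le> v t0 z" if "z \<in> U" for z
          using min[OF t0(2), of z] that U by auto
        note so = local_min_second_order[OF C12D(2,3)[OF v t0(2)] U(1) True m]
        \<comment> \<open>The trace is the sum of the values of the Hessian form at the columns of
          \<open>\<sigma> x0\<close>, each nonnegative at a spatial minimum.\<close>
        have "trace (transpose (\<sigma> x0) ** hessian (v t0) x0 ** \<sigma> x0)
          = (\<Sum>j\<in>UNIV. column j (\<sigma> x0) \<bullet> (hessian (v t0) x0 *v column j (\<sigma> x0)))"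
          unfolding trace_def matrix_mul_assoc[symmetric]
          by (intro sum.cong) (auto simp: matrix_matrix_mult_def transpose_def column_def inner_vec_def matrix_vector_mult_def)
        also have "\<dots> \<ge> 0" using so(2) by (intro sum_nonneg) auto
        finally show False using gen[OF t0(2) True] td e so(1) by (simp add: generator_def)
      qed
    qed
    then have "0 \<le> v t0 x0 + \<epsilon> * (T - t0)" using fin[OF t0(3)] by simp
    also have "\<dots> \<le> v t x + \<epsilon> * (T - t)" using min tx by simp
    finally show ?thesis .
  qed
  show ?thesis
  proof (rule field_le_epsilon)
    fix e :: real assume e: "e > 0"
    have "0 \<le> v t x + e / T * (T - t)" using key[of "e / T"] e T by simp
    also have "e / T * (T - t) \<le> e" using e T tx by (simp add: field_simps)
    finally show "0 \<le> v t x + e" by simp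
  qed
qed

section \<open>Uniform estimates on balls and one-sided Taylor bounds\<close>

definition C12_close :: "real \<Rightarrow> (real \<Rightarrow> real ^ 'n \<Rightarrow> real) \<Rightarrow> real \<Rightarrow> real \<Rightarrow> real \<Rightarrow> bool" where
  "C12_close T v R e \<delta> \<longleftrightarrow> (\<forall>s\<in>{0..T}. \<forall>t\<in>{0..T}. \<forall>x y.
     norm x \<le> R \<longrightarrow> norm y \<le> R \<longrightarrow> \<bar>s - t\<bar> \<le> \<delta> \<longrightarrow> norm (x - y) \<le> \<delta> \<longrightarrow>
     \<bar>v s x - v t y\<bar> \<le> e \<and> \<bar>time_deriv T v s x - time_deriv T v t y\<bar> \<le> e \<and>
     norm (gradient (v s) x - gradient (v t) y) \<le> e \<and> norm (hessian (v s) x - hessian (v t) y) \<le> e)"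

definition C12_bound :: "real \<Rightarrow> (real \<Rightarrow> real ^ 'n \<Rightarrow> real) \<Rightarrow> real \<Rightarrow> real \<Rightarrow> bool" where
  "C12_bound T v R B \<longleftrightarrow> (\<forall>t\<in>{0..T}. \<forall>x. norm x \<le> R \<longrightarrow>
     \<bar>v t x\<bar> \<le> B \<and> \<bar>time_deriv T v t x\<bar> \<le> B \<and> norm (gradient (v t) x) \<le> B \<and> norm (hessian (v t) x) \<le> B)"

lemmas C12_closeD = C12_close_def[THEN iffD1, rule_format]
  and C12_boundD = C12_bound_def[THEN iffD1, rule_format]

text \<open>Heine-Cantor on a compact cylinder, applied to the quadruple of \<open>v\<close> and its
  derivatives so that one \<open>\<delta>\<close> serves all four.\<close>

lemma C12_uniform:
  fixes v :: "real \<Rightarrow> real ^ 'n \<Rightarrow> real"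
  assumes v: "C12 T v" and e: "0 < e"
  obtains \<delta> where "0 < \<delta>" "C12_close T v R e \<delta>"
proof -
  let ?K = "{0..T} \<times> cball (0::real^'n) R"
  have K: "compact ?K" by (intro compact_Times) auto
  let ?f = "\<lambda>p. (v (fst p) (snd p), time_deriv T v (fst p) (snd p), gradient (v (fst p)) (snd p), hessian (v (fst p)) (snd p))"
  have "continuous_on ?K ?f"
    using v unfolding C12_def case_prod_beta
    by (intro continuous_on_Pair) (auto intro: continuous_on_subset)
  then have "uniformly_continuous_on ?K ?f" by (rule compact_uniformly_continuous[OF _ K])
  then obtain d where d: "d > 0" "\<And>p q. p \<in> ?K \<Longrightarrow> q \<in> ?K \<Longrightarrow> dist p q < d \<Longrightarrow> dist (?f p) (?f q) < e"
    using e unfolding uniformly_continuous_on_def by (metis (no_types, lifting) dist_commute)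
  \<comment> \<open>The product distance is at most the sum of the coordinate distances, here at
    most \<open>2 * d / 3\<close>, which is strictly below \<open>d\<close>.\<close>
  have "C12_close T v R e (d / 3)"
    unfolding C12_close_def
  proof (intro ballI allI impI)
    fix s t and x y :: "real ^ 'n"
    assume *: "s \<in> {0..T}" "t \<in> {0..T}" "norm x \<le> R" "norm y \<le> R" "\<bar>s - t\<bar> \<le> d / 3" "norm (x - y) \<le> d / 3"
    have "dist (s, x) (t, y) \<le> dist s t + dist x y"
      unfolding dist_Pair_Pair by (rule sqrt_sum_squares_le_sum) auto
    also have "\<dots> < d" using * d(1) by (simp add: dist_norm)
    finally have "dist (?f (s, x)) (?f (t, y)) < e" using * by (intro d(2)) auto
    then have "dist (?f (s, x)) (?f (t, y)) \<le> e" by simp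
    from order_trans[OF dist_fst_le this] order_trans[OF dist_snd_le this]
    have 1: "\<bar>v s x - v t y\<bar> \<le> e"
      and 2: "dist (snd (?f (s, x))) (snd (?f (t, y))) \<le> e"
      by (simp_all add: dist_real_def)
    from order_trans[OF dist_fst_le 2] order_trans[OF dist_snd_le 2]
    have 3: "\<bar>time_deriv T v s x - time_deriv T v t y\<bar> \<le> e"
      and 4: "dist (snd (snd (?f (s, x)))) (snd (snd (?f (t, y)))) \<le> e"
      by (simp_all add: dist_real_def)
    from order_trans[OF dist_fst_le 4] order_trans[OF dist_snd_le 4]
    show "\<bar>v s x - v t y\<bar> \<le> e \<and> \<bar>time_deriv T v s x - time_deriv T v t y\<bar> \<le> e \<and>
      norm (gradient (v s) x - gradient (v t) y) \<le> e \<and> norm (hessian (v s) x - hessian (v t) y) \<le> e"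
      using 1 3 by (simp add: dist_norm)
  qed
  with d(1) show thesis by (intro that[of "d / 3"]) auto
qed

lemma C12_bounded:
  fixes v :: "real \<Rightarrow> real ^ 'n \<Rightarrow> real"
  assumes v: "C12 T v"
  obtains B where "0 < B" "C12_bound T v R B"
proof -
  let ?K = "{0..T} \<times> cball (0::real^'n) R"
  have K: "compact ?K" by (intro compact_Times) auto
  have b: "\<exists>B. \<forall>p\<in>?K. norm (f p) \<le> B" if "continuous_on ({0..T} \<times> UNIV) f" for f :: "_ \<Rightarrow> 'b::real_normed_vector"
  proof -
    have "compact (f ` ?K)"
      using that by (intro compact_continuous_image K) (auto intro: continuous_on_subset)
    then show ?thesis using compact_imp_bounded bounded_iff by (metis imageI)
  qed
  obtain B1 where 1: "\<forall>p\<in>?K. norm ((\<lambda>(t, x). v t x) p) \<le> B1" using b v unfolding C12_def by blast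
  obtain B2 where 2: "\<forall>p\<in>?K. norm ((\<lambda>(t, x). time_deriv T v t x) p) \<le> B2" using b v unfolding C12_def by blast
  obtain B3 where 3: "\<forall>p\<in>?K. norm ((\<lambda>(t, x). gradient (v t) x) p) \<le> B3" using b v unfolding C12_def by blast
  obtain B4 where 4: "\<forall>p\<in>?K. norm ((\<lambda>(t, x). hessian (v t) x) p) \<le> B4" using b v unfolding C12_def by blast
  show thesis
    by (rule that[of "max 1 (max (max B1 B2) (max B3 B4))"]) (use 1 2 3 4 in \<open>auto simp: C12_bound_def le_max_iff_disj\<close>)
qed

text \<open>A Gaussian step may leave every ball, where \<open>v\<close> is out of control. The
  crude cut-off keeps the scheme's values bounded; its jump is harmless because only measurability,
  boundedness and upper Taylor bounds are asked of it.\<close>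

definition truncate :: "real \<Rightarrow> (real ^ 'n \<Rightarrow> real) \<Rightarrow> real ^ 'n \<Rightarrow> real" where
  "truncate R f x = (if norm x \<le> R then f x else 0)"

text \<open>Time moves at the displaced point \<open>x + y\<close> by the mean value theorem, then
  space at time \<open>t\<close> by \<open>taylor_hessian\<close>; both intermediate derivatives are
  within \<open>e\<close> of those at \<open>(t, x)\<close>. Uniformity is taken on the ball of
  radius \<open>R + 1\<close>, which contains the whole segment.\<close>

lemma taylor_local:
  fixes v :: "real \<Rightarrow> real ^ 'n \<Rightarrow> real"
  assumes v: "C12 T v" and e: "0 < e"
  obtains \<delta> where "0 < \<delta>" "\<delta> \<le> 1"
    "\<And>t d x y. 0 \<le> t \<Longrightarrow> 0 \<le> d \<Longrightarrow> t + d \<le> T \<Longrightarrow> d \<le> \<delta> \<Longrightarrow> norm x \<le> R \<Longrightarrow> norm y \<le> \<delta> \<Longrightarrow>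
      v (t + d) (x + y) \<le> v t x + d * time_deriv T v t x + gradient (v t) x \<bullet> y
        + 1 / 2 * (y \<bullet> (hessian (v t) x *v y)) + e * (d + (norm y)\<^sup>2)"
proof -
  obtain \<delta> where d': "0 < \<delta>" "C12_close T v (R + 1) e \<delta>"
    by (rule C12_uniform[OF v e])
  note d = d'(1) C12_closeD[OF d'(2)]
  show thesis
  proof (rule that[of "min 1 \<delta>"])
    fix t d and x y :: "real ^ 'n"
    assume *: "0 \<le> t" "0 \<le> d" "t + d \<le> T" "d \<le> min 1 \<delta>" "norm x \<le> R" "norm y \<le> min 1 \<delta>"
    have xy: "norm (x + r *\<^sub>R y) \<le> R + 1" "norm (r *\<^sub>R y) \<le> \<delta>" if "0 \<le> r" "r \<le> 1" for r
    proof -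
      have "norm (r *\<^sub>R y) \<le> norm y" using that by (simp add: mult_left_le_one_le)
      then show "norm (x + r *\<^sub>R y) \<le> R + 1" "norm (r *\<^sub>R y) \<le> \<delta>"
        using * norm_triangle_ineq[of x "r *\<^sub>R y"] by auto
    qed
    have t: "t \<in> {0..T}" using * by auto
    have "v (t + d) (x + y) - v t (x + y) \<le> d * time_deriv T v t x + e * d"
    proof (cases "d = 0")
      case False
      then have "t < t + d" using * by simp
      then obtain s where s: "s \<in> {t<..<t+d}" "v (t + d) (x + y) - v t (x + y) = (t + d - t) * time_deriv T v s (x + y)"
      proof (rule mvt_simple[of t "t + d" "\<lambda>s. v s (x + y)" "\<lambda>s h. h * time_deriv T v s (x + y)", THEN bexE])
        fix s assume "t \<le> s" "s \<le> t + d"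
        then show "((\<lambda>s. v s (x + y)) has_derivative (\<lambda>h. h * time_deriv T v s (x + y))) (at s within {t..t + d})"
          using C12D(1)[OF v, of s "x + y"] * 
          by (auto simp: has_field_derivative_def mult.commute[of _ "time_deriv _ _ _ _"] elim!: has_derivative_subset)
      qed
      have "\<bar>time_deriv T v s (x + y) - time_deriv T v t x\<bar> \<le> e"
        using d(2)[of s t "x + y" x] s * xy[of 1] by auto
      then have "d * (time_deriv T v s (x + y) - time_deriv T v t x) \<le> d * e"
        using * by (intro mult_left_mono) auto
      then show ?thesis using s by (simp add: algebra_simps)
    qed simp
    moreover obtain r where r: "0 < r" "r < 1"
      "v t (x + y) = v t x + gradient (v t) x \<bullet> y + 1 / 2 * (y \<bullet> (hessian (v t) (x + r *\<^sub>R y) *v y))"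
      by (rule taylor_hessian[OF C12D(2,3)[OF v t]])
    moreover have "y \<bullet> (hessian (v t) (x + r *\<^sub>R y) *v y) \<le> y \<bullet> (hessian (v t) x *v y) + e * (norm y)\<^sup>2"
    proof -
      have "y \<bullet> ((hessian (v t) (x + r *\<^sub>R y) - hessian (v t) x) *v y)
        \<le> norm y * norm ((hessian (v t) (x + r *\<^sub>R y) - hessian (v t) x) *v y)"
        by (rule norm_cauchy_schwarz)
      also have "\<dots> \<le> norm y * (norm (hessian (v t) (x + r *\<^sub>R y) - hessian (v t) x) * norm y)"
        by (intro mult_left_mono norm_matrix_vector_mult_le) auto
      also have "\<dots> \<le> norm y * (e * norm y)"
        using d(2)[of t t "x + r *\<^sub>R y" x] t xy[of r] r * d(1) by (intro mult_left_mono mult_right_mono) auto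
      finally show ?thesis
        by (simp add: matrix_vector_mult_diff_rdistrib inner_diff_right power2_eq_square mult_ac)
    qed
    moreover have "a \<le> v0 + g + 1 / 2 * h' + p" if "a - m \<le> p" "m = v0 + g + 1 / 2 * h" "h \<le> h'"
      for a m p v0 g h h' :: real using that by simp
    ultimately have "v (t + d) (x + y) \<le> v t x + gradient (v t) x \<bullet> y
        + 1 / 2 * (y \<bullet> (hessian (v t) x *v y) + e * (norm y)\<^sup>2) + (d * time_deriv T v t x + e * d)"
      by blast
    moreover have "1 / 2 * (e * (norm y)\<^sup>2) \<le> e * (norm y)\<^sup>2" using e by simp
    ultimately show "v (t + d) (x + y) \<le> v t x + d * time_deriv T v t x + gradient (v t) x \<bullet> y
        + 1 / 2 * (y \<bullet> (hessian (v t) x *v y)) + e * (d + (norm y)\<^sup>2)"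
      by (simp add: algebra_simps)
  qed (use d in auto)
qed

text \<open>For small \<open>y\<close> the truncation is inactive. For large \<open>y\<close> every
  term is bounded by \<open>B\<close> times a power of \<open>norm y / \<delta>\<close>, hence
  absorbed by its fourth power.\<close>

lemma taylor_truncated:
  fixes v :: "real \<Rightarrow> real ^ 'n \<Rightarrow> real"
  assumes v: "C12 T v" and e: "0 < e"
  obtains \<delta> K where "0 < \<delta>" "\<delta> \<le> 1" "0 \<le> K"
    "\<And>t d x y. 0 \<le> t \<Longrightarrow> 0 \<le> d \<Longrightarrow> t + d \<le> T \<Longrightarrow> d \<le> \<delta> \<Longrightarrow> norm x \<le> R \<Longrightarrow>
      truncate (R + 1) (v (t + d)) (x + y) \<le> v t x + d * time_deriv T v t x + gradient (v t) x \<bullet> y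
        + 1 / 2 * (y \<bullet> (hessian (v t) x *v y)) + e * (d + (norm y)\<^sup>2) + K * norm y ^ 4"
proof -
  obtain \<delta> where d: "0 < \<delta>" "\<delta> \<le> 1"
    "\<And>t d x y. 0 \<le> t \<Longrightarrow> 0 \<le> d \<Longrightarrow> t + d \<le> T \<Longrightarrow> d \<le> \<delta> \<Longrightarrow> norm x \<le> R \<Longrightarrow> norm y \<le> \<delta> \<Longrightarrow>
      v (t + d) (x + y) \<le> v t x + d * time_deriv T v t x + gradient (v t) x \<bullet> y
        + 1 / 2 * (y \<bullet> (hessian (v t) x *v y)) + e * (d + (norm y)\<^sup>2)"
    using taylor_local[OF v e, where R = R] by blast
  obtain B where B0: "0 < B" "C12_bound T v (R + 1) B"
    by (rule C12_bounded[OF v])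
  note B = B0(1) C12_boundD[OF B0(2)]
  \<comment> \<open>Five terms are to be absorbed: the truncated value, \<open>v t x\<close>, and
    the contributions of the time derivative, the gradient and the Hessian.\<close>
  define K where "K = 5 * B / \<delta> ^ 4"
  have K: "0 \<le> K" using B d by (simp add: K_def)
  show thesis
  proof (rule that[OF d(1,2) K])
    fix t d and x y :: "real ^ 'n"
    assume *: "0 \<le> t" "0 \<le> d" "t + d \<le> T" "d \<le> \<delta>" "norm x \<le> R"
    show "truncate (R + 1) (v (t + d)) (x + y) \<le> v t x + d * time_deriv T v t x + gradient (v t) x \<bullet> y
        + 1 / 2 * (y \<bullet> (hessian (v t) x *v y)) + e * (d + (norm y)\<^sup>2) + K * norm y ^ 4"
    proof (cases "norm y \<le> \<delta>")
      case True
      have "norm (x + y) \<le> R + 1" using True * d(2) norm_triangle_ineq[of x y] by simp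
      moreover have "0 \<le> K * norm y ^ 4" using K by simp
      ultimately show ?thesis using d(3)[OF * True] by (simp add: truncate_def)
    next
      case False
      \<comment> \<open>At least 1 in this case, so \<open>?n ^ 4\<close> dominates 1,
        \<open>norm y\<close> and \<open>(norm y)\<^sup>2\<close> alike.\<close>
      let ?n = "norm y / \<delta>"
      have n: "1 \<le> ?n" "norm y \<le> ?n" using False d mult_left_le[of \<delta> "norm y"] by (auto simp: field_simps)
      have p: "1 \<le> ?n ^ 4" "?n \<le> ?n ^ 4" "?n\<^sup>2 \<le> ?n ^ 4"
        using n(1) one_le_power[of ?n 4] power_increasing[of 1 4 ?n] power_increasing[of 2 4 ?n] by auto
      have y: "norm y \<le> ?n ^ 4" "(norm y)\<^sup>2 \<le> ?n ^ 4"
        using n p order_trans[OF power_mono[OF n(2), of 2] p(3)] by auto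
      have t: "t \<in> {0..T}" "t + d \<in> {0..T}" using * by auto
      have nx: "norm x \<le> R + 1" using * by simp
      note Bx = B(2)[OF t(1) nx]
      have 1: "truncate (R + 1) (v (t + d)) (x + y) \<le> B * ?n ^ 4"
      proof -
        have "truncate (R + 1) (v (t + d)) (x + y) \<le> B * 1"
          using B(1) B(2)[OF t(2), of "x + y"] by (auto simp: truncate_def)
        also have "\<dots> \<le> B * ?n ^ 4" using B(1) p by (intro mult_left_mono) auto
        finally show ?thesis .
      qed
      have 2: "- v t x \<le> B * ?n ^ 4"
      proof -
        have "- v t x \<le> B * 1" using Bx by auto
        also have "\<dots> \<le> B * ?n ^ 4" using B(1) p by (intro mult_left_mono) auto
        finally show ?thesis .
      qed
      have 3: "- (d * time_deriv T v t x) \<le> B * ?n ^ 4"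
      proof -
        have "- (d * time_deriv T v t x) \<le> \<bar>d\<bar> * \<bar>time_deriv T v t x\<bar>" by (simp add: abs_mult[symmetric])
        also have "\<dots> \<le> 1 * B" using * d(2) Bx by (intro mult_mono) auto
        also have "\<dots> \<le> B * ?n ^ 4" using B(1) p mult_left_mono[of 1 "?n ^ 4" B] by auto
        finally show ?thesis .
      qed
      have 4: "- (gradient (v t) x \<bullet> y) \<le> B * ?n ^ 4"
      proof -
        have "- (gradient (v t) x \<bullet> y) \<le> norm (gradient (v t) x) * norm y"
          using Cauchy_Schwarz_ineq2[of "gradient (v t) x" y] by linarith
        also have "\<dots> \<le> B * ?n ^ 4" using Bx y B(1) by (intro mult_mono) auto
        finally show ?thesis .
      qed
      have 5: "- (1 / 2 * (y \<bullet> (hessian (v t) x *v y))) \<le> B * ?n ^ 4"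
      proof -
        have "- (y \<bullet> (hessian (v t) x *v y)) \<le> norm y * norm (hessian (v t) x *v y)"
          using Cauchy_Schwarz_ineq2[of y "hessian (v t) x *v y"] by linarith
        also have "\<dots> \<le> norm y * (norm (hessian (v t) x) * norm y)"
          by (intro mult_left_mono norm_matrix_vector_mult_le) auto
        also have "\<dots> = norm (hessian (v t) x) * (norm y)\<^sup>2" by (simp add: power2_eq_square)
        also have "\<dots> \<le> B * ?n ^ 4" using Bx y B(1) by (intro mult_mono) auto
        finally have "- (y \<bullet> (hessian (v t) x *v y)) \<le> B * ?n ^ 4" .
        moreover have "0 \<le> B * ?n ^ 4" using B(1) by simp
        ultimately show ?thesis by linarith
      qed
      have "K * norm y ^ 4 = 5 * (B * ?n ^ 4)" by (simp add: K_def power_divide)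
      moreover have "0 \<le> e * (d + (norm y)\<^sup>2)" using e * by simp
      ultimately show ?thesis using 1 2 3 4 5 by linarith
    qed
  qed
qed

section \<open>A single Euler step\<close>

lemma matrix_diff_left: "(A - B) ** C = A ** C - B ** (C :: real ^ 'l ^ 'm)"
  and matrix_diff_right: "C' ** (A - B) = C' ** A - C' ** (B :: real ^ 'm ^ 'n)"
  by (simp_all add: vec_eq_iff matrix_matrix_mult_def left_diff_distrib right_diff_distrib sum_subtractf)

text \<open>Exchanging \<open>H\<close> for \<open>H'\<close> costs \<open>e\<close> times the
  squared norm of \<open>h\<close>; then \<open>h\<close> is exchanged for \<open>g\<close> in one
  factor at a time, with \<open>norm h \<le> B' + norm (h - g)\<close>.\<close>

lemma quadratic_form_diff_le:
  fixes h g :: "real ^ 'k ^ 'n"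
  assumes "norm H \<le> B" "norm H' \<le> B" "norm (H - H') \<le> e" "norm g \<le> B'"
  shows "h \<bullet> (H ** h) \<le> g \<bullet> (H' ** g) + e * (norm h)\<^sup>2 + B * (norm (h - g) * (2 * B' + norm (h - g)))"
proof -
  have B: "0 \<le> B" using assms(1) norm_ge_zero order_trans by blast
  have bnd: "x \<bullet> (A ** y) \<le> a * (norm x * norm y)" if "norm A \<le> a" for A :: "real ^ 'n ^ 'n" and x y :: "real ^ 'k ^ 'n" and a
  proof -
    have "x \<bullet> (A ** y) \<le> norm x * (norm A * norm y)"
      by (rule order_trans[OF norm_cauchy_schwarz]) (intro mult_left_mono norm_matrix_mult_le; simp)
    also have "\<dots> \<le> norm x * (a * norm y)" using that by (intro mult_left_mono mult_right_mono) auto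
    finally show ?thesis by (simp add: mult_ac)
  qed
  have "h \<bullet> (H ** h) = h \<bullet> ((H - H') ** h) + (h - g) \<bullet> (H' ** h) + g \<bullet> (H' ** (h - g)) + g \<bullet> (H' ** g)"
    by (simp add: matrix_diff_left matrix_diff_right inner_diff_left inner_diff_right)
  moreover have "h \<bullet> ((H - H') ** h) \<le> e * (norm h)\<^sup>2"
    using bnd[OF assms(3), of h h] by (simp add: power2_eq_square)
  moreover have "(h - g) \<bullet> (H' ** h) \<le> B * (norm (h - g) * (B' + norm (h - g)))"
  proof -
    have "norm h \<le> B' + norm (h - g)" using norm_triangle_ineq[of g "h - g"] assms(4) by simp
    then have "B * (norm (h - g) * norm h) \<le> B * (norm (h - g) * (B' + norm (h - g)))"
      using B by (intro mult_left_mono) auto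
    then show ?thesis using bnd[OF assms(2), of "h - g" h] by linarith
  qed
  moreover have "g \<bullet> (H' ** (h - g)) \<le> B * (norm (h - g) * B')"
  proof -
    have "B * (norm g * norm (h - g)) \<le> B * (B' * norm (h - g))"
      using B assms(4) by (intro mult_left_mono mult_right_mono) auto
    then show ?thesis using bnd[OF assms(2), of g "h - g"] by (simp add: mult_ac)
  qed
  ultimately show ?thesis by (simp add: algebra_simps)
qed

lemma young: "0 < e \<Longrightarrow> a * b \<le> e * a\<^sup>2 + b\<^sup>2 / (4 * e)" for a b e :: real
proof -
  assume e: "0 < e"
  have "0 \<le> (2 * e * a - b)\<^sup>2" by simp
  then have "a * b * (4 * e) \<le> (e * a\<^sup>2 + b\<^sup>2 / (4 * e)) * (4 * e)"
    using e by (simp add: power2_eq_square algebra_simps)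
  then show ?thesis using e by (simp add: mult_le_cancel_right)
qed

text \<open>One Euler step with drift \<open>b Y\<close> and noise coefficient \<open>h\<close>, both only approximating the true
  coefficients at the current state \<open>x\<close>. The first three terms of the bound have mean zero when \<open>z\<close> is a
  Brownian increment over time \<open>d\<close>.\<close>

definition euler_bound ::
  "real \<Rightarrow> (real \<Rightarrow> real ^ 'n \<Rightarrow> real) \<Rightarrow> (real ^ 'n \<Rightarrow> real ^ 'n) \<Rightarrow> (real ^ 'n \<Rightarrow> real ^ 'k ^ 'n) \<Rightarrow>
   (real ^ 'n) set \<Rightarrow> real \<Rightarrow> real \<Rightarrow> real \<Rightarrow> real \<Rightarrow> real \<Rightarrow> real \<Rightarrow> bool" where
  "euler_bound T v b \<sigma> C R e \<delta> q c K \<longleftrightarrow>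
     (\<forall>t d x Y h z. 0 \<le> t \<longrightarrow> 0 \<le> d \<longrightarrow> t + d \<le> T \<longrightarrow> d \<le> \<delta> \<longrightarrow> Y \<in> C \<longrightarrow> norm (x - Y) \<le> \<delta> \<longrightarrow>
      truncate (R + 2) (v (t + d)) (x + (d *\<^sub>R b Y + h *v z)) - v t x \<le>
        (transpose h *v gradient (v t) x) \<bullet> z
        + 1 / 2 * (z \<bullet> ((transpose h ** hessian (v t) x ** h) *v z) - d * trace (transpose h ** hessian (v t) x ** h))
        + q * ((norm h)\<^sup>2 * ((norm z)\<^sup>2 - real CARD('k) * d))
        + d * generator T b \<sigma> v t Y + d * (e + c * (norm (h - \<sigma> Y))\<^sup>2)
        + K * (d\<^sup>2 + norm h ^ 4 * norm z ^ 4))"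

lemma euler_bound_mono: "euler_bound T v b \<sigma> C R e \<delta> q c K \<Longrightarrow> \<delta>' \<le> \<delta> \<Longrightarrow> euler_bound T v b \<sigma> C R e \<delta>' q c K"
  unfolding euler_bound_def by (meson order_trans)

text \<open>The Taylor expansion lives at the state \<open>x\<close> of the scheme, but the sign of
  the generator is known at \<open>Y\<close>. Moving the derivatives from \<open>x\<close> to
  \<open>Y\<close> costs multiples of a small \<open>\<eta>\<close>; moving the noise coefficient
  from \<open>h\<close> to \<open>\<sigma> Y\<close> costs a multiple of the squared difference,
  after Young's inequality.\<close>

lemma euler_step:
  fixes v :: "real \<Rightarrow> real ^ 'n \<Rightarrow> real" and \<sigma> :: "real ^ 'n \<Rightarrow> real ^ 'k ^ 'n"
  assumes v: "C12 T v" and e: "0 < e" and B': "0 \<le> B'"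
    and C: "\<And>Y. Y \<in> C \<Longrightarrow> norm Y \<le> R" "\<And>Y. Y \<in> C \<Longrightarrow> norm (b Y) \<le> B'" "\<And>Y. Y \<in> C \<Longrightarrow> norm (\<sigma> Y) \<le> B'"
  obtains \<delta> q c K where "0 < \<delta>" "\<delta> \<le> 1" "0 \<le> q" "0 \<le> c" "0 \<le> K" "euler_bound T v b \<sigma> C R e \<delta> q c K"
proof -
  define k where "k = real CARD('k)"
  have k: "0 \<le> k" by (simp add: k_def)
  \<comment> \<open>Collects the multiples of \<open>\<eta>\<close> that remain: two from the time
    derivative and the Taylor error, \<open>B'\<close> from the gradient, and the two powers of
    \<open>B'\<close> from the Hessian and from compensating the squared increment. They use up half
    of \<open>e\<close>.\<close>
  define S where "S = 2 + B' + B'\<^sup>2 + 6 * k * B'\<^sup>2"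
  have S: "0 < S" using B' k by (simp add: S_def add_pos_nonneg)
  define \<eta> where "\<eta> = e / (2 * S)"
  have \<eta>: "0 < \<eta>" "\<eta> * S = e / 2" using e S by (auto simp: \<eta>_def)
  obtain \<delta>1 where \<delta>1': "0 < \<delta>1" "C12_close T v (R + 1) \<eta> \<delta>1"
    by (rule C12_uniform[OF v \<eta>(1)])
  note \<delta>1 = \<delta>1'(1) C12_closeD[OF \<delta>1'(2)]
  obtain \<delta>2 K0 where \<delta>2: "0 < \<delta>2" "\<delta>2 \<le> 1" and K0: "0 \<le> K0" and taylor:
    "\<And>t d x y. 0 \<le> t \<Longrightarrow> 0 \<le> d \<Longrightarrow> t + d \<le> T \<Longrightarrow> d \<le> \<delta>2 \<Longrightarrow> norm (x::real^'n) \<le> R + 1 \<Longrightarrow>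
      truncate (R + 1 + 1) (v (t + d)) (x + y) \<le> v t x + d * time_deriv T v t x + gradient (v t) x \<bullet> y
        + 1 / 2 * (y \<bullet> (hessian (v t) x *v y)) + \<eta> * (d + (norm y)\<^sup>2) + K0 * norm y ^ 4"
    using taylor_truncated[OF v \<eta>(1), where R = "R + 1"] by blast
  obtain B where B0: "0 < B" "C12_bound T v (R + 1) B"
    by (rule C12_bounded[OF v])
  note B = B0(1) C12_boundD[OF B0(2)]
  define c where "c = \<eta> * (1 + 6 * k) + B / 2 + (B * B')\<^sup>2 / (2 * e)"
  define K1 where "K1 = 1 / 2 * (B * B'\<^sup>2) + (B * B')\<^sup>2 / (4 * \<eta>)"
  define K where "K = 8 * K0 + 8 * K0 * B' ^ 4 + K1 + 2 * \<eta> * B'\<^sup>2"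
  have K1: "0 \<le> K1" using B \<eta> by (simp add: K1_def)
  \<comment> \<open>In \<open>3 * \<eta>\<close>, two parts come from the Taylor error in
    \<open>(norm y)\<^sup>2\<close> and one from the mixed terms in \<open>yHy\<close>.\<close>
  show thesis
  proof (rule that[of "min \<delta>1 \<delta>2" "3 * \<eta>" c K])
    show "0 \<le> c" using \<eta> B e k by (simp add: c_def)
    show "0 \<le> K" using K0 K1 \<eta> by (simp add: K_def)
    show "euler_bound T v b \<sigma> C R e (min \<delta>1 \<delta>2) (3 * \<eta>) c K"
      unfolding euler_bound_def
    proof (intro allI impI)
      fix t d :: real and x Y :: "real ^ 'n" and h :: "real ^ 'k ^ 'n" and z :: "real ^ 'k"
      assume *: "0 \<le> t" "0 \<le> d" "t + d \<le> T" "d \<le> min \<delta>1 \<delta>2" "Y \<in> C" "norm (x - Y) \<le> min \<delta>1 \<delta>2"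
      define H where "H = hessian (v t) x"
      define G where "G = gradient (v t) x"
      define V where "V = time_deriv T v t x"
      define H' where "H' = hessian (v t) Y"
      define G' where "G' = gradient (v t) Y"
      define V' where "V' = time_deriv T v t Y"
      define u where "u = h *v z"
      define \<beta> where "\<beta> = b Y"
      define g where "g = norm (h - \<sigma> Y)"
      define y where "y = d *\<^sub>R \<beta> + u"
      have t: "t \<in> {0..T}" using * by auto
      have d1: "d \<le> 1" using * \<delta>2 by simp
      have nY: "norm Y \<le> R + 1" using C(1)[OF *(5)] by simp
      have nx: "norm x \<le> R + 1"
        using norm_triangle_ineq[of Y "x - Y"] C(1)[OF *(5)] * \<delta>2 by simp
      have \<beta>: "norm \<beta> \<le> B'" using C(2)[OF *(5)] by (simp add: \<beta>_def)
      have HB: "norm H \<le> B" "norm H' \<le> B" using B(2)[OF t nx] B(2)[OF t nY] by (auto simp: H_def H'_def)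
      have close: "V \<le> V' + \<eta>" "norm (G - G') \<le> \<eta>" "norm (H - H') \<le> \<eta>"
        using \<delta>1(2)[OF t t nx nY] * \<delta>1(1) by (auto simp: V_def V'_def G_def G'_def H_def H'_def)
      have g0: "0 \<le> g" by (simp add: g_def)
      have u: "norm u \<le> norm h * norm z" unfolding u_def by (rule norm_matrix_vector_mult_le)
      have u2: "(norm u)\<^sup>2 \<le> (norm h)\<^sup>2 * (norm z)\<^sup>2"
        using power_mono[OF u, of 2] by (simp add: power_mult_distrib)
      have u4: "norm u ^ 4 \<le> norm h ^ 4 * norm z ^ 4"
        using power_mono[OF u, of 4] by (simp add: power_mult_distrib)
      have ny: "norm y \<le> d * B' + norm u"
        using norm_triangle_ineq[of "d *\<^sub>R \<beta>" u] mult_left_mono[OF \<beta> *(2)] *(2) by (simp add: y_def)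
      have sq2: "(p + r)\<^sup>2 \<le> 2 * p\<^sup>2 + 2 * r\<^sup>2" for p r :: real
        using sum_squares_bound[of p r] by (simp add: power2_sum)
      have y2: "(norm y)\<^sup>2 \<le> 2 * d\<^sup>2 * B'\<^sup>2 + 2 * (norm u)\<^sup>2"
        using order_trans[OF power_mono[OF ny, of 2] sq2] by (simp add: power_mult_distrib)
      have y4: "norm y ^ 4 \<le> 8 * d\<^sup>2 * B' ^ 4 + 8 * norm u ^ 4"
      proof -
        have "norm y ^ 4 = ((norm y)\<^sup>2)\<^sup>2" by (simp flip: power_mult)
        also have "\<dots> \<le> (2 * d\<^sup>2 * B'\<^sup>2 + 2 * (norm u)\<^sup>2)\<^sup>2" using y2 by (intro power_mono) auto
        also have "\<dots> \<le> 2 * (2 * d\<^sup>2 * B'\<^sup>2)\<^sup>2 + 2 * (2 * (norm u)\<^sup>2)\<^sup>2" by (rule sq2)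
        also have "\<dots> = 8 * d ^ 4 * B' ^ 4 + 8 * norm u ^ 4"
          by (simp add: power_mult_distrib flip: power_mult)
        also have "d ^ 4 * B' ^ 4 \<le> d\<^sup>2 * B' ^ 4"
          using * d1 by (intro mult_right_mono power_decreasing) auto
        then have "8 * d ^ 4 * B' ^ 4 + 8 * norm u ^ 4 \<le> 8 * d\<^sup>2 * B' ^ 4 + 8 * norm u ^ 4" by simp
        finally show ?thesis .
      qed
      have bil: "p \<bullet> (H *v r) \<le> norm p * (B * norm r)" for p r
      proof -
        have "p \<bullet> (H *v r) \<le> norm p * norm (H *v r)" by (rule norm_cauchy_schwarz)
        also have "\<dots> \<le> norm p * (norm H * norm r)" by (intro mult_left_mono norm_matrix_vector_mult_le) auto
        also have "\<dots> \<le> norm p * (B * norm r)" using HB by (intro mult_left_mono mult_right_mono) auto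
        finally show ?thesis .
      qed
      have nd\<beta>: "norm (d *\<^sub>R \<beta>) \<le> d * B'" using mult_left_mono[OF \<beta> *(2)] *(2) by simp
      \<comment> \<open>The mixed terms are of size \<open>d * norm u\<close>; Young's inequality
        splits them into \<open>\<eta> * (norm u)\<^sup>2\<close> and a multiple of
        \<open>d\<^sup>2\<close>.\<close>
      have yHy: "1 / 2 * (y \<bullet> (H *v y)) \<le> 1 / 2 * (u \<bullet> (H *v u)) + \<eta> * (norm u)\<^sup>2 + K1 * d\<^sup>2"
      proof -
        have "y \<bullet> (H *v y) = u \<bullet> (H *v u) + d *\<^sub>R \<beta> \<bullet> (H *v y) + u \<bullet> (H *v (d *\<^sub>R \<beta>))"
          unfolding y_def by (simp add: matrix_vector_right_distrib inner_add_left inner_add_right)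
        moreover have "d *\<^sub>R \<beta> \<bullet> (H *v y) \<le> d * B' * (B * (d * B' + norm u))"
          using B(1) ny nd\<beta> * B' by (intro order_trans[OF bil] mult_mono mult_left_mono mult_nonneg_nonneg add_nonneg_nonneg) auto
        moreover have "u \<bullet> (H *v (d *\<^sub>R \<beta>)) \<le> norm u * (B * (d * B'))"
          using B(1) nd\<beta> by (intro order_trans[OF bil] mult_left_mono) auto
        moreover have "norm u * (d * (B * B')) \<le> \<eta> * (norm u)\<^sup>2 + (d * (B * B'))\<^sup>2 / (4 * \<eta>)"
          by (rule young[OF \<eta>(1)])
        ultimately have "1 / 2 * (y \<bullet> (H *v y)) \<le> 1 / 2 * (u \<bullet> (H *v u)) + 1 / 2 * (d * B' * B * (d * B'))
           + (\<eta> * (norm u)\<^sup>2 + (d * (B * B'))\<^sup>2 / (4 * \<eta>))"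
          by (simp add: algebra_simps)
        also have "\<dots> = 1 / 2 * (u \<bullet> (H *v u)) + \<eta> * (norm u)\<^sup>2 + K1 * d\<^sup>2"
          by (simp add: K1_def power2_eq_square algebra_simps add_divide_distrib)
        finally show ?thesis .
      qed
      have trace_eq: "trace (transpose m ** N ** m) = m \<bullet> (N ** m)" for m :: "real ^ 'k ^ 'n" and N :: "real ^ 'n ^ 'n"
        by (simp add: inner_matrix_eq_trace matrix_mul_assoc)
      have z1: "(transpose h *v G) \<bullet> z = G \<bullet> u"
        by (simp add: u_def transpose_matrix_vector dot_lmul_matrix)
      have z2: "z \<bullet> ((transpose h ** H ** h) *v z) = u \<bullet> (H *v u)"
      proof -
        have "z \<bullet> ((transpose h ** H ** h) *v z) = (transpose h *v (H *v u)) \<bullet> z"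
          by (simp add: u_def matrix_vector_mul_assoc matrix_mul_assoc inner_commute)
        also have "\<dots> = u \<bullet> (H *v u)"
          by (simp only: u_def transpose_matrix_vector dot_lmul_matrix inner_commute[of "H *v _"])
        finally show ?thesis .
      qed
      have "\<eta> * (d + (norm y)\<^sup>2) \<le> \<eta> * (d + (2 * d\<^sup>2 * B'\<^sup>2 + 2 * ((norm h)\<^sup>2 * (norm z)\<^sup>2)))"
        using \<eta> y2 u2 by (intro mult_left_mono) auto
      moreover have "K0 * norm y ^ 4 \<le> K0 * (8 * d\<^sup>2 * B' ^ 4 + 8 * (norm h ^ 4 * norm z ^ 4))"
        using K0 y4 u4 by (intro mult_left_mono) auto
      moreover have "\<eta> * (norm u)\<^sup>2 \<le> \<eta> * ((norm h)\<^sup>2 * (norm z)\<^sup>2)" using \<eta> u2 by (intro mult_left_mono) auto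
      moreover have "truncate (R + 2) (v (t + d)) (x + y) \<le> v t x + d * V + G \<bullet> y
          + 1 / 2 * (y \<bullet> (H *v y)) + \<eta> * (d + (norm y)\<^sup>2) + K0 * norm y ^ 4"
        using taylor[of t d x y] * nx by (simp add: V_def G_def H_def add.assoc)
      moreover have "G \<bullet> y = d * (G \<bullet> \<beta>) + G \<bullet> u" by (simp add: y_def inner_add_right)
      moreover have "8 * K0 * (d\<^sup>2 + norm h ^ 4 * norm z ^ 4) + 8 * K0 * B' ^ 4 * d\<^sup>2 + K1 * d\<^sup>2 + 2 * \<eta> * B'\<^sup>2 * d\<^sup>2
          \<le> K * (d\<^sup>2 + norm h ^ 4 * norm z ^ 4)"
        unfolding K_def using K0 K1 \<eta> by (simp add: algebra_simps)
      moreover have "0 \<le> K0 * d\<^sup>2" using K0 by simp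
      ultimately have A: "truncate (R + 2) (v (t + d)) (x + y) - v t x \<le> G \<bullet> u + 1 / 2 * (u \<bullet> (H *v u))
          + 3 * \<eta> * ((norm h)\<^sup>2 * (norm z)\<^sup>2) + d * (V + G \<bullet> \<beta> + \<eta>) + K * (d\<^sup>2 + norm h ^ 4 * norm z ^ 4)"
        using yHy by (simp add: algebra_simps)
      have h2: "(norm h)\<^sup>2 \<le> 2 * B'\<^sup>2 + 2 * g\<^sup>2"
      proof -
        have "norm h \<le> B' + g"
          using norm_triangle_ineq[of "\<sigma> Y" "h - \<sigma> Y"] C(3)[OF *(5)] by (simp add: g_def)
        from order_trans[OF power_mono[OF this, of 2] sq2] show ?thesis by simp
      qed
      have "G \<bullet> \<beta> \<le> G' \<bullet> \<beta> + \<eta> * B'"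
      proof -
        have "(G - G') \<bullet> \<beta> \<le> norm (G - G') * norm \<beta>" by (rule norm_cauchy_schwarz)
        also have "\<dots> \<le> \<eta> * B'" using close \<beta> \<eta> by (intro mult_mono) auto
        finally show ?thesis by (simp add: inner_diff_left)
      qed
      moreover have "h \<bullet> (H ** h) \<le> \<sigma> Y \<bullet> (H' ** \<sigma> Y) + \<eta> * (norm h)\<^sup>2 + (2 * (B * B' * g) + B * g\<^sup>2)"
        using quadratic_form_diff_le[OF HB close(3) C(3)[OF *(5)], of h, folded g_def]
        by (simp add: algebra_simps power2_eq_square)
      \<comment> \<open>The term linear in \<open>g\<close> is traded for the other half of
        \<open>e\<close> and a multiple of \<open>g\<^sup>2\<close>.\<close>
      moreover have "1 * (B * B' * g) \<le> e / 2 * 1\<^sup>2 + (B * B' * g)\<^sup>2 / (4 * (e / 2))"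
        using e by (intro young) auto
      moreover have "\<eta> * (norm h)\<^sup>2 \<le> \<eta> * (2 * B'\<^sup>2 + 2 * g\<^sup>2)" using \<eta> h2 by (intro mult_left_mono) auto
      moreover have "3 * \<eta> * k * (norm h)\<^sup>2 \<le> 3 * \<eta> * k * (2 * B'\<^sup>2 + 2 * g\<^sup>2)"
        using \<eta> h2 k by (intro mult_left_mono) auto
      moreover have "\<eta> * S = 2 * \<eta> + \<eta> * B' + \<eta> * B'\<^sup>2 + 6 * \<eta> * k * B'\<^sup>2" by (simp add: S_def algebra_simps)
      moreover have "c * g\<^sup>2 = \<eta> * g\<^sup>2 + 6 * \<eta> * k * g\<^sup>2 + B / 2 * g\<^sup>2 + (B * B' * g)\<^sup>2 / (2 * e)"
        by (simp add: c_def algebra_simps power_mult_distrib)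
      ultimately have "V + G \<bullet> \<beta> + \<eta> + 1 / 2 * (h \<bullet> (H ** h)) + 3 * \<eta> * k * (norm h)\<^sup>2
        \<le> V' + G' \<bullet> \<beta> + 1 / 2 * (\<sigma> Y \<bullet> (H' ** \<sigma> Y)) + e + c * g\<^sup>2"
        using close(1) \<eta>(2) by (simp add: algebra_simps)
      from mult_left_mono[OF this *(2)] A
      have "truncate (R + 2) (v (t + d)) (x + y) - v t x \<le> G \<bullet> u
          + 1 / 2 * (u \<bullet> (H *v u) - d * (h \<bullet> (H ** h)))
          + 3 * \<eta> * ((norm h)\<^sup>2 * ((norm z)\<^sup>2 - k * d))
          + d * (V' + G' \<bullet> \<beta> + 1 / 2 * (\<sigma> Y \<bullet> (H' ** \<sigma> Y))) + d * (e + c * g\<^sup>2) + K * (d\<^sup>2 + norm h ^ 4 * norm z ^ 4)"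
        by (simp add: algebra_simps)
      then show "truncate (R + 2) (v (t + d)) (x + (d *\<^sub>R b Y + h *v z)) - v t x \<le>
          (transpose h *v gradient (v t) x) \<bullet> z
          + 1 / 2 * (z \<bullet> ((transpose h ** hessian (v t) x ** h) *v z) - d * trace (transpose h ** hessian (v t) x ** h))
          + 3 * \<eta> * ((norm h)\<^sup>2 * ((norm z)\<^sup>2 - real CARD('k) * d))
          + d * generator T b \<sigma> v t Y + d * (e + c * (norm (h - \<sigma> Y))\<^sup>2)
          + K * (d\<^sup>2 + norm h ^ 4 * norm z ^ 4)"
        unfolding generator_def trace_eq G_def[symmetric] H_def[symmetric] G'_def[symmetric] H'_def[symmetric]
          V'_def[symmetric] z1 z2 u_def[symmetric] \<beta>_def[symmetric] y_def[symmetric] g_def[symmetric] k_def[symmetric] .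
    qed
  qed (use \<delta>1 \<delta>2 \<eta> in auto)
qed

section \<open>Grids and simple processes\<close>

lemma borel_measurable_matrix_vector_mult [measurable (raw)]:
  fixes f :: "'a \<Rightarrow> real ^ 'm ^ 'n"
  assumes "f \<in> borel_measurable N" "g \<in> borel_measurable N"
  shows "(\<lambda>w. f w *v g w) \<in> borel_measurable N"
proof (rule borel_measurable_continuous_Pair[OF assms])
  show "continuous_on UNIV (\<lambda>p :: (real ^ 'm ^ 'n) \<times> (real ^ 'm). fst p *v snd p)"
    unfolding matrix_vector_mult_def
    by (intro continuous_on_vec_lambda continuous_on_sum continuous_on_mult
      continuous_on_component continuous_on_fst continuous_on_snd continuous_on_id)
qed

lemma borel_measurable_matrix_mult [measurable (raw)]:
  fixes f :: "'a \<Rightarrow> real ^ 'm ^ 'n" and g :: "'a \<Rightarrow> real ^ 'l ^ 'm"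
  assumes "f \<in> borel_measurable N" "g \<in> borel_measurable N"
  shows "(\<lambda>w. f w ** g w) \<in> borel_measurable N"
proof (rule borel_measurable_continuous_Pair[OF assms])
  show "continuous_on UNIV (\<lambda>p :: (real ^ 'm ^ 'n) \<times> (real ^ 'l ^ 'm). fst p ** snd p)"
    unfolding matrix_matrix_mult_def
    by (intro continuous_on_vec_lambda continuous_on_sum continuous_on_mult
      continuous_on_component continuous_on_fst continuous_on_snd continuous_on_id)
qed

lemma borel_measurable_transpose [measurable (raw)]:
  fixes f :: "'a \<Rightarrow> real ^ 'm ^ 'n"
  assumes "f \<in> borel_measurable N"
  shows "(\<lambda>w. transpose (f w)) \<in> borel_measurable N"
proof (rule measurable_compose[OF assms borel_measurable_continuous_onI])
  show "continuous_on UNIV (transpose :: real ^ 'm ^ 'n \<Rightarrow> _)"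
    unfolding transpose_def
    by (intro continuous_on_vec_lambda continuous_on_component continuous_on_id)
qed

text \<open>Strictly increasing because the normal law of an increment is available only over
  intervals of positive length.\<close>

definition grid :: "real \<Rightarrow> nat \<Rightarrow> (nat \<Rightarrow> real) \<Rightarrow> bool" where
  "grid T L t \<longleftrightarrow> t 0 = 0 \<and> t L = T \<and> (\<forall>j<L. t j < t (Suc j))"

lemma grid_mono: "grid T L t \<Longrightarrow> i \<le> j \<Longrightarrow> j \<le> L \<Longrightarrow> t i \<le> t j"
proof (induction j)
  case (Suc j)
  then have "t j < t (Suc j)" unfolding grid_def by simp
  with Suc show ?case by (cases "i = Suc j") auto
qed simp

lemma grid_bounds: "grid T L t \<Longrightarrow> j \<le> L \<Longrightarrow> 0 \<le> t j \<and> t j \<le> T"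
  using grid_mono[of T L t 0 j] grid_mono[of T L t j L] unfolding grid_def by auto

lemma grid_no_between:
  assumes g: "grid T L t" and u: "u \<in> t ` {..L}" "t j < u" and j: "j < L" 
  shows "t (Suc j) \<le> u"
proof -
  obtain i where i: "u = t i" "i \<le> L" using u by auto
  then have "j < i" using grid_mono[OF g, of i j] u j by (meson leI less_imp_le not_le)
  then show ?thesis using grid_mono[OF g, of "Suc j" i] i by simp
qed

text \<open>Equidistant points of spacing at most \<open>h\<close> are merged with the prescribed
  ones; sorting the finite set removes repetitions, which gives strictness.\<close>

lemma grid_exists:
  assumes T: "0 < T" and h: "0 < h" and Q: "finite Q"
  obtains L t where "grid T L t" "\<And>j. j < L \<Longrightarrow> t (Suc j) - t j \<le> h" "Q \<inter> {0..T} \<subseteq> t ` {..L}"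
proof -
  obtain N :: nat where N: "T / h < N" using reals_Archimedean2 by blast
  have N0: "0 < N" using N T h by (auto intro!: gr0I simp: field_simps) 
  define P where "P = (Q \<inter> {0..T}) \<union> {0, T} \<union> (\<lambda>k. real k * T / N) ` {..N}"
  have P: "finite P" "P \<subseteq> {0..T}" "0 \<in> P" "T \<in> P"
    using Q T N0 by (auto simp: P_def field_simps)
  define xs where "xs = sorted_list_of_set P"
  have xs: "set xs = P" "sorted_wrt (<) xs" using P by (auto simp: xs_def)
  define L where "L = length xs - 1"
  have ne: "xs \<noteq> []" using xs P by auto
  then have len: "length xs = Suc L" by (cases xs) (auto simp: L_def)
  have lt: "xs ! i < xs ! j" if "i < j" "j \<le> L" for i j
    using sorted_wrt_nth_less[OF xs(2)] that len by simp
  have le: "xs ! i \<le> xs ! j" if "i \<le> j" "j \<le> L" for i j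
    using lt[of i j] that by (cases "i = j") auto
  have inP: "xs ! i \<in> P" if "i \<le> L" for i using that len xs(1) nth_mem[of i xs] by simp
  have ex: "\<exists>i\<le>L. xs ! i = u" if "u \<in> P" for u
    using that len xs(1) by (metis in_set_conv_nth less_Suc_eq_le)
  have g: "grid T L ((!) xs)"
    unfolding grid_def
  proof (intro conjI allI impI)
    show "xs ! 0 = 0" using ex[OF P(3)] le[of 0] inP[of 0] P(2) by force
    show "xs ! L = T" using ex[OF P(4)] le[of _ L] inP[of L] P(2) by force
  qed (use lt in auto)
  show thesis
  proof (rule that[OF g])
    fix j assume j: "j < L"
    show "xs ! Suc j - xs ! j \<le> h"
    proof (rule ccontr)
      assume "\<not> ?thesis"
      moreover have "T / N \<le> h" using N h N0 by (simp add: field_simps)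
      ultimately have big: "T / N < xs ! Suc j - xs ! j" by simp
      \<comment> \<open>The index of the first multiple of \<open>T / N\<close> strictly after
        \<open>xs ! j\<close>. In a cell longer than \<open>T / N\<close> this multiple would be an
        interior grid point.\<close>
      define k where "k = nat \<lfloor>xs ! j * N / T\<rfloor> + 1"
      have nn: "0 \<le> xs ! j" using inP[of j] P(2) j by auto
      have k: "xs ! j * N / T < k" "k \<le> xs ! j * N / T + 1"
        using nn T by (auto simp: k_def intro: order_trans[OF of_int_floor_le]) linarith
      have 1: "xs ! j < real k * T / N" using k(1) T N0 by (simp add: field_simps)
      have 2: "real k * T / N < xs ! Suc j"
      proof -
        have "real k * T / N \<le> (xs ! j * N / T + 1) * T / N"
          using k(2) T N0 by (intro divide_right_mono mult_right_mono) auto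
        also have "\<dots> = xs ! j + T / N" using T N0 by (simp add: field_simps)
        finally show ?thesis using big by simp
      qed
      also have "xs ! Suc j \<le> T" using inP[of "Suc j"] P(2) j by auto
      finally have "k \<le> N" using T N0 by (simp add: field_simps)
      then have "real k * T / N \<in> P" by (auto simp: P_def)
      then obtain i where "i \<le> L" "xs ! i = real k * T / N" using ex by blast
      then have "xs ! Suc j \<le> real k * T / N"
        using grid_no_between[OF g _ _ j, of "real k * T / N"] 1 by (metis atMost_iff imageI)
      then show False using 2 by simp
    qed
  next
    show "Q \<inter> {0..T} \<subseteq> (!) xs ` {..L}" using ex by (force simp: P_def)
  qed
qed

text \<open>Discrete stopping: \<open>k\<close> is the first failure of \<open>g\<close>, or
  \<open>L\<close>, and the sum telescopes up to it. The test on all \<open>i \<le> j\<close> makes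
  the decision about step \<open>j\<close> depend on the past only.\<close>

lemma stopped_sum:
  fixes f :: "nat \<Rightarrow> real"
  obtains k where "k \<le> L" "\<forall>j<k. g j" "k = L \<or> \<not> g k"
    "(\<Sum>j<L. if \<forall>i\<le>j. g i then f (Suc j) - f j else 0) = f k - f 0"
proof -
  have "\<exists>k\<le>L. (\<forall>j<k. g j) \<and> (k = L \<or> \<not> g k) \<and>
    (\<Sum>j<L. if \<forall>i\<le>j. g i then f (Suc j) - f j else 0) = f k - f 0"
  proof (induction L)
    case (Suc L)
    then obtain k where k: "k \<le> L" "\<forall>j<k. g j" "k = L \<or> \<not> g k"
      "(\<Sum>j<L. if \<forall>i\<le>j. g i then f (Suc j) - f j else 0) = f k - f 0" by blast
    show ?case
    proof (cases "k = L \<and> g L")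
      case True
      then have "\<forall>i\<le>L. g i" using k(2) by (metis le_neq_implies_less)
      then show ?thesis using k True by (intro exI[of _ "Suc L"]) (auto simp: less_Suc_eq_le)
    next
      case False
      then have "\<not> g k" using k(3) by auto
      then have "\<not> (\<forall>i\<le>L. g i)" using k(1) by blast
      then show ?thesis using k \<open>\<not> g k\<close> by (intro exI[of _ k]) auto
    qed
  qed simp
  then show thesis using that by blast
qed

text \<open>The constant value of a simple process on a cell from \<open>a\<close> to
  \<open>c\<close> without partition points inside. It is phrased by end points, so that only those
  \<open>\<xi> i\<close> enter that are known at time \<open>a\<close>.\<close>

definition step_coeff :: "nat \<Rightarrow> (nat \<Rightarrow> real) \<Rightarrow> (nat \<Rightarrow> 'w \<Rightarrow> real ^ 'k ^ 'n) \<Rightarrow> real \<Rightarrow> real \<Rightarrow> 'w \<Rightarrow> real ^ 'k ^ 'n" where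
  "step_coeff m p \<xi> a c w = (\<Sum>i<m. if p i \<le> a \<and> c \<le> p (Suc i) then \<xi> i w else 0)"

lemma step_coeff_value:
  assumes "\<And>i. i \<le> m \<Longrightarrow> p i \<notin> {a<..<c}" "s \<in> {a<..c}"
  shows "simple_value m p \<xi> s w = step_coeff m p \<xi> a c w"
  unfolding simple_value_def step_coeff_def
proof (rule sum.cong)
  fix i assume "i \<in> {..<m}"
  then have "p i \<notin> {a<..<c}" "p (Suc i) \<notin> {a<..<c}" using assms(1) by auto
  then show "indicator {p i<..p (Suc i)} s *\<^sub>R \<xi> i w = (if p i \<le> a \<and> c \<le> p (Suc i) then \<xi> i w else 0)"
    using assms(2) by (auto simp: indicator_def)
qed simp

text \<open>A cell lies after, inside or before each interval of the simple process, and only an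
  interval that contains it lets the integral move.\<close>

lemma step_coeff_integral:
  assumes "\<And>i. i \<le> m \<Longrightarrow> p i \<notin> {a<..<c}" "a < c" "\<And>i. i < m \<Longrightarrow> p i \<le> p (Suc i)"
  shows "simple_integral W m p \<xi> c w = simple_integral W m p \<xi> a w + step_coeff m p \<xi> a c w *v (W c w - W a w)"
proof -
  have "\<xi> i w *v (W (min (p (Suc i)) c) w - W (min (p i) c) w) - \<xi> i w *v (W (min (p (Suc i)) a) w - W (min (p i) a) w)
      = (if p i \<le> a \<and> c \<le> p (Suc i) then \<xi> i w else 0) *v (W c w - W a w)" if "i < m" for i
  proof -
    have "p i \<notin> {a<..<c}" "p (Suc i) \<notin> {a<..<c}" "p i \<le> p (Suc i)" using assms that by auto
    then consider "p i \<le> a" "p (Suc i) \<le> a" | "p i \<le> a" "c \<le> p (Suc i)" | "c \<le> p i" "c \<le> p (Suc i)"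
      by fastforce
    then show ?thesis
      by cases (use assms(2) in \<open>auto simp: min_def matrix_vector_mult_diff_distrib\<close>)
  qed
  then have "simple_integral W m p \<xi> c w - simple_integral W m p \<xi> a w
    = (\<Sum>i<m. (if p i \<le> a \<and> c \<le> p (Suc i) then \<xi> i w else 0) *v (W c w - W a w))"
    unfolding simple_integral_def by (simp add: sum_subtractf[symmetric])
  also have "\<dots> = step_coeff m p \<xi> a c w *v (W c w - W a w)"
    unfolding step_coeff_def
    by (induction m) (auto simp: matrix_vector_mult_add_rdistrib)
  finally show ?thesis by (simp add: algebra_simps)
qed

lemma simple_integral_0:
  assumes "0 \<le> p 0" "\<And>i. i < m \<Longrightarrow> p i \<le> p (Suc i)"
  shows "simple_integral W m p \<xi> 0 w = 0"
proof -
  have "0 \<le> p i" if "i \<le> m" for i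
    using that by (induction i) (use assms in \<open>auto intro: order_trans\<close>)
  then have "min (p (Suc i)) 0 = 0" "min (p i) 0 = 0" if "i < m" for i
    using that by (auto simp: min_def intro!: antisym)
  then show ?thesis unfolding simple_integral_def by simp
qed

lemma step_coeff_bounded:
  assumes "simple_process M F m p \<xi>"
  obtains B where "0 \<le> B" "\<And>a c w. w \<in> space M \<Longrightarrow> norm (step_coeff m p \<xi> a c w) \<le> B"
proof -
  have "\<forall>i<m. \<exists>B. \<forall>w\<in>space M. norm (\<xi> i w) \<le> B"
    using assms unfolding simple_process_def bounded_iff by blast
  then obtain B where B: "\<And>i w. i < m \<Longrightarrow> w \<in> space M \<Longrightarrow> norm (\<xi> i w) \<le> B i" by metis
  show thesis
  proof (rule that[of "\<Sum>i<m. \<bar>B i\<bar>"])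
    fix a c w assume w: "w \<in> space M"
    show "norm (step_coeff m p \<xi> a c w) \<le> (\<Sum>i<m. \<bar>B i\<bar>)"
      unfolding step_coeff_def
    proof (rule sum_norm_le)
      fix i assume "i \<in> {..<m}"
      then show "norm (if p i \<le> a \<and> c \<le> p (Suc i) then \<xi> i w else 0) \<le> \<bar>B i\<bar>"
        using B[of i w] w by (auto intro: order_trans)
    qed
  qed (simp add: sum_nonneg)
qed

section \<open>Adapted sums along a grid\<close>

context wiener
begin

lemma step_coeff_measurable:
  assumes "simple_process M F m p \<xi>"
  shows "step_coeff m p \<xi> a c \<in> borel_measurable (F a)"
  unfolding step_coeff_def
proof (rule borel_measurable_sum)
  fix i assume "i \<in> {..<m}"
  then have "\<xi> i \<in> borel_measurable (F (p i))" using assms unfolding simple_process_def by auto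
  then have "\<xi> i \<in> borel_measurable (F a)" if "p i \<le> a"
    using that by (rule F_measurable_mono)
  then show "(\<lambda>w. if p i \<le> a \<and> c \<le> p (Suc i) then \<xi> i w else 0) \<in> borel_measurable (F a)"
    by (cases "p i \<le> a \<and> c \<le> p (Suc i)") (simp, simp only: if_False borel_measurable_const)
qed

lemma simple_integral_measurable:
  assumes "simple_process M F m p \<xi>" "0 \<le> t"
  shows "simple_integral W m p \<xi> t \<in> borel_measurable (F t)"
proof -
  have p: "0 \<le> p i" if "i \<le> m" for i
    using that assms(1) by (induction i) (auto simp: simple_process_def intro: order_trans)
  have "(\<lambda>w. \<xi> i w *v (W (min (p (Suc i)) t) w - W (min (p i) t) w)) \<in> borel_measurable (F t)" if i: "i < m" for i
  proof (cases "p i \<le> t")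
    case True
    have [measurable]: "\<xi> i \<in> borel_measurable (F t)"
      using assms i True F_measurable_mono[of "\<xi> i" "p i" borel t] unfolding simple_process_def by auto
    have [measurable]: "W (min (p (Suc i)) t) \<in> borel_measurable (F t)" "W (min (p i) t) \<in> borel_measurable (F t)"
      using p[of i] p[of "Suc i"] i assms(2) by (auto intro!: W_F_measurable)
    show ?thesis by measurable
  next
    case False
    \<comment> \<open>The interval begins after \<open>t\<close>: the increment vanishes, so that
      \<open>\<xi> i\<close>, possibly unknown at time \<open>t\<close>, drops out.\<close>
    then have "min (p (Suc i)) t = t" "min (p i) t = t"
      using assms i unfolding simple_process_def by (auto simp: min_def)
    then show ?thesis by simp
  qed
  then have "(\<lambda>w. \<Sum>i<m. \<xi> i w *v (W (min (p (Suc i)) t) w - W (min (p i) t) w)) \<in> borel_measurable (F t)"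
    by (intro borel_measurable_sum) auto
  then show ?thesis unfolding simple_integral_def .
qed

text \<open>Coefficient \<open>j\<close> is known at \<open>t j\<close>, so every summand has mean
  zero. The three kinds of terms are the centred ones in \<open>euler_bound\<close>.\<close>

lemma martingale_sum:
  fixes c :: "nat \<Rightarrow> 'w \<Rightarrow> real ^ 'k" and A :: "nat \<Rightarrow> 'w \<Rightarrow> real ^ 'k ^ 'k" and q :: "nat \<Rightarrow> 'w \<Rightarrow> real"
  assumes g: "grid T L t"
    and c: "\<And>j. j < L \<Longrightarrow> c j \<in> borel_measurable (F (t j))" "\<And>j w. j < L \<Longrightarrow> w \<in> space M \<Longrightarrow> norm (c j w) \<le> B1"
    and A: "\<And>j. j < L \<Longrightarrow> A j \<in> borel_measurable (F (t j))" "\<And>j w. j < L \<Longrightarrow> w \<in> space M \<Longrightarrow> norm (A j w) \<le> B2"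
    and q: "\<And>j. j < L \<Longrightarrow> q j \<in> borel_measurable (F (t j))" "\<And>j w. j < L \<Longrightarrow> w \<in> space M \<Longrightarrow> \<bar>q j w\<bar> \<le> B3"
  defines "z \<equiv> \<lambda>j w. W (t (Suc j)) w - W (t j) w"
  shows "has_bochner_integral M (\<lambda>w. \<Sum>j<L. c j w \<bullet> z j w
      + 1 / 2 * (z j w \<bullet> (A j w *v z j w) - (t (Suc j) - t j) * trace (A j w))
      + q j w * ((norm (z j w))\<^sup>2 - real CARD('k) * (t (Suc j) - t j))) 0"
proof -
  have "has_bochner_integral M (\<lambda>w. \<Sum>j<L. c j w \<bullet> z j w
      + 1 / 2 * (z j w \<bullet> (A j w *v z j w) - (t (Suc j) - t j) * trace (A j w))
      + q j w * ((norm (z j w))\<^sup>2 - real CARD('k) * (t (Suc j) - t j))) (\<Sum>j<L. 0 + 1 / 2 * 0 + 0)"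
  proof (intro has_bochner_integral_sum has_bochner_integral_add has_bochner_integral_mult_right)
    fix j assume "j \<in> {..<L}"
    then have j: "j < L" by simp
    have s: "0 \<le> t j" "t j < t (Suc j)" using g j grid_bounds[OF g, of j] unfolding grid_def by auto
    show "has_bochner_integral M (\<lambda>w. c j w \<bullet> z j w) 0"
      unfolding z_def by (rule inner_increment[OF s c(1)[OF j] c(2)[OF j]])
    show "has_bochner_integral M (\<lambda>w. z j w \<bullet> (A j w *v z j w) - (t (Suc j) - t j) * trace (A j w)) 0"
      unfolding z_def by (rule quadratic_increment[OF s A(1)[OF j] A(2)[OF j]])
    show "has_bochner_integral M (\<lambda>w. q j w * ((norm (z j w))\<^sup>2 - real CARD('k) * (t (Suc j) - t j))) 0"
      unfolding z_def by (rule norm_increment(1)[OF s q(1)[OF j] q(2)[OF j]])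
  qed
  then show ?thesis by simp
qed


text \<open>Lenglart's domination inequality: stop the martingale \<open>D\<close> when it exceeds \<open>\<epsilon>\<close> or when the next
  step would raise its quadratic variation above \<open>\<gamma>\<close>.\<close>

lemma lenglart_grid:
  fixes x :: "nat \<Rightarrow> 'w \<Rightarrow> real ^ 'k ^ 'n" and D :: "nat \<Rightarrow> 'w \<Rightarrow> real ^ 'n"
  assumes g: "grid T L t" and e: "0 < \<epsilon>" and \<gamma>: "0 \<le> \<gamma>"
    and x: "\<And>j. j < L \<Longrightarrow> x j \<in> borel_measurable (F (t j))" "\<And>j w. j < L \<Longrightarrow> w \<in> space M \<Longrightarrow> norm (x j w) \<le> B"
    and Dm: "\<And>j. j \<le> L \<Longrightarrow> D j \<in> borel_measurable (F (t j))"
    and D0: "\<And>w. D 0 w = 0"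
    and D: "\<And>j w. j < L \<Longrightarrow> D (Suc j) w = D j w + x j w *v (W (t (Suc j)) w - W (t j) w)"
    and A: "A \<in> sets M" "\<And>w. w \<in> space M - A \<Longrightarrow> (\<Sum>j<L. (norm (x j w))\<^sup>2 * (t (Suc j) - t j)) \<le> \<gamma>"
  shows "prob {w \<in> space M. \<exists>j\<le>L. \<epsilon> < norm (D j w)} \<le> real CARD('k) * \<gamma> / \<epsilon>\<^sup>2 + prob A"
proof -
  define z where "z = (\<lambda>j w. W (t (Suc j)) w - W (t j) w)"
  \<comment> \<open>The sum includes the step still to be taken. Its coefficient \<open>x i\<close>
    is known at \<open>t i\<close>, so the decision to stop is too.\<close>
  define good where "good = (\<lambda>w i. norm (D i w) \<le> \<epsilon> \<and> (\<Sum>l\<le>i. (norm (x l w))\<^sup>2 * (t (Suc l) - t l)) \<le> \<gamma>)"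
  \<comment> \<open>Expanding the squared norm of \<open>D (Suc j)\<close>: \<open>c j\<close>
    carries the mixed term, and \<open>q j\<close> bounds the purely quadratic one.\<close>
  define c where "c = (\<lambda>j w. if \<forall>i\<le>j. good w i then transpose (x j w) *v (2 *\<^sub>R D j w) else 0)"
  define q where "q = (\<lambda>j w. if \<forall>i\<le>j. good w i then (norm (x j w))\<^sup>2 else 0)"
  define N where "N = (\<lambda>w. \<Sum>j<L. c j w \<bullet> z j w
      + 1 / 2 * (z j w \<bullet> ((0 :: real ^ 'k ^ 'k) *v z j w) - (t (Suc j) - t j) * trace (0 :: real ^ 'k ^ 'k))
      + q j w * ((norm (z j w))\<^sup>2 - real CARD('k) * (t (Suc j) - t j)))"
  have t: "t j < t (Suc j)" if "j < L" for j using g that unfolding grid_def by auto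
  have xm: "x i \<in> borel_measurable (F (t j))" if "i \<le> j" "j < L" for i j
    using F_measurable_mono[OF x(1)[of i] grid_mono[OF g, of i j]] that by auto
  have Dm': "D i \<in> borel_measurable (F (t j))" if "i \<le> j" "j < L" for i j
    using F_measurable_mono[OF Dm[of i] grid_mono[OF g, of i j]] that by auto
  have gm: "{w \<in> space (F (t j)). \<forall>i\<le>j. good w i} \<in> sets (F (t j))" if "j < L" for j
  proof -
    have "{w \<in> space (F (t j)). good w i} \<in> sets (F (t j))" if i: "i \<le> j" for i
    proof -
      have "(\<lambda>w. \<Sum>l\<le>i. (norm (x l w))\<^sup>2 * (t (Suc l) - t l)) \<in> borel_measurable (F (t j))"
        using xm i \<open>j < L\<close> by (intro borel_measurable_sum borel_measurable_times borel_measurable_power borel_measurable_norm) auto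
      moreover have "(\<lambda>w. norm (D i w)) \<in> borel_measurable (F (t j))"
        by (rule measurable_compose[OF Dm'[OF i \<open>j < L\<close>] borel_measurable_norm])
      ultimately show ?thesis unfolding good_def
        by (intro sets.sets_Collect_conj borel_measurable_le borel_measurable_const)
    qed
    then have "{w \<in> space (F (t j)). \<forall>i\<in>{..j}. good w i} \<in> sets (F (t j))"
      by (intro sets.sets_Collect_finite_All) auto
    then show ?thesis by (simp only: Ball_def atMost_iff)
  qed
  have meas: "c j \<in> borel_measurable (F (t j))" "q j \<in> borel_measurable (F (t j))" if j: "j < L" for j
  proof -
    note xj = xm[OF order_refl j] and Dj = Dm'[OF order_refl j]
    show "c j \<in> borel_measurable (F (t j))" unfolding c_def
      by (intro measurable_If gm[OF j] borel_measurable_matrix_vector_mult borel_measurable_transpose xj Dj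
          borel_measurable_scaleR borel_measurable_const)
    show "q j \<in> borel_measurable (F (t j))" unfolding q_def
      by (intro measurable_If gm[OF j] borel_measurable_power measurable_compose[OF xj borel_measurable_norm] borel_measurable_const)
  qed
  have c_le: "norm (c j w) \<le> B * (2 * \<epsilon>)" and q_le: "\<bar>q j w\<bar> \<le> B\<^sup>2" if j: "j < L" and w: "w \<in> space M" for j w
  proof -
    have B: "norm (x j w) \<le> B" using x(2)[OF j w] .
    then have B0: "0 \<le> B" using norm_ge_zero order_trans by blast
    show "norm (c j w) \<le> B * (2 * \<epsilon>)"
    proof (cases "\<forall>i\<le>j. good w i")
      case True
      then have "norm (D j w) \<le> \<epsilon>" by (auto simp: good_def)
      then have "norm (transpose (x j w)) * norm (2 *\<^sub>R D j w) \<le> B * (2 * \<epsilon>)"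
        using B B0 by (intro mult_mono) (auto simp: norm_transpose)
      then have "norm (transpose (x j w) *v (2 *\<^sub>R D j w)) \<le> B * (2 * \<epsilon>)"
        using norm_matrix_vector_mult_le order_trans by blast
      then show ?thesis using True by (simp add: c_def)
    qed (use B0 e in \<open>auto simp: c_def\<close>)
    show "\<bar>q j w\<bar> \<le> B\<^sup>2" using power_mono[OF B, of 2] by (auto simp: q_def)
  qed
  have N: "has_bochner_integral M N 0"
    unfolding N_def z_def
    by (rule martingale_sum[OF g meas(1) c_le _ _ meas(2) q_le, where A = "\<lambda>_ _. 0" and ?B2.0 = 0]) simp_all
  have stop: "\<exists>k\<le>L. (norm (D k w))\<^sup>2 \<le> N w + real CARD('k) * \<gamma> \<and> (\<forall>i<k. good w i) \<and> (k = L \<or> \<not> good w k)" for w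
  proof -
    obtain k where k: "k \<le> L" "\<forall>j<k. good w j" "k = L \<or> \<not> good w k"
      "(\<Sum>j<L. if \<forall>i\<le>j. good w i then (norm (D (Suc j) w))\<^sup>2 - (norm (D j w))\<^sup>2 else 0) = (norm (D k w))\<^sup>2 - (norm (D 0 w))\<^sup>2"
      by (rule stopped_sum[where L = L and g = "good w" and f = "\<lambda>j. (norm (D j w))\<^sup>2"])
    have "(if \<forall>i\<le>j. good w i then (norm (D (Suc j) w))\<^sup>2 - (norm (D j w))\<^sup>2 else 0) \<le>
      (c j w \<bullet> z j w + 1 / 2 * (z j w \<bullet> ((0 :: real ^ 'k ^ 'k) *v z j w) - (t (Suc j) - t j) * trace (0 :: real ^ 'k ^ 'k))
      + q j w * ((norm (z j w))\<^sup>2 - real CARD('k) * (t (Suc j) - t j))) + real CARD('k) * (q j w * (t (Suc j) - t j))"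
      if j: "j < L" for j
    proof (cases "\<forall>i\<le>j. good w i")
      case True
      let ?u = "x j w *v z j w"
      have "(norm (D (Suc j) w))\<^sup>2 - (norm (D j w))\<^sup>2 = 2 * (D j w \<bullet> ?u) + (norm ?u)\<^sup>2"
        using D[OF j, of w] unfolding power2_norm_eq_inner z_def by (simp add: inner_add_left inner_add_right inner_commute)
      also have "2 * (D j w \<bullet> ?u) = (transpose (x j w) *v (2 *\<^sub>R D j w)) \<bullet> z j w"
        by (simp add: transpose_matrix_vector dot_lmul_matrix)
      also have "(norm ?u)\<^sup>2 \<le> (norm (x j w))\<^sup>2 * (norm (z j w))\<^sup>2"
        using power_mono[OF norm_matrix_vector_mult_le, of "x j w" "z j w" 2] by (simp add: power_mult_distrib)
      finally show ?thesis using True by (simp add: c_def q_def trace_def algebra_simps)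
    next
      case False
      then have 0: "c j w = 0" "q j w = 0" by (simp_all only: c_def q_def if_False)
      show ?thesis unfolding 0 if_not_P[OF False] by (simp add: trace_def)
    qed
    then have "(\<Sum>j<L. if \<forall>i\<le>j. good w i then (norm (D (Suc j) w))\<^sup>2 - (norm (D j w))\<^sup>2 else 0)
       \<le> N w + (\<Sum>j<L. real CARD('k) * (q j w * (t (Suc j) - t j)))"
      unfolding N_def sum.distrib[symmetric] by (intro sum_mono) auto
    also have "(\<Sum>j<L. real CARD('k) * (q j w * (t (Suc j) - t j))) = real CARD('k) * (\<Sum>j<L. q j w * (t (Suc j) - t j))"
      by (simp add: sum_distrib_left)
    also have "(\<Sum>j<L. q j w * (t (Suc j) - t j)) \<le> \<gamma>"
    proof -
      have "(\<Sum>j<L. q j w * (t (Suc j) - t j)) = (\<Sum>j<k. q j w * (t (Suc j) - t j))"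
        using k(1,3) by (intro sum.mono_neutral_right) (auto simp: q_def)
      also have "\<dots> = (\<Sum>j<k. (norm (x j w))\<^sup>2 * (t (Suc j) - t j))"
        using k(2) by (intro sum.cong) (auto simp: q_def)
      also have "\<dots> \<le> \<gamma>"
      proof (cases k)
        \<comment> \<open>The last step taken is \<open>k'\<close>, and \<open>good w k'\<close>
          bounds exactly the sum up to and including it.\<close>
        case (Suc k')
        then have "good w k'" using k(2) by simp
        then show ?thesis using Suc by (simp add: good_def lessThan_Suc_atMost)
      qed (use \<gamma> in simp)
      finally show ?thesis .
    qed
    finally have "(norm (D k w))\<^sup>2 \<le> N w + real CARD('k) * \<gamma>" using k(4) D0 by (simp add: mult_left_mono)
    then show ?thesis using k by blast
  qed
  define E where "E = {w \<in> space M. \<exists>j\<le>L. \<epsilon> < norm (D j w)}"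
  have "{w \<in> space M. \<epsilon> < norm (D j w)} \<in> sets M" if "j \<le> L" for j
    using F_measurable_M[OF Dm[OF that]] by measurable
  then have "(\<Union>j\<in>{..L}. {w \<in> space M. \<epsilon> < norm (D j w)}) \<in> sets M" by (intro sets.finite_UN) auto
  also have "(\<Union>j\<in>{..L}. {w \<in> space M. \<epsilon> < norm (D j w)}) = E" by (auto simp: E_def)
  finally have Em: "E \<in> sets M" .
  have "\<epsilon>\<^sup>2 * indicator (E - A) w \<le> N w + real CARD('k) * \<gamma>" if w: "w \<in> space M" for w
  proof -
    obtain k where k: "k \<le> L" "(norm (D k w))\<^sup>2 \<le> N w + real CARD('k) * \<gamma>" "\<forall>i<k. good w i" "k = L \<or> \<not> good w k"
      using stop by blast
    show ?thesis
    proof (cases "w \<in> E - A")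
      case True
      then obtain j where j: "j \<le> L" "\<epsilon> < norm (D j w)" by (auto simp: E_def)
      then have "\<not> good w j" by (auto simp: good_def)
      then have kj: "k \<le> j" using k(3) not_less by blast
      \<comment> \<open>Off \<open>A\<close> the budget is never exceeded, so stopping before
        \<open>L\<close> is due to the size of \<open>D\<close>; stopping at \<open>L\<close> leaves
        only \<open>j = L\<close>.\<close>
      have "\<epsilon> < norm (D k w)"
      proof (cases "k = L")
        case True
        then show ?thesis using kj j by simp
      next
        case False
        have "(\<Sum>l\<le>k. (norm (x l w))\<^sup>2 * (t (Suc l) - t l)) \<le> (\<Sum>l<L. (norm (x l w))\<^sup>2 * (t (Suc l) - t l))"
          using False k(1) t by (intro sum_mono2) (auto simp: less_imp_le)
        also have "\<dots> \<le> \<gamma>" using A(2) True w by auto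
        finally show ?thesis using False k(4) by (auto simp: good_def)
      qed
      then have "\<epsilon>\<^sup>2 \<le> (norm (D k w))\<^sup>2" using e by (intro power_mono) auto
      then show ?thesis using k(2) True by simp
    next
      case False
      then show ?thesis using k(2) order_trans[OF zero_le_power2 k(2)] by simp
    qed
  qed
  moreover have "integrable M (\<lambda>w. \<epsilon>\<^sup>2 * indicator (E - A) w)"
    using Em A(1) by (intro integrable_mult_right integrable_real_indicator) (auto simp: less_top[symmetric])
  moreover have "integrable M (\<lambda>w. N w + real CARD('k) * \<gamma>)"
    using N by (simp add: has_bochner_integral_iff)
  ultimately have "expectation (\<lambda>w. \<epsilon>\<^sup>2 * indicator (E - A) w) \<le> expectation (\<lambda>w. N w + real CARD('k) * \<gamma>)"
    by (intro integral_mono)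
  also have "\<dots> = real CARD('k) * \<gamma>" using N by (simp add: has_bochner_integral_iff prob_space)
  finally have "prob (E - A) \<le> real CARD('k) * \<gamma> / \<epsilon>\<^sup>2"
    using Em A(1) e by (simp add: field_simps)
  moreover have "prob E \<le> prob (E - A) + prob A"
    using Em A(1) finite_measure_mono[of E "(E - A) \<union> A"] measure_Un_le[of "E - A" M A] by auto
  ultimately show ?thesis unfolding E_def by linarith
qed

end

section \<open>Approximation of Ito integrals\<close>

context wiener
begin

lemma progressive_measurable_M:
  fixes H :: "real \<Rightarrow> 'w \<Rightarrow> real ^ 'k ^ 'n"
  assumes "progressive F H" "0 \<le> T"
  shows "(\<lambda>(s, w). H s w) \<in> borel_measurable (restrict_space lborel {0..T} \<Otimes>\<^sub>M M)"
proof -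
  have 1: "(\<lambda>w. w) \<in> measurable M (F T)"
    using sets_F_subset[of T] by (intro measurableI) (auto dest: sets.sets_into_space)
  have 2: "(\<lambda>s. s) \<in> measurable (restrict_space lborel {0..T}) (restrict_space borel {0..T})"
    by (intro measurable_restrict_space3) auto
  have "(\<lambda>x. (fst x, snd x)) \<in> measurable (restrict_space lborel {0..T} \<Otimes>\<^sub>M M) (restrict_space borel {0..T} \<Otimes>\<^sub>M F T)"
    by (rule measurable_Pair[OF measurable_compose[OF measurable_fst 2] measurable_compose[OF measurable_snd 1]])
  moreover have "(\<lambda>(s, w). H s w) \<in> borel_measurable (restrict_space borel {0..T} \<Otimes>\<^sub>M F T)"
    using assms unfolding progressive_def by blast
  ultimately have "(\<lambda>x. (\<lambda>(s, w). H s w) (fst x, snd x)) \<in> borel_measurable (restrict_space lborel {0..T} \<Otimes>\<^sub>M M)"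
    by (rule measurable_compose)
  then show ?thesis by simp
qed

lemma simple_value_measurable:
  assumes "simple_process M F m p \<xi>"
  shows "(\<lambda>(s, w). simple_value m p \<xi> s w) \<in> borel_measurable (restrict_space lborel {0..T} \<Otimes>\<^sub>M M)"
proof -
  have "(\<lambda>x. indicator {p i<..p (Suc i)} (fst x) *\<^sub>R \<xi> i (snd x)) \<in> borel_measurable (restrict_space lborel {0..T} \<Otimes>\<^sub>M M)"
    if i: "i < m" for i
  proof -
    have "\<xi> i \<in> borel_measurable M"
      using assms i unfolding simple_process_def by (auto intro: F_measurable_M)
    from measurable_compose[OF measurable_snd this]
    have 1: "(\<lambda>x. \<xi> i (snd x)) \<in> borel_measurable (restrict_space lborel {0..T} \<Otimes>\<^sub>M M)" .
    have "(\<lambda>s. indicator {p i<..p (Suc i)} s :: real) \<in> borel_measurable (restrict_space lborel {0..T})"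
      by (intro measurable_restrict_space1) simp
    from borel_measurable_scaleR[OF measurable_compose[OF measurable_fst this] 1] show ?thesis .
  qed
  then have "(\<lambda>x. \<Sum>i<m. indicator {p i<..p (Suc i)} (fst x) *\<^sub>R \<xi> i (snd x)) \<in> borel_measurable (restrict_space lborel {0..T} \<Otimes>\<^sub>M M)"
    by (intro borel_measurable_sum) auto
  then show ?thesis unfolding simple_value_def by (simp add: case_prod_beta)
qed

text \<open>Tonelli's theorem needs joint measurability, which progressive processes offer only over
  \<open>{0..T}\<close>; hence the detour through the restricted Lebesgue measure.\<close>

lemma sq_dist_measurable:
  fixes G H :: "real \<Rightarrow> 'w \<Rightarrow> 'b::{second_countable_topology, real_normed_vector}"
  assumes "(\<lambda>(s, w). G s w) \<in> borel_measurable (restrict_space lborel {0..T} \<Otimes>\<^sub>M M)"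
    and "(\<lambda>(s, w). H s w) \<in> borel_measurable (restrict_space lborel {0..T} \<Otimes>\<^sub>M M)"
  shows "(\<lambda>w. \<integral>\<^sup>+s\<in>{0..T}. ennreal ((norm (G s w - H s w))\<^sup>2) \<partial>lborel) \<in> borel_measurable M"
    and "w \<in> space M \<Longrightarrow> (\<lambda>s. ennreal ((norm (G s w - H s w))\<^sup>2) * indicator {0..T} s) \<in> borel_measurable lborel"
proof -
  let ?R = "restrict_space lborel {0..T::real}"
  have f: "(\<lambda>(s, w). ennreal ((norm (G s w - H s w))\<^sup>2)) \<in> borel_measurable (?R \<Otimes>\<^sub>M M)"
    using assms unfolding case_prod_beta by measurable
  have sf: "sigma_finite_measure ?R"
    by (rule sigma_finite_measure_restrict_space[OF lborel.sigma_finite_measure_axioms]) simp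
  have "(\<lambda>(w, s). ennreal ((norm (G s w - H s w))\<^sup>2)) \<in> borel_measurable (M \<Otimes>\<^sub>M ?R)"
    using measurable_pair_swap[OF f] by (simp add: case_prod_beta)
  then have "(\<lambda>w. \<integral>\<^sup>+s. ennreal ((norm (G s w - H s w))\<^sup>2) \<partial>?R) \<in> borel_measurable M"
    by (rule sigma_finite_measure.borel_measurable_nn_integral[OF sf])
  then show "(\<lambda>w. \<integral>\<^sup>+s\<in>{0..T}. ennreal ((norm (G s w - H s w))\<^sup>2) \<partial>lborel) \<in> borel_measurable M"
    by (simp add: nn_integral_restrict_space)
  assume w: "w \<in> space M"
  have "(\<lambda>s. ennreal ((norm (G s w - H s w))\<^sup>2)) \<in> borel_measurable ?R"
    using measurable_compose[OF measurable_Pair2'[OF w] f] by simp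
  then show "(\<lambda>s. ennreal ((norm (G s w - H s w))\<^sup>2) * indicator {0..T} s) \<in> borel_measurable lborel"
    by (subst (asm) borel_measurable_restrict_space_iff_ennreal) auto
qed

text \<open>Open cells are disjoint and lose only finitely many points, so comparing with
  \<open>f\<close> in their interiors is enough.\<close>

lemma grid_sum_le_nn_integral:
  assumes g: "grid T L t" and a: "\<And>j. j < L \<Longrightarrow> 0 \<le> a j"
    and le: "\<And>j s. j < L \<Longrightarrow> s \<in> {t j<..<t (Suc j)} \<Longrightarrow> ennreal (a j) \<le> f s"
  shows "ennreal (\<Sum>j<L. a j * (t (Suc j) - t j)) \<le> (\<integral>\<^sup>+s\<in>{0..T}. f s \<partial>lborel)"
proof -
  have t: "t j < t (Suc j)" if "j < L" for j using g that unfolding grid_def by auto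
  let ?I = "\<lambda>j. {t j<..<t (Suc j)}"
  have "ennreal (\<Sum>j<L. a j * (t (Suc j) - t j)) = (\<Sum>j<L. ennreal (a j * (t (Suc j) - t j)))"
    by (rule sum_ennreal[symmetric], rule mult_nonneg_nonneg) (use a t in \<open>auto simp: less_imp_le\<close>)
  also have "\<dots> = (\<Sum>j<L. ennreal (a j) * emeasure lborel (?I j))"
  proof (rule sum.cong[OF refl])
    fix j assume "j \<in> {..<L}"
    then have "0 \<le> a j" "t j \<le> t (Suc j)" using a t by (auto simp: less_imp_le)
    then show "ennreal (a j * (t (Suc j) - t j)) = ennreal (a j) * emeasure lborel (?I j)"
      by (simp add: ennreal_mult)
  qed
  also have "\<dots> = (\<Sum>j<L. \<integral>\<^sup>+s. ennreal (a j) * indicator (?I j) s \<partial>lborel)"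
    by (intro sum.cong refl nn_integral_cmult_indicator[symmetric]) simp
  also have "\<dots> = (\<integral>\<^sup>+s. (\<Sum>j<L. ennreal (a j) * indicator (?I j) s) \<partial>lborel)"
    by (intro nn_integral_sum[symmetric]) auto
  also have "\<dots> \<le> (\<integral>\<^sup>+s\<in>{0..T}. f s \<partial>lborel)"
  proof (rule nn_integral_mono)
    fix s
    show "(\<Sum>j<L. ennreal (a j) * indicator (?I j) s) \<le> f s * indicator {0..T} s"
    proof (cases "\<exists>j<L. s \<in> ?I j")
      case True
      then obtain j where j: "j < L" "s \<in> ?I j" by blast
      have uniq: "i = j" if i: "i < L" "s \<in> ?I i" for i
      proof (rule ccontr)
        assume "i \<noteq> j"
        then consider "Suc i \<le> j" | "Suc j \<le> i" by linarith
        then show False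
          by cases (use grid_mono[OF g, of "Suc i" j] grid_mono[OF g, of "Suc j" i] i j in auto)
      qed
      have "(\<Sum>i<L. ennreal (a i) * indicator (?I i) s) = (\<Sum>i\<in>{j}. ennreal (a i) * indicator (?I i) s)"
      proof (rule sum.mono_neutral_right)
        show "\<forall>i\<in>{..<L} - {j}. ennreal (a i) * indicator (?I i) s = 0"
        proof
          fix i assume "i \<in> {..<L} - {j}"
          then have "s \<notin> ?I i" using uniq by blast
          then show "ennreal (a i) * indicator (?I i) s = 0" by simp
        qed
      qed (use j in auto)
      also have "\<dots> \<le> f s" using j le by simp
      finally show ?thesis
        using grid_bounds[OF g, of j] grid_bounds[OF g, of "Suc j"] j by simp
    next
      case False
      then have "(\<Sum>j<L. ennreal (a j) * indicator (?I j) s) = 0" by (intro sum.neutral) auto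
      then show ?thesis by (simp only: zero_le)
    qed
  qed
  finally show ?thesis .
qed

lemma norm_diff_sq_le: "(norm (a - b))\<^sup>2 \<le> 2 * (norm (a - c))\<^sup>2 + 2 * (norm (b - c :: 'b::real_normed_vector))\<^sup>2"
proof -
  have "norm (a - b) \<le> norm (a - c) + norm (b - c)"
    using norm_triangle_ineq4[of "a - c" "b - c"] by simp
  then have "(norm (a - b))\<^sup>2 \<le> (norm (a - c) + norm (b - c))\<^sup>2" by (intro power_mono) auto
  also have "\<dots> \<le> 2 * (norm (a - c))\<^sup>2 + 2 * (norm (b - c))\<^sup>2"
    using sum_squares_bound[of "norm (a - c)" "norm (b - c)"] by (simp add: power2_sum)
  finally show ?thesis .
qed

abbreviation l2_error :: "real \<Rightarrow> nat \<Rightarrow> (nat \<Rightarrow> real) \<Rightarrow> (nat \<Rightarrow> 'w \<Rightarrow> real ^ 'k ^ 'n) \<Rightarrow> (real \<Rightarrow> 'w \<Rightarrow> real ^ 'k ^ 'n) \<Rightarrow> 'w \<Rightarrow> ennreal" where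
  "l2_error T m p \<xi> H w \<equiv> \<integral>\<^sup>+s\<in>{0..T}. ennreal ((norm (simple_value m p \<xi> s w - H s w))\<^sup>2) \<partial>lborel"

text \<open>On a grid through \<open>Q\<close> and all partition points the difference of the
  integrals evolves by the differences of the step values. Their squares are at most twice the sum
  of the two squared errors against \<open>H\<close>, which explains \<open>4 * \<gamma>\<close>,
  and Lenglart's inequality applies.\<close>

lemma simple_integrals_close:
  assumes T: "0 < T" and Q: "finite Q" "Q \<subseteq> {0..T}" and e: "0 < \<epsilon>" and \<gamma>: "0 \<le> \<gamma>"
    and S: "simple_process M F m p \<xi>" "simple_process M F m' p' \<xi>'"
    and H: "(\<lambda>(s, w). H s w) \<in> borel_measurable (restrict_space lborel {0..T} \<Otimes>\<^sub>M M)"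
    and A: "A \<in> sets M" "\<And>w. w \<in> space M - A \<Longrightarrow>
        l2_error T m p \<xi> H w \<le> ennreal \<gamma> \<and>
        l2_error T m' p' \<xi>' H w \<le> ennreal \<gamma>"
  shows "prob {w \<in> space M. \<exists>t\<in>Q. \<epsilon> < norm (simple_integral W m p \<xi> t w - simple_integral W m' p' \<xi>' t w)}
    \<le> real CARD('k) * (4 * \<gamma>) / \<epsilon>\<^sup>2 + prob A"
proof -
  obtain L t where g: "grid T L t" and Qt: "(Q \<union> p ` {..m} \<union> p' ` {..m'}) \<inter> {0..T} \<subseteq> t ` {..L}"
    using grid_exists[OF T T, of "Q \<union> p ` {..m} \<union> p' ` {..m'}"] Q by (metis finite_UnI finite_imageI finite_atMost)
  have nob: "u \<notin> {t j<..<t (Suc j)}" if "u \<in> Q \<union> p ` {..m} \<union> p' ` {..m'}" "j < L" for u j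
  proof
    assume u: "u \<in> {t j<..<t (Suc j)}"
    then have "u \<in> {0..T}" using grid_bounds[OF g, of j] grid_bounds[OF g, of "Suc j"] that by auto
    then have "u \<in> t ` {..L}" using Qt that by blast
    from grid_no_between[OF g this _ that(2)] u show False by auto
  qed
  have tl: "t j < t (Suc j)" if "j < L" for j using g that unfolding grid_def by auto
  define x where "x = (\<lambda>j w. step_coeff m p \<xi> (t j) (t (Suc j)) w - step_coeff m' p' \<xi>' (t j) (t (Suc j)) w)"
  define D where "D = (\<lambda>j w. simple_integral W m p \<xi> (t j) w - simple_integral W m' p' \<xi>' (t j) w)"
  obtain B1 where B1: "\<forall>a c. \<forall>w\<in>space M. norm (step_coeff m p \<xi> a c w) \<le> B1"
    using step_coeff_bounded[OF S(1)] by metis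
  obtain B2 where B2: "\<forall>a c. \<forall>w\<in>space M. norm (step_coeff m' p' \<xi>' a c w) \<le> B2"
    using step_coeff_bounded[OF S(2)] by metis
  have "prob {w \<in> space M. \<exists>j\<le>L. \<epsilon> < norm (D j w)} \<le> real CARD('k) * (4 * \<gamma>) / \<epsilon>\<^sup>2 + prob A"
  proof (rule lenglart_grid[OF g e _ _ _ _ _ _ A(1), where x = x and B = "B1 + B2"])
    show "0 \<le> 4 * \<gamma>" using \<gamma> by simp
    fix j
    show "j < L \<Longrightarrow> x j \<in> borel_measurable (F (t j))"
      unfolding x_def using step_coeff_measurable[OF S(1)] step_coeff_measurable[OF S(2)]
      by (intro borel_measurable_diff) auto
    show "norm (x j w) \<le> B1 + B2" if "w \<in> space M" for w
      unfolding x_def by (rule order_trans[OF norm_triangle_ineq4 add_mono]) (use B1 B2 that in auto)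
    show "j \<le> L \<Longrightarrow> D j \<in> borel_measurable (F (t j))"
      unfolding D_def using grid_bounds[OF g, of j] simple_integral_measurable[OF S(1), of "t j"] simple_integral_measurable[OF S(2), of "t j"]
      by (intro borel_measurable_diff) auto
    show "D 0 w = 0" for w
      using g simple_integral_0[of p m W \<xi> w] simple_integral_0[of p' m' W \<xi>' w] S
      unfolding D_def grid_def simple_process_def by auto
    show "D (Suc j) w = D j w + x j w *v (W (t (Suc j)) w - W (t j) w)" if j: "j < L" for w
      using step_coeff_integral[of m p "t j" "t (Suc j)" W \<xi> w] step_coeff_integral[of m' p' "t j" "t (Suc j)" W \<xi>' w]
        tl[OF j] nob[OF _ j] S
      unfolding D_def x_def simple_process_def by (simp add: matrix_vector_mult_diff_rdistrib)
  next
    fix w assume w: "w \<in> space M - A"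
    let ?f = "\<lambda>s. ennreal ((norm (simple_value m p \<xi> s w - H s w))\<^sup>2)"
    let ?f' = "\<lambda>s. ennreal ((norm (simple_value m' p' \<xi>' s w - H s w))\<^sup>2)"
    have ms: "(\<lambda>s. ?f s * indicator {0..T} s) \<in> borel_measurable lborel"
      "(\<lambda>s. ?f' s * indicator {0..T} s) \<in> borel_measurable lborel"
      using w sq_dist_measurable(2)[OF simple_value_measurable[OF S(1)] H, of w] sq_dist_measurable(2)[OF simple_value_measurable[OF S(2)] H, of w] by auto
    have "ennreal (\<Sum>j<L. (norm (x j w))\<^sup>2 * (t (Suc j) - t j)) \<le> (\<integral>\<^sup>+s\<in>{0..T}. (2 * ?f s + 2 * ?f' s) \<partial>lborel)"
    proof (rule grid_sum_le_nn_integral[OF g])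
      fix j s assume j: "j < L" and s: "s \<in> {t j<..<t (Suc j)}"
      have "x j w = simple_value m p \<xi> s w - simple_value m' p' \<xi>' s w"
        using step_coeff_value[of m p "t j" "t (Suc j)" s \<xi> w] step_coeff_value[of m' p' "t j" "t (Suc j)" s \<xi>' w]
          nob[OF _ j] s by (simp add: x_def)
      then have "(norm (x j w))\<^sup>2 \<le> 2 * (norm (simple_value m p \<xi> s w - H s w))\<^sup>2 + 2 * (norm (simple_value m' p' \<xi>' s w - H s w))\<^sup>2"
        using norm_diff_sq_le by metis
      then have "ennreal ((norm (x j w))\<^sup>2) \<le> ennreal (2 * (norm (simple_value m p \<xi> s w - H s w))\<^sup>2 + 2 * (norm (simple_value m' p' \<xi>' s w - H s w))\<^sup>2)"
        by (rule ennreal_leI)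
      then show "ennreal ((norm (x j w))\<^sup>2) \<le> 2 * ?f s + 2 * ?f' s"
        by (simp add: ennreal_plus ennreal_mult)
    qed simp
    also have "\<dots> = (\<integral>\<^sup>+s. 2 * (?f s * indicator {0..T} s) + 2 * (?f' s * indicator {0..T} s) \<partial>lborel)"
      by (intro nn_integral_cong) (simp add: distrib_right mult.assoc)
    also have "\<dots> = 2 * (\<integral>\<^sup>+s\<in>{0..T}. ?f s \<partial>lborel) + 2 * (\<integral>\<^sup>+s\<in>{0..T}. ?f' s \<partial>lborel)"
      using ms by (simp add: nn_integral_add nn_integral_cmult)
    also have "\<dots> \<le> 2 * ennreal \<gamma> + 2 * ennreal \<gamma>"
      using A(2)[OF w] by (intro add_mono mult_left_mono) auto
    also have "\<dots> = ennreal (4 * \<gamma>)"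
      using \<gamma> by (simp add: ennreal_mult flip: distrib_right)
    finally show "(\<Sum>j<L. (norm (x j w))\<^sup>2 * (t (Suc j) - t j)) \<le> 4 * \<gamma>"
      using \<gamma> by simp
  qed
  moreover have "{w \<in> space M. \<exists>j\<le>L. \<epsilon> < norm (D j w)} \<in> sets M"
  proof -
    have "{w \<in> space M. \<epsilon> < norm (D j w)} \<in> sets M" if "j \<le> L" for j
    proof -
      have "simple_integral W m p \<xi> (t j) \<in> borel_measurable M" "simple_integral W m' p' \<xi>' (t j) \<in> borel_measurable M"
        using simple_integral_measurable[OF S(1)] simple_integral_measurable[OF S(2)] grid_bounds[OF g that] F_measurable_M by blast+
      then show ?thesis unfolding D_def by measurable
    qed
    then have "(\<Union>j\<in>{..L}. {w \<in> space M. \<epsilon> < norm (D j w)}) \<in> sets M" by (intro sets.finite_UN) auto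
    also have "(\<Union>j\<in>{..L}. {w \<in> space M. \<epsilon> < norm (D j w)}) = {w \<in> space M. \<exists>j\<le>L. \<epsilon> < norm (D j w)}" by auto
    finally show ?thesis .
  qed
  moreover have "{w \<in> space M. \<exists>u\<in>Q. \<epsilon> < norm (simple_integral W m p \<xi> u w - simple_integral W m' p' \<xi>' u w)}
      \<subseteq> {w \<in> space M. \<exists>j\<le>L. \<epsilon> < norm (D j w)}"
  proof safe
    fix w u assume "u \<in> Q" and u: "\<epsilon> < norm (simple_integral W m p \<xi> u w - simple_integral W m' p' \<xi>' u w)"
    then obtain j where "j \<le> L" "u = t j" using Qt Q(2) by blast
    then show "\<exists>j\<le>L. \<epsilon> < norm (D j w)" using u unfolding D_def by blast
  qed
  ultimately show ?thesis using finite_measure_mono order_trans by blast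
qed

text \<open>The definition gives convergence at single times only, while the simple process has to
  be fixed before the grid. For each \<open>Q\<close> a second, better approximation is close to
  \<open>I\<close> on \<open>Q\<close>, and \<open>simple_integrals_close\<close> compares it with
  the fixed one at a cost independent of \<open>Q\<close>.\<close>

lemma ito_integral_approx:
  assumes I: "has_ito_integral M W H I" and T: "0 < T" and e: "0 < \<epsilon>" and \<gamma>: "0 < \<gamma>" and \<eta>: "0 < \<eta>"
  obtains m p \<xi> A where "simple_process M F m p \<xi>" "A \<in> sets M" "prob A \<le> \<eta>"
    "\<forall>w\<in>space M - A. l2_error T m p \<xi> H w \<le> ennreal \<gamma>"
    "\<forall>Q. finite Q \<and> Q \<subseteq> {0..T} \<longrightarrow>
      prob {w \<in> space M. \<exists>t\<in>Q. \<epsilon> < norm (simple_integral W m p \<xi> t w - I t w)} \<le> \<eta>"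
proof -
  define K where "K = real CARD('k)"
  have K: "0 < K" by (simp add: K_def)
  \<comment> \<open>The second entry makes the Lenglart bound at threshold
    \<open>\<epsilon> / 2\<close> at most \<open>\<eta> / 4\<close>.\<close>
  define \<gamma>' where "\<gamma>' = min \<gamma> (\<eta> * \<epsilon>\<^sup>2 / (64 * K))"
  have \<gamma>': "0 < \<gamma>'" "\<gamma>' \<le> \<gamma>" "K * (4 * \<gamma>') / (\<epsilon> / 2)\<^sup>2 \<le> \<eta> / 4"
  proof -
    show "0 < \<gamma>'" "\<gamma>' \<le> \<gamma>" using \<gamma> \<eta> e K by (auto simp: \<gamma>'_def)
    have "K * (4 * \<gamma>') / (\<epsilon> / 2)\<^sup>2 \<le> K * (4 * (\<eta> * \<epsilon>\<^sup>2 / (64 * K))) / (\<epsilon> / 2)\<^sup>2"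
      using K by (intro divide_right_mono mult_left_mono) (auto simp: \<gamma>'_def)
    also have "\<dots> = \<eta> / 4" using K e by (simp add: field_simps power2_eq_square)
    finally show "K * (4 * \<gamma>') / (\<epsilon> / 2)\<^sup>2 \<le> \<eta> / 4" .
  qed
  have H: "(\<lambda>(s, w). H s w) \<in> borel_measurable (restrict_space lborel {0..T} \<Otimes>\<^sub>M M)"
    using I T unfolding has_ito_integral_def by (intro progressive_measurable_M) auto
  obtain m p \<xi> where *: "(\<forall>n. simple_process M F (m n) (p n) (\<xi> n)) \<and>
    (\<forall>t\<ge>0. \<forall>\<epsilon>>0. (\<lambda>n. prob {w \<in> space M.
        (\<integral>\<^sup>+s\<in>{0..t}. ennreal ((norm (simple_value (m n) (p n) (\<xi> n) s w - H s w))\<^sup>2) \<partial>lborel) > ennreal \<epsilon>}) \<longlonglongrightarrow> 0) \<and>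
    (\<forall>t\<ge>0. \<forall>\<epsilon>>0. (\<lambda>n. prob {w \<in> space M.
        norm (simple_integral W (m n) (p n) (\<xi> n) t w - I t w) > \<epsilon>}) \<longlonglongrightarrow> 0)"
    using I[unfolded has_ito_integral_def, THEN conjunct2, THEN conjunct2, THEN conjunct2, THEN conjunct2] by blast
  then have S: "simple_process M F (m n) (p n) (\<xi> n)" for n by blast
  have c1: "(\<lambda>n. prob {w \<in> space M.
        (\<integral>\<^sup>+s\<in>{0..t}. ennreal ((norm (simple_value (m n) (p n) (\<xi> n) s w - H s w))\<^sup>2) \<partial>lborel) > ennreal \<epsilon>}) \<longlonglongrightarrow> 0"
    and c2: "(\<lambda>n. prob {w \<in> space M.
        norm (simple_integral W (m n) (p n) (\<xi> n) t w - I t w) > \<epsilon>}) \<longlonglongrightarrow> 0" if "0 \<le> t" "0 < \<epsilon>" for t \<epsilon>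
    using *[THEN conjunct2] that by simp_all
  let ?J = "\<lambda>n. simple_integral W (m n) (p n) (\<xi> n)"
  define A where "A n = {w \<in> space M. l2_error T (m n) (p n) (\<xi> n) H w > ennreal \<gamma>'}" for n
  have A: "A n \<in> sets M" for n
    unfolding A_def using sq_dist_measurable(1)[OF simple_value_measurable[OF S] H, of n] by measurable
  have "\<forall>\<^sub>F n in sequentially. prob (A n) < \<eta> / 4"
    using order_tendstoD(2)[OF c1[of T \<gamma>'], of "\<eta> / 4"] T \<gamma>' \<eta> unfolding A_def by auto
  then obtain n where n: "prob (A n) < \<eta> / 4" "\<forall>\<^sub>F n in sequentially. prob (A n) < \<eta> / 4"
    using eventually_happens by fastforce
  have SI: "?J n t \<in> borel_measurable M" if "0 \<le> t" for n t
    using simple_integral_measurable[OF S that] F_measurable_M by blast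
  have Im: "I t \<in> borel_measurable M" if "0 \<le> t" for t
    using I that F_measurable_M unfolding has_ito_integral_def by blast
  show thesis
  proof (rule that[OF S[of n] A[of n]])
    show "prob (A n) \<le> \<eta>" using n(1) \<eta> by simp
    show "\<forall>w\<in>space M - A n. l2_error T (m n) (p n) (\<xi> n) H w \<le> ennreal \<gamma>"
    proof
      fix w assume "w \<in> space M - A n"
      then have "l2_error T (m n) (p n) (\<xi> n) H w \<le> ennreal \<gamma>'"
        by (auto simp: A_def not_less)
      also have "\<dots> \<le> ennreal \<gamma>" using \<gamma>' by (intro ennreal_leI) auto
      finally show "l2_error T (m n) (p n) (\<xi> n) H w \<le> ennreal \<gamma>" .
    qed
    show "\<forall>Q. finite Q \<and> Q \<subseteq> {0..T} \<longrightarrow>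
      prob {w \<in> space M. \<exists>t\<in>Q. \<epsilon> < norm (?J n t w - I t w)} \<le> \<eta>"
    proof (intro allI impI, elim conjE)
      fix Q :: "real set" assume Q: "finite Q" "Q \<subseteq> {0..T}"
      let ?B = "\<lambda>n' t. {w \<in> space M. \<epsilon> / 2 < norm (?J n' t w - I t w)}"
      have "(\<lambda>n'. \<Sum>t\<in>Q. prob (?B n' t)) \<longlonglongrightarrow> (\<Sum>t\<in>Q. 0)"
        using Q e by (intro tendsto_sum c2) auto
      then have "\<forall>\<^sub>F n' in sequentially. (\<Sum>t\<in>Q. prob (?B n' t)) < \<eta> / 4"
        using \<eta> by (intro order_tendstoD(2)) auto
      \<comment> \<open>The index \<open>n'\<close> depends on \<open>Q\<close>; \<open>n\<close>,
        and with it the simple process and the exceptional set of the lemma, does not.\<close>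
      with n(2) have "\<forall>\<^sub>F n' in sequentially. prob (A n') < \<eta> / 4 \<and> (\<Sum>t\<in>Q. prob (?B n' t)) < \<eta> / 4"
        by eventually_elim simp
      then obtain n' where n': "prob (A n') < \<eta> / 4" "(\<Sum>t\<in>Q. prob (?B n' t)) < \<eta> / 4"
        using eventually_happens by fastforce
      let ?C = "{w \<in> space M. \<exists>t\<in>Q. \<epsilon> / 2 < norm (?J n t w - ?J n' t w)}"
      let ?E = "{w \<in> space M. \<exists>t\<in>Q. \<epsilon> < norm (?J n t w - I t w)}"
      have B: "?B n' t \<in> sets M" if "t \<in> Q" for t
      proof -
        have "0 \<le> t" using that Q by auto
        from SI[OF this] Im[OF this] show ?thesis by measurable
      qed
      have C: "?C \<in> sets M"
      proof -
        have "{w \<in> space M. \<epsilon> / 2 < norm (?J n t w - ?J n' t w)} \<in> sets M" if "t \<in> Q" for t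
        proof -
          have "0 \<le> t" using that Q by auto
          from SI[OF this] show ?thesis by measurable
        qed
        then show ?thesis using Q by (intro sets.sets_Collect_finite_Ex) auto
      qed
      have "prob ?C \<le> K * (4 * \<gamma>') / (\<epsilon> / 2)\<^sup>2 + prob (A n \<union> A n')"
        unfolding K_def using \<gamma>'(1) e A
        by (intro simple_integrals_close[OF T Q _ _ S S H]) (auto simp: A_def not_less)
      also have "\<dots> \<le> \<eta> / 4 + (\<eta> / 4 + \<eta> / 4)"
        using \<gamma>'(3) measure_Un_le[OF A[of n] A[of n']] n(1) n'(1) by simp
      finally have C': "prob ?C \<le> \<eta> / 4 + (\<eta> / 4 + \<eta> / 4)" .
      have "?E \<subseteq> ?C \<union> (\<Union>t\<in>Q. ?B n' t)"
      proof
        fix w assume "w \<in> ?E"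
        then obtain t where t: "w \<in> space M" "t \<in> Q" "\<epsilon> < norm (?J n t w - I t w)" by auto
        moreover have "norm (?J n t w - I t w) \<le>
          norm (?J n t w - ?J n' t w)
          + norm (?J n' t w - I t w)"
          using norm_triangle_ineq[of "?J n t w - ?J n' t w"
             "?J n' t w - I t w"] by simp
        ultimately have "\<epsilon> / 2 < norm (?J n t w - ?J n' t w)
          \<or> \<epsilon> / 2 < norm (?J n' t w - I t w)" by linarith
        then show "w \<in> ?C \<union> (\<Union>t\<in>Q. ?B n' t)" using t by blast
      qed
      then have "prob ?E \<le> prob (?C \<union> (\<Union>t\<in>Q. ?B n' t))"
        using B C Q by (intro finite_measure_mono sets.Un sets.finite_UN) auto
      also have "\<dots> \<le> prob ?C + prob (\<Union>t\<in>Q. ?B n' t)"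
        using B C Q by (intro measure_Un_le sets.finite_UN) auto
      also have "prob (\<Union>t\<in>Q. ?B n' t) \<le> (\<Sum>t\<in>Q. prob (?B n' t))"
        using B Q by (intro finite_measure_subadditive_finite) auto
      finally show "prob ?E \<le> \<eta>" using C' n'(2) by simp
    qed
  qed
qed

end

section \<open>The stopped Euler scheme\<close>

text \<open>Almost every path has some modulus of continuity, so the events of violating it at scale
  \<open>r n\<close> decrease to a null set. They are tested on a countable dense set of times to be
  measurable, and continuity extends the bound to all times.\<close>

lemma (in prob_space) modulus_in_probability:
  fixes Z :: "real \<Rightarrow> 'a \<Rightarrow> 'c::{metric_space, second_countable_topology}" and \<rho> :: "'a \<Rightarrow> real"
  assumes Z: "\<And>t. t \<in> {0..T} \<Longrightarrow> Z t \<in> borel_measurable M" and \<rho>: "\<rho> \<in> borel_measurable M"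
    and uc: "AE w in M. uniformly_continuous_on {t \<in> {0..T}. t < \<rho> w} (\<lambda>t. Z t w)"
    and e: "0 < e" and \<eta>: "0 < \<eta>"
  obtains h A where "0 < h" "A \<in> sets M" "prob A \<le> \<eta>"
    "\<forall>w\<in>space M - A. \<forall>s\<in>{0..T}. \<forall>t\<in>{0..T}. s < \<rho> w \<longrightarrow> t < \<rho> w \<longrightarrow> \<bar>s - t\<bar> \<le> h \<longrightarrow> dist (Z s w) (Z t w) \<le> e"
proof -
  obtain Q where Q: "countable Q" "Q \<subseteq> {0..T}" "{0..T} \<subseteq> closure Q"
    using separable[of "{0..T}"] by metis
  define r where "r n = 1 / real (Suc n)" for n
  define B where "B n = {w \<in> space M. \<exists>s\<in>Q. \<exists>t\<in>Q. s < \<rho> w \<and> t < \<rho> w \<and> \<bar>s - t\<bar> < r n \<and> e < dist (Z s w) (Z t w)}" for n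
  have B: "B n \<in> sets M" for n
    unfolding B_def
  proof (intro sets.sets_Collect_countable_Ex' Q(1))
    fix s t assume "s \<in> Q" "t \<in> Q"
    then have [measurable]: "Z s \<in> borel_measurable M" "Z t \<in> borel_measurable M" using Q(2) Z by auto
    note [measurable] = \<rho>
    show "{w \<in> space M. s < \<rho> w \<and> t < \<rho> w \<and> \<bar>s - t\<bar> < r n \<and> e < dist (Z s w) (Z t w)} \<in> sets M"
      by measurable
  qed
  have dec: "decseq B"
  proof (rule decseq_SucI)
    fix n
    have "r (Suc n) \<le> r n" by (simp add: r_def frac_le)
    then show "B (Suc n) \<subseteq> B n" unfolding B_def by fastforce
  qed
  from uc obtain N where N: "N \<in> null_sets M" "\<And>w. w \<in> space M - N \<Longrightarrow> uniformly_continuous_on {t \<in> {0..T}. t < \<rho> w} (\<lambda>t. Z t w)"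
    by (rule AE_E3) blast
  have "(\<Inter>n. B n) \<subseteq> N"
  proof (rule subsetI, rule ccontr)
    fix w assume w: "w \<in> (\<Inter>n. B n)" "w \<notin> N"
    then have "w \<in> space M - N" by (auto simp: B_def)
    from N(2)[OF this] obtain d where d: "d > 0"
      "\<And>s t. s \<in> {t \<in> {0..T}. t < \<rho> w} \<Longrightarrow> t \<in> {t \<in> {0..T}. t < \<rho> w} \<Longrightarrow> dist s t < d \<Longrightarrow> dist (Z s w) (Z t w) < e"
      using e unfolding uniformly_continuous_on_def by (metis (no_types, lifting) dist_commute)
    obtain n where "r n < d" using reals_Archimedean[OF d(1)] by (auto simp: r_def inverse_eq_divide)
    moreover obtain s t where "s \<in> Q" "t \<in> Q" "s < \<rho> w" "t < \<rho> w" "\<bar>s - t\<bar> < r n" "e < dist (Z s w) (Z t w)"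
      using w(1) unfolding B_def by blast
    ultimately show False using d(2)[of s t] subsetD[OF Q(2), of s] subsetD[OF Q(2), of t] by (auto simp: dist_real_def)
  qed
  then have "(\<Inter>n. B n) \<in> null_sets M"
    using null_sets_subset[OF N(1)] B by auto
  then have "prob (\<Inter>n. B n) = 0" by (rule measure_eq_0_null_sets)
  then have "(\<lambda>n. prob (B n)) \<longlonglongrightarrow> 0"
    using finite_Lim_measure_decseq[OF _ dec] B by auto
  then have "\<forall>\<^sub>F n in sequentially. prob (B n) < \<eta>" using \<eta> by (rule order_tendstoD(2))
  then obtain n where n: "prob (B n) < \<eta>" by (auto simp: eventually_sequentially)
  show thesis
  \<comment> \<open>A third of \<open>r n\<close> leaves room to move both times into
    \<open>Q\<close>, each by less than another third.\<close>
  proof (rule that[of "r n / 3" "B n \<union> N"])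
    show "0 < r n / 3" by (simp add: r_def)
    show "B n \<union> N \<in> sets M" using B N by auto
    show "prob (B n \<union> N) \<le> \<eta>"
      using measure_Un_null_set[OF B[of n] N(1)] n by simp
    show "\<forall>w\<in>space M - (B n \<union> N). \<forall>s\<in>{0..T}. \<forall>t\<in>{0..T}. s < \<rho> w \<longrightarrow> t < \<rho> w \<longrightarrow> \<bar>s - t\<bar> \<le> r n / 3 \<longrightarrow> dist (Z s w) (Z t w) \<le> e"
    proof (intro ballI impI)
      fix w s t assume w: "w \<in> space M - (B n \<union> N)" and st: "s \<in> {0..T}" "t \<in> {0..T}" "s < \<rho> w" "t < \<rho> w" "\<bar>s - t\<bar> \<le> r n / 3"
      let ?D = "{t \<in> {0..T}. t < \<rho> w}"
      have cont: "continuous_on ?D (\<lambda>t. Z t w)"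
        using N(2)[of w] w uniformly_continuous_imp_continuous by blast
      have approx: "\<exists>s'\<in>Q. s' < \<rho> w \<and> \<bar>s' - s\<bar> < r n / 3 \<and> dist (Z s' w) (Z s w) < \<delta>" if s: "s \<in> {0..T}" "s < \<rho> w" and \<delta>: "0 < \<delta>" for s \<delta>
      proof -
        obtain d where d: "d > 0" "\<forall>s'\<in>?D. dist s' s < d \<longrightarrow> dist (Z s' w) (Z s w) < \<delta>"
          using cont s \<delta> unfolding continuous_on_iff by (metis (no_types, lifting) mem_Collect_eq)
        \<comment> \<open>Times below \<open>\<rho> w\<close> form an open set, so the approximating
          points of \<open>Q\<close> can be taken there as well.\<close>
        have "s \<in> {..<\<rho> w} \<inter> closure Q" using s Q(3) by auto
        then have "s \<in> closure ({..<\<rho> w} \<inter> Q)" using open_Int_closure_subset[of "{..<\<rho> w}" Q] by auto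
        moreover have "0 < min d (r n / 3)" using d by (simp add: r_def)
        ultimately obtain s' where s': "s' \<in> {..<\<rho> w} \<inter> Q" "dist s' s < min d (r n / 3)"
          unfolding closure_approachable by blast
        then show ?thesis using d(2) Q(2) by (intro bexI[of _ s']) (auto simp: dist_real_def)
      qed
      show "dist (Z s w) (Z t w) \<le> e"
      proof (rule field_le_epsilon)
        fix \<delta> :: real assume "0 < \<delta>"
        then have \<delta>: "0 < \<delta> / 2" by simp
        obtain s' where s': "s' \<in> Q" "s' < \<rho> w" "\<bar>s' - s\<bar> < r n / 3" "dist (Z s' w) (Z s w) < \<delta> / 2"
          using approx[OF st(1,3) \<delta>] by blast
        obtain t' where t': "t' \<in> Q" "t' < \<rho> w" "\<bar>t' - t\<bar> < r n / 3" "dist (Z t' w) (Z t w) < \<delta> / 2"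
          using approx[OF st(2,4) \<delta>] by blast
        have "\<bar>s' - t'\<bar> < r n" using s'(3) t'(3) st(5) by linarith
        then have "dist (Z s' w) (Z t' w) \<le> e"
          using w s' t' unfolding B_def by force
        moreover have "dist (Z s w) (Z t w) \<le> dist (Z s w) (Z s' w) + dist (Z s' w) (Z t' w) + dist (Z t' w) (Z t w)"
          by (meson add_right_mono dist_triangle order_trans)
        ultimately show "dist (Z s w) (Z t w) \<le> e + \<delta>" using s'(4) t'(4) by (simp add: dist_commute)
      qed
    qed
  qed
qed

lemma C12_continuous_slice:
  assumes "C12 T v" "t \<in> {0..T}"
  shows "continuous_on UNIV (v t)" "continuous_on UNIV (gradient (v t))" "continuous_on UNIV (hessian (v t))"
proof -
  have *: "continuous_on UNIV (f t)" if "continuous_on ({0..T} \<times> UNIV) (\<lambda>(t, x). f t x)" for f :: "real \<Rightarrow> real ^ 'n \<Rightarrow> 'c::topological_space"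
  proof -
    have "continuous_on UNIV (\<lambda>x. (\<lambda>(t, x). f t x) (t, x))"
      using assms(2) by (intro continuous_on_compose2[OF that] continuous_intros) auto
    then show ?thesis by simp
  qed
  show "continuous_on UNIV (v t)" "continuous_on UNIV (gradient (v t))" "continuous_on UNIV (hessian (v t))"
    using assms(1) unfolding C12_def by (auto intro: *)
qed

context wiener
begin

text \<open>Sum of the bounds for one step over the cells where \<open>G\<close> holds. The centred
  terms vanish in mean, the generator helps by its sign, and both the squares of the cell lengths
  and the fourth moments add up to multiples of \<open>h * T\<close>.\<close>

lemma euler_scheme:
  fixes v :: "real \<Rightarrow> real ^ 'n \<Rightarrow> real" and \<sigma> :: "real ^ 'n \<Rightarrow> real ^ 'k ^ 'n"
    and x :: "nat \<Rightarrow> 'w \<Rightarrow> real ^ 'k ^ 'n" and Y U :: "nat \<Rightarrow> 'w \<Rightarrow> real ^ 'n"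
  assumes v: "C12 T v" and e: "0 \<le> e" and C: "\<And>y. y \<in> C \<Longrightarrow> norm y \<le> R"
    and gen: "\<And>t y. t \<in> {0..T} \<Longrightarrow> y \<in> C \<Longrightarrow> generator T b \<sigma> v t y \<le> 0"
    and \<delta>: "\<delta> \<le> 1" and q: "0 \<le> q" and c: "0 \<le> c" and K: "0 \<le> K"
    and step: "euler_bound T v b \<sigma> C R e \<delta> q c K"
    and bc: "continuous_on UNIV b"
    and g: "grid T L t" and mesh: "\<And>j. j < L \<Longrightarrow> t (Suc j) - t j \<le> h" "h \<le> \<delta>"
    and x: "\<And>j. j < L \<Longrightarrow> x j \<in> borel_measurable (F (t j))" "\<And>j w. j < L \<Longrightarrow> w \<in> space M \<Longrightarrow> norm (x j w) \<le> N"
    and U: "\<And>j. j \<le> L \<Longrightarrow> U j \<in> borel_measurable (F (t j))"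
      "\<And>j w. j < L \<Longrightarrow> U (Suc j) w = U j w + ((t (Suc j) - t j) *\<^sub>R b (Y j w) + x j w *v (W (t (Suc j)) w - W (t j) w))"
    and G: "\<And>j. j < L \<Longrightarrow> {w \<in> space M. G j w} \<in> sets (F (t j))"
      "\<And>j w. j < L \<Longrightarrow> w \<in> space M \<Longrightarrow> G j w \<Longrightarrow> Y j w \<in> C \<and> norm (U j w - Y j w) \<le> \<delta>"
    and \<gamma>: "\<And>w. w \<in> space M \<Longrightarrow> (\<Sum>j<L. if G j w then (norm (x j w - \<sigma> (Y j w)))\<^sup>2 * (t (Suc j) - t j) else 0) \<le> \<gamma>"
  defines "S \<equiv> \<lambda>w. \<Sum>j<L. if G j w then truncate (R + 2) (v (t (Suc j))) (U (Suc j) w) - truncate (R + 2) (v (t j)) (U j w) else 0"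
  shows "S \<in> borel_measurable M"
    and "expectation S \<le> T * e + c * \<gamma> + K * (h * T * (1 + 3 * (real CARD('k))\<^sup>2 * N ^ 4))"
proof -
  define z where "z = (\<lambda>j w. W (t (Suc j)) w - W (t j) w)"
  define d where "d = (\<lambda>j. t (Suc j) - t j)"
  \<comment> \<open>Coefficients are set to zero where \<open>G\<close> fails: they stay adapted,
    and bounded because \<open>U\<close> is near \<open>C\<close> otherwise.\<close>
  define cc where "cc = (\<lambda>j w. if G j w then transpose (x j w) *v gradient (v (t j)) (U j w) else 0)"
  define A where "A = (\<lambda>j w. if G j w then transpose (x j w) ** hessian (v (t j)) (U j w) ** x j w else 0)"
  define qq where "qq = (\<lambda>j w. if G j w then q * (norm (x j w))\<^sup>2 else 0)"
  define N1 where "N1 = (\<lambda>w. \<Sum>j<L. cc j w \<bullet> z j w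
      + 1 / 2 * (z j w \<bullet> (A j w *v z j w) - d j * trace (A j w))
      + qq j w * ((norm (z j w))\<^sup>2 - real CARD('k) * d j))"
  define N2 where "N2 = (\<lambda>w. \<Sum>j<L. N ^ 4 * norm (z j w) ^ 4)"
  have T0: "0 \<le> T" using grid_bounds[OF g, of 0] by auto
  have tj: "t j \<in> {0..T}" "0 \<le> t j" if "j \<le> L" for j using grid_bounds[OF g that] by auto
  have d: "0 < d j" "t (Suc j) = t j + d j" "d j \<le> h" if "j < L" for j
    using g mesh(1) that unfolding grid_def d_def by auto
  obtain B where B0: "0 < B" "C12_bound T v (R + 2) B"
    by (rule C12_bounded[OF v])
  note B = B0(1) C12_boundD[OF B0(2)]
  \<comment> \<open>Truncation starts beyond \<open>R + 2\<close>, so it is inactive at the state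
    from which a counted step departs.\<close>
  have UG: "norm (U j w) \<le> R + 1" if "j < L" "w \<in> space M" "G j w" for j w
    using G(2)[OF that] C[of "Y j w"] \<delta> norm_triangle_ineq[of "Y j w" "U j w - Y j w"] by auto
  have gm: "(\<lambda>w. gradient (v (t j)) (U j w)) \<in> borel_measurable (F (t j))"
    and hm: "(\<lambda>w. hessian (v (t j)) (U j w)) \<in> borel_measurable (F (t j))" if "j < L" for j
    using U(1)[of j] C12_continuous_slice(2,3)[OF v tj(1)[of j]] that
    by (auto intro!: measurable_compose[OF U(1)[of j]] borel_measurable_continuous_onI)
  have meas: "cc j \<in> borel_measurable (F (t j))" "A j \<in> borel_measurable (F (t j))" "qq j \<in> borel_measurable (F (t j))"
    if j: "j < L" for j
  proof -
    have G': "{w \<in> space (F (t j)). G j w} \<in> sets (F (t j))" using G(1)[OF j] by simp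
    note xj = x(1)[OF j]
    show "cc j \<in> borel_measurable (F (t j))" unfolding cc_def
      by (intro measurable_If G' borel_measurable_matrix_vector_mult borel_measurable_transpose xj gm[OF j] borel_measurable_const)
    show "A j \<in> borel_measurable (F (t j))" unfolding A_def
      by (intro measurable_If G' borel_measurable_matrix_mult borel_measurable_transpose xj hm[OF j] borel_measurable_const)
    show "qq j \<in> borel_measurable (F (t j))" unfolding qq_def
      by (intro measurable_If G' borel_measurable_times borel_measurable_power measurable_compose[OF xj borel_measurable_norm] borel_measurable_const)
  qed
  have bnd: "norm (cc j w) \<le> \<bar>N\<bar> * B" "norm (A j w) \<le> \<bar>N\<bar> * B * \<bar>N\<bar>" "\<bar>qq j w\<bar> \<le> q * \<bar>N\<bar>\<^sup>2" if j: "j < L" and w: "w \<in> space M" for j w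
  proof -
    have xN: "norm (x j w) \<le> \<bar>N\<bar>" using x(2)[OF j w] by simp
    have "norm (cc j w) \<le> \<bar>N\<bar> * B \<and> norm (A j w) \<le> \<bar>N\<bar> * B * \<bar>N\<bar> \<and> \<bar>qq j w\<bar> \<le> q * \<bar>N\<bar>\<^sup>2"
    proof (cases "G j w")
      case True
      then have "norm (U j w) \<le> R + 2" using UG[OF j w] by simp
      then have gB: "norm (gradient (v (t j)) (U j w)) \<le> B" "norm (hessian (v (t j)) (U j w)) \<le> B"
        using B(2)[OF tj(1)] j by auto
      have "norm (transpose (x j w) *v gradient (v (t j)) (U j w)) \<le> \<bar>N\<bar> * B"
        by (rule order_trans[OF norm_matrix_vector_mult_le mult_mono]) (use xN gB in \<open>auto simp: norm_transpose\<close>)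
      moreover have "norm (transpose (x j w) ** hessian (v (t j)) (U j w)) \<le> \<bar>N\<bar> * B"
        by (rule order_trans[OF norm_matrix_mult_le mult_mono]) (use xN gB in \<open>auto simp: norm_transpose\<close>)
      then have "norm (transpose (x j w) ** hessian (v (t j)) (U j w) ** x j w) \<le> \<bar>N\<bar> * B * \<bar>N\<bar>"
        by (rule order_trans[OF norm_matrix_mult_le mult_mono[OF _ xN]]) (use B in auto)
      moreover have "q * (norm (x j w))\<^sup>2 \<le> q * \<bar>N\<bar>\<^sup>2"
        using xN q by (intro mult_left_mono power_mono) auto
      moreover have "0 \<le> q * (norm (x j w))\<^sup>2" using q by simp
      ultimately show ?thesis unfolding cc_def A_def qq_def if_P[OF True] by (simp only: abs_of_nonneg)
    next
      case False
      then have "cc j w = 0" "A j w = 0" "qq j w = 0" by (simp_all only: cc_def A_def qq_def if_False)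
      then show ?thesis using B q by simp
    qed
    then show "norm (cc j w) \<le> \<bar>N\<bar> * B" "norm (A j w) \<le> \<bar>N\<bar> * B * \<bar>N\<bar>" "\<bar>qq j w\<bar> \<le> q * \<bar>N\<bar>\<^sup>2" by auto
  qed
  have N1: "has_bochner_integral M N1 0"
    unfolding N1_def z_def d_def by (rule martingale_sum[OF g meas(1) bnd(1) meas(2) bnd(2) meas(3) bnd(3)]) simp_all
  have N4: "integrable M (\<lambda>w. N ^ 4 * norm (z j w) ^ 4)"
    "expectation (\<lambda>w. N ^ 4 * norm (z j w) ^ 4) \<le> 3 * (real CARD('k))\<^sup>2 * (d j)\<^sup>2 * N ^ 4" if j: "j < L" for j
  proof -
    have s: "0 \<le> t j" "t j < t (Suc j)" using tj[of j] d[OF j] j by auto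
    have 0: "0 \<le> N ^ 4" by simp
    show "integrable M (\<lambda>w. N ^ 4 * norm (z j w) ^ 4)"
      unfolding z_def by (rule norm_increment(2)[OF s, of "\<lambda>_. N ^ 4" "N ^ 4"]) auto
    show "expectation (\<lambda>w. N ^ 4 * norm (z j w) ^ 4) \<le> 3 * (real CARD('k))\<^sup>2 * (d j)\<^sup>2 * N ^ 4"
      using norm_increment(3)[OF s, of "\<lambda>_. N ^ 4" "N ^ 4"] unfolding z_def d_def by (simp add: prob_space)
  qed
  have sumd: "(\<Sum>j<L. d j) = T"
    using g sum_lessThan_telescope[of t L] unfolding d_def grid_def by simp
  have sumd2: "(\<Sum>j<L. (d j)\<^sup>2) \<le> h * T"
  proof -
    have "(\<Sum>j<L. (d j)\<^sup>2) \<le> (\<Sum>j<L. h * d j)"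
      using d by (intro sum_mono) (simp add: power2_eq_square mult_right_mono less_imp_le)
    then show ?thesis by (simp add: sumd flip: sum_distrib_left)
  qed
  have iN2: "integrable M N2" unfolding N2_def using N4 by (intro Bochner_Integration.integrable_sum) auto
  have EN2: "expectation N2 \<le> 3 * (real CARD('k))\<^sup>2 * N ^ 4 * (h * T)"
  proof -
    have "expectation N2 = (\<Sum>j<L. expectation (\<lambda>w. N ^ 4 * norm (z j w) ^ 4))"
      unfolding N2_def using N4 by (intro Bochner_Integration.integral_sum) auto
    also have "\<dots> \<le> (\<Sum>j<L. 3 * (real CARD('k))\<^sup>2 * N ^ 4 * (d j)\<^sup>2)"
      using N4 by (intro sum_mono) (auto simp: mult_ac)
    also have "\<dots> = 3 * (real CARD('k))\<^sup>2 * N ^ 4 * (\<Sum>j<L. (d j)\<^sup>2)" by (simp add: sum_distrib_left)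
    also have "\<dots> \<le> 3 * (real CARD('k))\<^sup>2 * N ^ 4 * (h * T)" using sumd2 by (intro mult_left_mono) auto
    finally show ?thesis .
  qed
  have tm: "(\<lambda>w. truncate (R + 2) (v (t j)) (U j w)) \<in> borel_measurable M" if "j \<le> L" for j
  proof -
    have Um: "U j \<in> borel_measurable M" using U(1)[OF that] by (rule F_measurable_M)
    have "(\<lambda>y. v (t j) y) \<in> borel_measurable borel"
      using C12_continuous_slice(1)[OF v tj(1)[OF that]] by (rule borel_measurable_continuous_onI)
    then have "(truncate (R + 2) (v (t j)) :: real ^ 'n \<Rightarrow> real) \<in> borel_measurable borel"
      unfolding truncate_def by measurable
    from measurable_compose[OF Um this] show ?thesis .
  qed
  have Gm: "{w \<in> space M. G j w} \<in> sets M" if "j < L" for j using G(1)[OF that] sets_F_subset by blast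
  show Sm: "S \<in> borel_measurable M"
    unfolding S_def
    by (intro borel_measurable_sum measurable_If borel_measurable_diff borel_measurable_const tm Gm) auto
  have tB: "\<bar>truncate (R + 2) (v (t j)) y\<bar> \<le> B" if "j \<le> L" for j and y :: "real ^ 'n"
    using B(1) B(2)[OF tj(1)[OF that], of y] by (auto simp: truncate_def)
  have iS: "integrable M S"
  proof (rule integrable_const_bound[of _ "\<Sum>j<L. 2 * B"])
    show "AE w in M. norm (S w) \<le> (\<Sum>j<L. 2 * B)"
    proof (rule AE_I2)
      fix w
      show "norm (S w) \<le> (\<Sum>j<L. 2 * B)"
        unfolding S_def
      proof (rule sum_norm_le)
        fix j assume "j \<in> {..<L}"
        then show "norm (if G j w then truncate (R + 2) (v (t (Suc j))) (U (Suc j) w) - truncate (R + 2) (v (t j)) (U j w) else 0) \<le> 2 * B"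
          using tB[of j "U j w"] tB[of "Suc j" "U (Suc j) w"] B(1) by auto
      qed
    qed
  qed (rule Sm)
  have le: "S w \<le> N1 w + (T * e + c * \<gamma> + K * (h * T)) + K * N2 w" if w: "w \<in> space M" for w
  proof -
    have "(if G j w then truncate (R + 2) (v (t (Suc j))) (U (Suc j) w) - truncate (R + 2) (v (t j)) (U j w) else 0)
      \<le> (cc j w \<bullet> z j w + 1 / 2 * (z j w \<bullet> (A j w *v z j w) - d j * trace (A j w))
          + qq j w * ((norm (z j w))\<^sup>2 - real CARD('k) * d j))
        + (d j * e + c * (if G j w then (norm (x j w - \<sigma> (Y j w)))\<^sup>2 * d j else 0)) + K * (d j)\<^sup>2
        + K * (N ^ 4 * norm (z j w) ^ 4)" if j: "j < L" for j
    proof (cases "G j w")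
      case True
      have t1: "truncate (R + 2) (v (t j)) (U j w) = v (t j) (U j w)"
        using UG[OF j w True] by (simp add: truncate_def)
      have Us: "U (Suc j) w = U j w + (d j *\<^sub>R b (Y j w) + x j w *v z j w)"
        using U(2)[OF j] by (simp add: d_def z_def)
      have "d j * generator T b \<sigma> v (t j) (Y j w) \<le> 0"
        using gen[OF tj(1)[of j], of "Y j w"] G(2)[OF j w True] d[OF j] j by (simp add: mult_nonneg_nonpos less_imp_le)
      moreover have "norm (x j w) ^ 4 * norm (z j w) ^ 4 \<le> N ^ 4 * norm (z j w) ^ 4"
        using x(2)[OF j w] by (intro mult_right_mono power_mono) auto
      then have "K * ((d j)\<^sup>2 + norm (x j w) ^ 4 * norm (z j w) ^ 4) \<le> K * ((d j)\<^sup>2 + N ^ 4 * norm (z j w) ^ 4)"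
        using K by (intro mult_left_mono) auto
      moreover have "t j + d j \<le> T" "d j \<le> \<delta>" using tj(1)[of "Suc j"] d[OF j] j mesh(2) by auto
      ultimately show ?thesis
        using step[unfolded euler_bound_def, rule_format, of "t j" "d j" "Y j w" "U j w" "x j w" "z j w"]
          tj(2)[of j] d[OF j] G(2)[OF j w True] j
        unfolding if_P[OF True] cc_def A_def qq_def t1 Us d(2)[OF j] by (simp add: algebra_simps)
    next
      case False
      then have 0: "cc j w = 0" "A j w = 0" "qq j w = 0" by (simp_all only: cc_def A_def qq_def if_False)
      show ?thesis unfolding 0 if_not_P[OF False] using K e d[OF j] by (simp add: trace_def less_imp_le)
    qed
    then have "S w \<le> (\<Sum>j<L. (cc j w \<bullet> z j w + 1 / 2 * (z j w \<bullet> (A j w *v z j w) - d j * trace (A j w))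
          + qq j w * ((norm (z j w))\<^sup>2 - real CARD('k) * d j))
        + (d j * e + c * (if G j w then (norm (x j w - \<sigma> (Y j w)))\<^sup>2 * d j else 0)) + K * (d j)\<^sup>2
        + K * (N ^ 4 * norm (z j w) ^ 4))"
      unfolding S_def by (intro sum_mono) auto
    also have "\<dots> = N1 w + ((\<Sum>j<L. d j) * e + c * (\<Sum>j<L. if G j w then (norm (x j w - \<sigma> (Y j w)))\<^sup>2 * d j else 0))
        + K * (\<Sum>j<L. (d j)\<^sup>2) + K * N2 w"
      unfolding N1_def N2_def by (simp only: sum.distrib sum_distrib_left sum_distrib_right)
    also have "\<dots> \<le> N1 w + (T * e + c * \<gamma>) + K * (h * T) + K * N2 w"
    proof -
      have "(\<Sum>j<L. if G j w then (norm (x j w - \<sigma> (Y j w)))\<^sup>2 * d j else 0) \<le> \<gamma>"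
        using \<gamma>[OF w] unfolding d_def .
      then show ?thesis using c K sumd2 unfolding sumd
        by (intro add_mono mult_left_mono order_refl)
    qed
    finally show ?thesis by simp
  qed
  have "expectation S \<le> expectation (\<lambda>w. N1 w + (T * e + c * \<gamma> + K * (h * T)) + K * N2 w)"
    using iS N1 iN2 le by (intro integral_mono Bochner_Integration.integrable_add integrable_mult_right) (auto simp: has_bochner_integral_iff)
  also have "\<dots> = (T * e + c * \<gamma> + K * (h * T)) + K * expectation N2"
    using N1 iN2 by (simp add: has_bochner_integral_iff prob_space)
  also have "\<dots> \<le> (T * e + c * \<gamma> + K * (h * T)) + K * (3 * (real CARD('k))\<^sup>2 * N ^ 4 * (h * T))"
    using EN2 K by (intro add_left_mono mult_left_mono) auto
  finally show "expectation S \<le> T * e + c * \<gamma> + K * (h * T * (1 + 3 * (real CARD('k))\<^sup>2 * N ^ 4))"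
    by (simp add: algebra_simps)
qed

end

section \<open>Tools for comparing the scheme with the path\<close>

lemma uniformly_continuous_on_mono:
  fixes f :: "'a::metric_space \<Rightarrow> 'b::metric_space"
  assumes f: "uniformly_continuous_on S f" and sub: "S' \<subseteq> S"
  shows "uniformly_continuous_on S' f"
  unfolding uniformly_continuous_on_def
proof (intro allI impI)
  fix e :: real assume "e > 0"
  then obtain d where "d > 0" "\<forall>x\<in>S. \<forall>x'\<in>S. dist x' x < d \<longrightarrow> dist (f x') (f x) < e"
    using f unfolding uniformly_continuous_on_def by blast
  then show "\<exists>d>0. \<forall>x\<in>S'. \<forall>x'\<in>S'. dist x' x < d \<longrightarrow> dist (f x') (f x) < e"
    using sub by (intro exI[of _ d]) blast
qed

lemma grid_locate:
  assumes g: "grid T L t" and i: "i \<le> L" and r: "0 \<le> r" "r \<le> t i"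
  shows "\<exists>l\<le>i. t l \<le> r \<and> (l = i \<or> r < t (Suc l))"
  using i r(2)
proof (induction i)
  case 0
  then show ?case using g r by (auto simp: grid_def)
next
  case (Suc i)
  show ?case
  proof (cases "r < t i")
    case True
    then obtain l where "l \<le> i" "t l \<le> r" "l = i \<or> r < t (Suc l)" using Suc by auto
    then show ?thesis using True by (intro exI[of _ l]) auto
  next
    case False
    show ?thesis
    proof (cases "r < t (Suc i)")
      case True
      then show ?thesis using False by (intro exI[of _ i]) auto
    next
      case False
      then show ?thesis using Suc.prems by (intro exI[of _ "Suc i"]) auto
    qed
  qed
qed

text \<open>The condition at index \<open>j\<close> already counts summand \<open>j\<close>; hence
  the last good index bounds the whole stopped sum.\<close>

lemma stopped_sum_le:
  fixes a :: "nat \<Rightarrow> real"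
  assumes a: "\<And>j. j < L \<Longrightarrow> 0 \<le> a j" and \<gamma>: "0 \<le> \<gamma>"
    and le: "\<And>j. j < L \<Longrightarrow> g j \<Longrightarrow> (\<Sum>l\<le>j. a l) \<le> \<gamma>"
  shows "(\<Sum>j<L. if \<forall>i\<le>j. g i then a j else 0) \<le> \<gamma>"
proof -
  obtain k where k: "k \<le> L" "\<forall>j<k. g j" "k = L \<or> \<not> g k"
    by (rule stopped_sum[of L g "\<lambda>_. 0"]) auto
  have "(\<Sum>j<L. if \<forall>i\<le>j. g i then a j else 0) = (\<Sum>j<k. if \<forall>i\<le>j. g i then a j else 0)"
    using k(1,3) by (intro sum.mono_neutral_right) auto
  also have "\<dots> \<le> (\<Sum>j<k. a j)" using a k(1) by (intro sum_mono) auto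
  also have "\<dots> \<le> \<gamma>"
  proof (cases k)
    case (Suc k')
    then have "g k'" "k' < L" using k by auto
    then show ?thesis using le[of k'] Suc by (simp add: lessThan_Suc_atMost)
  qed (use \<gamma> in simp)
  finally show ?thesis .
qed

lemma riemann_sum_error:
  fixes f :: "real \<Rightarrow> 'a::euclidean_space"
  assumes g: "grid T L t" and k: "k \<le> L" and f: "continuous_on {0..t k} f"
    and \<omega>: "\<And>i s. i < k \<Longrightarrow> s \<in> {t i..t (Suc i)} \<Longrightarrow> norm (f s - f (t i)) \<le> \<omega>"
  shows "norm (integral {0..t k} f - (\<Sum>i<k. (t (Suc i) - t i) *\<^sub>R f (t i))) \<le> \<omega> * t k"
  using k f \<omega>
proof (induction k)
  case 0
  then show ?case using g by (simp add: grid_def)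
next
  case (Suc k)
  have b: "0 \<le> t k" "t k \<le> t (Suc k)"
    using grid_bounds[OF g, of k] grid_mono[OF g, of k "Suc k"] Suc.prems(1) by auto
  have f: "continuous_on {0..t k} f" "continuous_on {t k..t (Suc k)} f"
    using Suc.prems(2) b by (auto intro: continuous_on_subset)
  have IH: "norm (integral {0..t k} f - (\<Sum>i<k. (t (Suc i) - t i) *\<^sub>R f (t i))) \<le> \<omega> * t k"
    using Suc.prems f by (intro Suc.IH) auto
  have int: "integral {t k..t (Suc k)} (\<lambda>s. f s - f (t k)) = integral {t k..t (Suc k)} f - (t (Suc k) - t k) *\<^sub>R f (t k)"
    using f b by (subst Henstock_Kurzweil_Integration.integral_diff) (auto intro: integrable_continuous_real)
  have "norm (integral {t k..t (Suc k)} (\<lambda>s. f s - f (t k))) \<le> \<omega> * (t (Suc k) - t k)"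
    using f b Suc.prems(3)[of k] by (intro integral_bound continuous_intros) auto
  moreover have "integral {0..t (Suc k)} f = integral {0..t k} f + integral {t k..t (Suc k)} f"
    using b Suc.prems(2)
    by (intro Henstock_Kurzweil_Integration.integral_combine[symmetric] integrable_continuous_real) auto
  ultimately show ?case
    using IH norm_triangle_mono[OF IH, of "integral {t k..t (Suc k)} (\<lambda>s. f s - f (t k))" "\<omega> * (t (Suc k) - t k)"]
    unfolding int by (simp add: algebra_simps)
qed

section \<open>The stopped scheme against the path\<close>

context wiener
begin

text \<open>Here \<open>V\<close> is the value of \<open>v\<close> along the Euler scheme whose noise coefficients come from a simple
  process approximating the Ito integrand. The scheme is stopped at the first grid time at which \<open>\<tau>\<close> has
  passed, the path is within \<open>e / 2\<close> of the complement of \<open>C\<close>, the scheme has left the path, or the squared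
  errors of the noise coefficients exceed a budget. Outside \<open>A\<close> the last two can only happen in the
  grid cell that contains \<open>\<tau>\<close>.\<close>

lemma stopped_supersolution:
  fixes v :: "real \<Rightarrow> real ^ 'n \<Rightarrow> real" and b :: "real ^ 'n \<Rightarrow> real ^ 'n" and \<sigma> :: "real ^ 'n \<Rightarrow> real ^ 'k ^ 'n"
    and X :: "real \<Rightarrow> 'w \<Rightarrow> real ^ 'n" and \<zeta> :: "'w \<Rightarrow> ereal" and \<tau> :: "'w \<Rightarrow> real"
  assumes bc: "continuous_on UNIV b" and sc: "continuous_on UNIV \<sigma>"
    and T: "0 < T" and v: "C12 T v"
    and vB: "\<And>t y. t \<in> {0..T} \<Longrightarrow> norm y \<le> R + 2 \<Longrightarrow> \<bar>v t y\<bar> \<le> B" and B: "0 \<le> B"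
    and C: "\<And>y. y \<in> C \<Longrightarrow> norm y \<le> R" and C': "- C \<noteq> {}" and x0: "x0 \<in> C"
    and gen: "\<And>t y. t \<in> {0..T} \<Longrightarrow> y \<in> C \<Longrightarrow> generator T b \<sigma> v t y \<le> 0"
    and Xm: "\<And>t. 0 \<le> t \<Longrightarrow> (\<lambda>w. if ereal t < \<zeta> w then X t w else 0) \<in> borel_measurable (F t)"
    and Xc: "\<And>w. w \<in> space M \<Longrightarrow> continuous_on {t. 0 \<le> t \<and> ereal t < \<zeta> w} (\<lambda>t. X t w)"
    and X0: "AE w in M. X 0 w = x0"
    and \<tau>: "stopping_time F \<tau>" "AE w in M. 0 \<le> \<tau> w \<and> ereal (\<tau> w) < \<zeta> w"
    and I: "has_ito_integral M W (\<lambda>s w. if s \<le> \<tau> w \<and> ereal s < \<zeta> w then \<sigma> (X s w) else 0) I"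
    and eq: "AE w in M. \<forall>t\<ge>0. X (min t (\<tau> w)) w = x0 + integral {0..min t (\<tau> w)} (\<lambda>s. b (X s w)) + I t w"
    and e: "0 < e"
  obtains V A where "V \<in> borel_measurable M" "\<forall>w\<in>space M. \<bar>V w\<bar> \<le> B" "expectation V \<le> v 0 x0 + e"
    "A \<in> sets M" "prob A \<le> e"
    "\<forall>w\<in>space M - A. \<exists>t\<in>{0..T}. (t = 0 \<or> t < \<tau> w) \<and> (\<forall>r\<in>{0..t}. X r w \<in> C) \<and> \<bar>V w - v t (X t w)\<bar> \<le> e \<and>
        (T - e \<le> t \<or> \<tau> w - e \<le> t \<or> infdist (X t w) (- C) \<le> e)"
proof -
  define H where "H = (\<lambda>s w. if s \<le> \<tau> w \<and> ereal s < \<zeta> w then \<sigma> (X s w) else 0)"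
  \<comment> \<open>Beyond the lifetime \<open>X\<close> is meaningless; this version is the one
    known to be adapted.\<close>
  define Xh where "Xh = (\<lambda>t w. if ereal t < \<zeta> w then X t w else 0)"
  define k where "k = real CARD('k)"
  obtain B' where B': "0 \<le> B'" "\<And>y. norm y \<le> R \<Longrightarrow> norm (b y) \<le> B'" "\<And>y. norm y \<le> R \<Longrightarrow> norm (\<sigma> y) \<le> B'"
  proof -
    have "bounded (b ` cball 0 R)" "bounded (\<sigma> ` cball 0 R)"
      using bc sc by (auto intro!: compact_imp_bounded compact_continuous_image intro: continuous_on_subset)
    then obtain B1 B2 where "\<forall>y\<in>cball 0 R. norm (b y) \<le> B1" "\<forall>y\<in>cball 0 R. norm (\<sigma> y) \<le> B2"
      unfolding bounded_iff by blast
    then show thesis by (intro that[of "max 0 (max B1 B2)"]) (auto simp: le_max_iff_disj)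
  qed
  \<comment> \<open>The excess \<open>e\<close> in the mean is split in three:
    \<open>T * (e / (3 * T))\<close> for the Taylor errors, \<open>c * \<gamma>\<close> for the
    noise coefficients, and \<open>K * (h * P)\<close> for the mesh.\<close>
  have e': "0 < e / (3 * T)" using e T by simp
  obtain \<delta>0 q c K where \<delta>0: "0 < \<delta>0" "\<delta>0 \<le> 1" and q: "0 \<le> q" and c: "0 \<le> c" and K: "0 \<le> K"
    and step: "euler_bound T v b \<sigma> C R (e / (3 * T)) \<delta>0 q c K"
  proof (rule euler_step[OF v e' B'(1), where C = C and b = b and \<sigma> = \<sigma> and R = R])
    fix y assume "y \<in> C"
    then show "norm y \<le> R" "norm (b y) \<le> B'" "norm (\<sigma> y) \<le> B'" using C B'(2,3) by auto
  qed (rule that)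
  obtain \<delta>v where \<delta>v': "0 < \<delta>v" "C12_close T v (R + 2) e \<delta>v"
    by (rule C12_uniform[OF v e])
  note \<delta>v = \<delta>v'(1) C12_closeD[OF \<delta>v'(2)]
  \<comment> \<open>One more step after the last good time may double the distance to the path, so
    \<open>2 * \<delta>\<close> must respect the ball and the modulus of \<open>v\<close>.\<close>
  define \<delta> where "\<delta> = min \<delta>0 (min (1 / 2) (\<delta>v / 2))"
  have \<delta>: "0 < \<delta>" "\<delta> \<le> \<delta>0" "2 * \<delta> \<le> 1" "2 * \<delta> \<le> \<delta>v" using \<delta>0 \<delta>v by (auto simp: \<delta>_def)
  define \<gamma> where "\<gamma> = e / (3 * (c + 1))"
  have \<gamma>: "0 < \<gamma>" "c * \<gamma> \<le> e / 3" using e c by (auto simp: \<gamma>_def field_simps)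
  \<comment> \<open>The entry \<open>e / 2\<close> serves the distance to the complement of
    \<open>C\<close>, the one with \<open>\<delta>\<close> the Riemann sum of the drift, the one
    with \<open>\<gamma>\<close> the oscillation of \<open>\<sigma>\<close> in a cell; 1 ensures
    that the square of \<open>\<omega>\<close> is at most \<open>\<omega>\<close>.\<close>
  define \<omega> where "\<omega> = min (min (e / 2) 1) (min (\<delta> / (2 * T)) (\<gamma> / (4 * T)))"
  have \<omega>: "0 < \<omega>" "\<omega> \<le> e / 2" "\<omega> * T \<le> \<delta> / 2" "2 * \<omega>\<^sup>2 * T \<le> \<gamma> / 2"
  proof -
    show w0: "0 < \<omega>" "\<omega> \<le> e / 2" using e \<delta> \<gamma> T by (auto simp: \<omega>_def)
    have "\<omega> \<le> \<delta> / (2 * T)" "\<omega> \<le> 1" "\<omega> \<le> \<gamma> / (4 * T)" by (auto simp: \<omega>_def)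
    then have *: "\<omega> * T \<le> \<delta> / 2" "\<omega> * T \<le> \<gamma> / 4" "\<omega> \<le> 1" using T by (auto simp: field_simps)
    show "\<omega> * T \<le> \<delta> / 2" by (rule *)
    have "\<omega>\<^sup>2 * T \<le> \<omega> * T" using * w0 T by (simp add: power2_eq_square mult_left_le)
    then show "2 * \<omega>\<^sup>2 * T \<le> \<gamma> / 2" using * by simp
  qed
  obtain m p \<xi> A1 where S: "simple_process M F m p \<xi>" and A1: "A1 \<in> sets M" "prob A1 \<le> e / 8"
    "\<forall>w\<in>space M - A1. l2_error T m p \<xi> H w \<le> ennreal (\<gamma> / 4)"
    and ucp: "\<forall>Q. finite Q \<and> Q \<subseteq> {0..T} \<longrightarrow>
      prob {w \<in> space M. \<exists>t\<in>Q. \<delta> / 2 < norm (simple_integral W m p \<xi> t w - I t w)} \<le> e / 8"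
  proof (rule ito_integral_approx[OF I[folded H_def] T])
    show "0 < \<delta> / 2" "0 < \<gamma> / 4" "0 < e / 8" using \<delta> \<gamma> e by auto
  qed (rule that)
  obtain N where N: "0 \<le> N" "\<And>a c w. w \<in> space M \<Longrightarrow> norm (step_coeff m p \<xi> a c w) \<le> N"
    using step_coeff_bounded[OF S] by metis
  have XhF: "Xh t \<in> borel_measurable (F t)" if "0 \<le> t" for t using Xm[OF that] by (simp add: Xh_def)
  have \<tau>m: "\<tau> \<in> borel_measurable M"
  proof (rule borel_measurableI_le)
    fix y
    have "{x \<in> space (F y). \<tau> x \<le> y} \<in> sets (F y)" using stopping_timeD[OF \<tau>(1), of y] by (simp add: pred_def)
    then show "{x \<in> space M. \<tau> x \<le> y} \<in> sets M" using sets_F_subset by auto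
  qed
  \<comment> \<open>The path, its drift and its noise coefficient are bundled so that one modulus
    covers all three.\<close>
  define Z where "Z = (\<lambda>t w. (Xh t w, b (Xh t w), \<sigma> (Xh t w)))"
  have Zm: "Z t \<in> borel_measurable M" if "t \<in> {0..T}" for t
  proof -
    have m: "Xh t \<in> borel_measurable M" using XhF[of t] that F_measurable_M by auto
    show ?thesis unfolding Z_def
      by (intro borel_measurable_Pair m measurable_compose[OF m borel_measurable_continuous_onI] bc sc)
  qed
  have Zuc: "AE w in M. uniformly_continuous_on {t \<in> {0..T}. t < \<tau> w} (\<lambda>t. Z t w)"
    using \<tau>(2) AE_space
  proof eventually_elim
    case (elim w)
    \<comment> \<open>As \<open>\<tau> w\<close> is strictly below the lifetime, the path is
      continuous on a compact interval including \<open>\<tau> w\<close>; this is what makes it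
      uniformly continuous before \<open>\<tau> w\<close>.\<close>
    have sub: "{0..min T (\<tau> w)} \<subseteq> {t. 0 \<le> t \<and> ereal t < \<zeta> w}"
      using elim by (auto intro: order_le_less_trans[of _ "ereal (\<tau> w)"])
    have "continuous_on {0..min T (\<tau> w)} (\<lambda>t. X t w)" by (rule continuous_on_subset[OF Xc sub]) (use elim in simp)
    then have "continuous_on {0..min T (\<tau> w)} (\<lambda>t. (X t w, b (X t w), \<sigma> (X t w)))"
      by (intro continuous_on_Pair continuous_on_compose2[OF bc] continuous_on_compose2[OF sc]) auto
    then have "uniformly_continuous_on {0..min T (\<tau> w)} (\<lambda>t. (X t w, b (X t w), \<sigma> (X t w)))"
      by (rule compact_uniformly_continuous) simp
    then have "uniformly_continuous_on {t \<in> {0..T}. t < \<tau> w} (\<lambda>t. (X t w, b (X t w), \<sigma> (X t w)))"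
      by (rule uniformly_continuous_on_mono) auto
    moreover have "Z t w = (X t w, b (X t w), \<sigma> (X t w))" if "t \<in> {t \<in> {0..T}. t < \<tau> w}" for t
      using that subsetD[OF sub, of t] by (auto simp: Z_def Xh_def)
    ultimately show ?case unfolding uniformly_continuous_on_def by (metis (no_types, lifting))
  qed
  obtain h1 A2 where h1: "0 < h1" and A2: "A2 \<in> sets M" "prob A2 \<le> e / 8"
    "\<forall>w\<in>space M - A2. \<forall>s\<in>{0..T}. \<forall>t\<in>{0..T}. s < \<tau> w \<longrightarrow> t < \<tau> w \<longrightarrow> \<bar>s - t\<bar> \<le> h1 \<longrightarrow> dist (Z s w) (Z t w) \<le> \<omega>"
  proof (rule modulus_in_probability[OF Zm \<tau>m Zuc \<omega>(1)])
    show "0 < e / 8" using e by simp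
  qed (assumption, rule that)
  \<comment> \<open>With \<open>T + 1\<close> as cut-off the restriction on times in
    \<open>modulus_in_probability\<close> is void.\<close>
  have Wuc: "AE w in M. uniformly_continuous_on {t \<in> {0..T}. t < T + 1} (\<lambda>t. W t w)"
    using AE_space
  proof eventually_elim
    case (elim w)
    have "continuous_on {0..} (\<lambda>t. W t w)" using wiener elim unfolding wiener_process_def by blast
    then have "continuous_on {0..T} (\<lambda>t. W t w)" by (rule continuous_on_subset) auto
    then have "uniformly_continuous_on {0..T} (\<lambda>t. W t w)" by (rule compact_uniformly_continuous) simp
    then show ?case by (rule uniformly_continuous_on_mono) auto
  qed
  \<comment> \<open>Chosen so that one noise step, with coefficient at most \<open>N\<close>, moves
    by at most \<open>\<delta> / 2\<close>.\<close>
  have e2: "0 < \<delta> / (2 * (N + 1))" using \<delta> N by simp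
  obtain h2 A3 where h2: "0 < h2" and A3: "A3 \<in> sets M" "prob A3 \<le> e / 8"
    "\<forall>w\<in>space M - A3. \<forall>s\<in>{0..T}. \<forall>t\<in>{0..T}. s < T + 1 \<longrightarrow> t < T + 1 \<longrightarrow> \<bar>s - t\<bar> \<le> h2 \<longrightarrow> dist (W s w) (W t w) \<le> \<delta> / (2 * (N + 1))"
  proof (rule modulus_in_probability[of T W "\<lambda>_. T + 1", OF _ _ Wuc e2])
    show "0 < e / 8" using e by simp
  qed (auto intro: that)
  define P where "P = T * (1 + 3 * k\<^sup>2 * N ^ 4)"
  have P: "0 < P" using T N by (auto simp: P_def intro!: mult_pos_pos add_pos_nonneg)
  have pos: "0 < \<delta> / (2 * (B' + 1))" "0 < e / (3 * (K + 1) * P)" using \<delta>(1) B'(1) e K P by simp_all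
  \<comment> \<open>The mesh comes last, since \<open>N\<close> and the budget constants enter
    through \<open>P\<close> and \<open>K\<close>. The entry \<open>e / 2\<close> lets two cells fit
    into a time span of \<open>e\<close>.\<close>
  define h where "h = min (min (min h1 h2) (min \<delta> (\<delta> / (2 * (B' + 1))))) (min (e / (3 * (K + 1) * P)) (e / 2))"
  have h0: "0 < h" unfolding h_def min_less_iff_conj using h1 h2 \<delta>(1) pos e by simp
  have h_le: "h \<le> h1" "h \<le> h2" "h \<le> \<delta>" "h \<le> \<delta> / (2 * (B' + 1))" "h \<le> e / (3 * (K + 1) * P)" "h \<le> e / 2"
    unfolding h_def by (simp_all only: min_le_iff_disj order_refl simp_thms)
  note h = h0 h_le
  have hB': "h * B' \<le> \<delta> / 2"
  proof -
    have "h * B' \<le> h * (B' + 1)" using h by (intro mult_left_mono) auto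
    also have "\<dots> \<le> \<delta> / (2 * (B' + 1)) * (B' + 1)" using h B' by (intro mult_right_mono) auto
    also have "\<dots> = \<delta> / 2" using B'(1) by (simp add: divide_simps)
    finally show ?thesis .
  qed
  have hK: "K * (h * P) \<le> e / 3"
  proof -
    have "K * (h * P) \<le> (K + 1) * (e / (3 * (K + 1) * P) * P)"
      using h K P by (intro mult_mono mult_right_mono) auto
    also have "\<dots> = e / 3" using K P by (simp add: divide_simps)
    finally show ?thesis .
  qed
  obtain L t where g: "grid T L t" and mesh: "\<And>j. j < L \<Longrightarrow> t (Suc j) - t j \<le> h"
    and pt: "p ` {..m} \<inter> {0..T} \<subseteq> t ` {..L}"
    using grid_exists[OF T h(1), of "p ` {..m}"] by auto
  have t0: "t 0 = 0" "t L = T" using g by (auto simp: grid_def)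
  have L: "0 < L" using t0 T by (cases L) auto
  have tj: "0 \<le> t j" "t j \<le> T" "t j \<in> {0..T}" if "j \<le> L" for j using grid_bounds[OF g that] by auto
  have tS: "t j < t (Suc j)" if "j < L" for j using g that by (auto simp: grid_def)
  have nob: "p i \<notin> {t j<..<t (Suc j)}" if "i \<le> m" "j < L" for i j
  proof
    assume u: "p i \<in> {t j<..<t (Suc j)}"
    then have "p i \<in> {0..T}" using tj[of j] tj[of "Suc j"] that by auto
    then have "p i \<in> t ` {..L}" using pt that by blast
    from grid_no_between[OF g this _ that(2)] u show False by auto
  qed
  define x where "x = (\<lambda>j. step_coeff m p \<xi> (t j) (t (Suc j)))"
  define Y where "Y = (\<lambda>j. Xh (t j))"
  \<comment> \<open>The drift is read off the path at the grid point, so the scheme is a Riemann sum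
    plus a simple integral and no Gronwall argument is called for.\<close>
  define U where "U = rec_nat (\<lambda>w. x0) (\<lambda>j u w. u w + ((t (Suc j) - t j) *\<^sub>R b (Y j w) + x j w *v (W (t (Suc j)) w - W (t j) w)))"
  have U0: "U 0 w = x0" for w by (simp add: U_def)
  have US: "U (Suc j) w = U j w + ((t (Suc j) - t j) *\<^sub>R b (Y j w) + x j w *v (W (t (Suc j)) w - W (t j) w))" for j w
    by (simp add: U_def)
  define cond where "cond = (\<lambda>w j. t j < \<tau> w \<and> e / 2 < infdist (Y j w) (- C) \<and> norm (U j w - Y j w) \<le> \<delta> \<and>
     (\<Sum>l\<le>j. (norm (x l w - \<sigma> (Y l w)))\<^sup>2 * (t (Suc l) - t l)) \<le> \<gamma>)"
  have xF: "x j \<in> borel_measurable (F (t j))" for j unfolding x_def by (rule step_coeff_measurable[OF S])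
  have YF: "Y j \<in> borel_measurable (F (t j))" if "j \<le> L" for j unfolding Y_def by (rule XhF[OF tj(1)[OF that]])
  have mono: "f \<in> borel_measurable (F (t i)) \<Longrightarrow> i \<le> j \<Longrightarrow> j \<le> L \<Longrightarrow> f \<in> borel_measurable (F (t j))"
    for f :: "'w \<Rightarrow> 'c::topological_space" and i j
    by (rule F_measurable_mono[OF _ grid_mono[OF g]])
  have UF: "U j \<in> borel_measurable (F (t j))" if "j \<le> L" for j
    using that
  proof (induction j)
    case 0
    then show ?case by (simp add: U_def)
  next
    case (Suc j)
    then have j: "j \<le> Suc j" "Suc j \<le> L" "j \<le> L" by auto
    have m: "U j \<in> borel_measurable (F (t (Suc j)))" "Y j \<in> borel_measurable (F (t (Suc j)))" "x j \<in> borel_measurable (F (t (Suc j)))"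
      using mono[OF Suc.IH j(1,2)] mono[OF YF j(1,2)] mono[OF xF j(1,2)] j by auto
    have "W (t j) \<in> borel_measurable (F (t (Suc j)))" "W (t (Suc j)) \<in> borel_measurable (F (t (Suc j)))"
      using tj[of j] tj[of "Suc j"] j tS[of j] by (auto intro!: W_F_measurable)
    then have "(\<lambda>w. U j w + ((t (Suc j) - t j) *\<^sub>R b (Y j w) + x j w *v (W (t (Suc j)) w - W (t j) w))) \<in> borel_measurable (F (t (Suc j)))"
      by (intro borel_measurable_add borel_measurable_scaleR borel_measurable_const m borel_measurable_matrix_vector_mult
        borel_measurable_diff measurable_compose[OF m(2) borel_measurable_continuous_onI[OF bc]])
    then show ?case unfolding US[abs_def] .
  qed
  have condF: "{w \<in> space M. \<forall>i\<le>j. cond w i} \<in> sets (F (t j))" if j: "j < L" for j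
  proof -
    have "{w \<in> space (F (t j)). cond w i} \<in> sets (F (t j))" if i: "i \<le> j" for i
    proof -
      note ij = i less_imp_le[OF j]
      have m: "U i \<in> borel_measurable (F (t j))" "Y l \<in> borel_measurable (F (t j))" "x l \<in> borel_measurable (F (t j))" if "l \<le> j" for l
        using mono[OF UF ij] mono[OF YF that ij(2)] mono[OF xF that ij(2)] i j that by auto
      have 1: "{w \<in> space (F (t j)). t i < \<tau> w} \<in> sets (F (t j))"
        using stopping_timeD2[OF \<tau>(1), of "t i"] sets_F_mono[OF grid_mono[OF g ij]] by (auto simp: pred_def)
      have 2: "(\<lambda>w. infdist (Y i w) (- C)) \<in> borel_measurable (F (t j))"
        by (rule measurable_compose[OF m(2)[OF i] borel_measurable_continuous_onI]) (intro continuous_intros)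
      have 3: "(\<lambda>w. norm (U i w - Y i w)) \<in> borel_measurable (F (t j))"
        by (rule measurable_compose[OF borel_measurable_diff[OF m(1)[OF i] m(2)[OF i]] borel_measurable_norm])
      have 4: "(\<lambda>w. \<Sum>l\<le>i. (norm (x l w - \<sigma> (Y l w)))\<^sup>2 * (t (Suc l) - t l)) \<in> borel_measurable (F (t j))"
      proof (intro borel_measurable_sum borel_measurable_times borel_measurable_power borel_measurable_const)
        fix l assume "l \<in> {..i}"
        then have l: "l \<le> j" using i by simp
        show "(\<lambda>w. norm (x l w - \<sigma> (Y l w))) \<in> borel_measurable (F (t j))"
          by (rule measurable_compose[OF borel_measurable_diff[OF m(3)[OF l]
            measurable_compose[OF m(2)[OF l] borel_measurable_continuous_onI[OF sc]]] borel_measurable_norm])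
      qed
      show ?thesis unfolding cond_def
        by (intro sets.sets_Collect_conj 1 borel_measurable_less borel_measurable_le 2 3 4 borel_measurable_const)
    qed
    then have "{w \<in> space (F (t j)). \<forall>i\<in>{..j}. cond w i} \<in> sets (F (t j))"
      by (intro sets.sets_Collect_finite_All) auto
    then show ?thesis by (simp only: Ball_def atMost_iff space_F)
  qed
  have inC: "y \<in> C" if "0 < infdist y (- C)" for y
  proof (rule ccontr)
    assume "y \<notin> C"
    then have "infdist y (- C) = 0" by (intro infdist_zero) simp
    with that show False by simp
  qed
  define f where "f = (\<lambda>w j. truncate (R + 2) (v (t j)) (U j w))"
  define \<Sigma> where "\<Sigma> = (\<lambda>w. \<Sum>j<L. if \<forall>i\<le>j. cond w i then f w (Suc j) - f w j else 0)"
  have good: "Y j w \<in> C \<and> norm (U j w - Y j w) \<le> \<delta>" if "\<forall>i\<le>j. cond w i" for j w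
  proof -
    have "cond w j" using that by blast
    then show ?thesis using e unfolding cond_def by (intro conjI inC) auto
  qed
  have budget: "(\<Sum>j<L. if \<forall>i\<le>j. cond w i then (norm (x j w - \<sigma> (Y j w)))\<^sup>2 * (t (Suc j) - t j) else 0) \<le> \<gamma>" for w
    using tS \<gamma>(1) by (intro stopped_sum_le) (auto simp: cond_def less_imp_le)
  have step': "euler_bound T v b \<sigma> C R (e / (3 * T)) \<delta> q c K"
    using step \<delta>(2) by (rule euler_bound_mono)
  have e3: "0 \<le> e / (3 * T)" and \<delta>1: "\<delta> \<le> 1" using e T \<delta> by auto
  have xN: "norm (x j w) \<le> N" if "w \<in> space M" for j w unfolding x_def by (rule N(2)[OF that])
  note scheme = euler_scheme[OF v e3 _ _ \<delta>1 q c K step' bc g _ h(4),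
      where x = x and Y = Y and U = U and G = "\<lambda>j w. \<forall>i\<le>j. cond w i" and N = N and \<gamma> = \<gamma>]
  have \<Sigma>m: "\<Sigma> \<in> borel_measurable M"
    unfolding \<Sigma>_def f_def
    by (rule scheme(1)) (assumption | rule xF xN UF US budget good condF mesh gen C)+
  have \<Sigma>E: "expectation \<Sigma> \<le> T * (e / (3 * T)) + c * \<gamma> + K * (h * T * (1 + 3 * (real CARD('k))\<^sup>2 * N ^ 4))"
    unfolding \<Sigma>_def f_def
    by (rule scheme(2)) (assumption | rule xF xN UF US budget good condF mesh gen C)+
  define V where "V = (\<lambda>w. v 0 x0 + \<Sigma> w)"
  have path: "\<exists>\<kappa>\<le>L. (\<forall>j<\<kappa>. cond w j) \<and> (\<kappa> = L \<or> \<not> cond w \<kappa>) \<and> V w = f w \<kappa>" for w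
  proof -
    obtain \<kappa> where \<kappa>: "\<kappa> \<le> L" "\<forall>j<\<kappa>. cond w j" "\<kappa> = L \<or> \<not> cond w \<kappa>"
      "(\<Sum>j<L. if \<forall>i\<le>j. cond w i then f w (Suc j) - f w j else 0) = f w \<kappa> - f w 0"
      by (rule stopped_sum[of L "cond w" "f w"])
    moreover have "f w 0 = v 0 x0" using C[OF x0] by (simp add: f_def U0 t0 truncate_def)
    ultimately show ?thesis unfolding V_def \<Sigma>_def by (intro exI[of _ \<kappa>]) simp
  qed
  have fB: "\<bar>f w j\<bar> \<le> B" if "j \<le> L" for w j
    using vB[OF tj(3)[OF that], of "U j w"] B by (simp add: f_def truncate_def)
  have VB: "\<bar>V w\<bar> \<le> B" for w using path[of w] fB by auto
  have Vm: "V \<in> borel_measurable M" unfolding V_def using \<Sigma>m by simp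
  have iV: "integrable M V" by (rule integrable_const_bound[of _ B]) (use VB Vm in auto)
  have EV: "expectation V \<le> v 0 x0 + e"
  proof -
    have "expectation \<Sigma> = expectation (\<lambda>w. V w - v 0 x0)" by (simp add: V_def)
    also have "\<dots> = expectation V - v 0 x0" using iV by (simp add: prob_space)
    finally have "expectation V = v 0 x0 + expectation \<Sigma>" by simp
    also have "expectation \<Sigma> \<le> e / 3 + c * \<gamma> + K * (h * P)"
      using \<Sigma>E T by (simp add: P_def k_def mult_ac)
    finally show ?thesis using \<gamma>(2) hK by simp
  qed
  have "AE w in M. X 0 w = x0 \<and> 0 \<le> \<tau> w \<and> ereal (\<tau> w) < \<zeta> w \<and>
      (\<forall>t\<ge>0. X (min t (\<tau> w)) w = x0 + integral {0..min t (\<tau> w)} (\<lambda>s. b (X s w)) + I t w)"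
    using X0 \<tau>(2) eq by eventually_elim auto
  then obtain N0 where N0: "N0 \<in> null_sets M" "\<And>w. w \<in> space M - N0 \<Longrightarrow> X 0 w = x0 \<and> 0 \<le> \<tau> w \<and> ereal (\<tau> w) < \<zeta> w \<and>
      (\<forall>t\<ge>0. X (min t (\<tau> w)) w = x0 + integral {0..min t (\<tau> w)} (\<lambda>s. b (X s w)) + I t w)"
    by (rule AE_E3) blast
  define A4 where "A4 = {w \<in> space M. \<exists>u\<in>t ` {..L}. \<delta> / 2 < norm (simple_integral W m p \<xi> u w - I u w)}"
  have A4: "A4 \<in> sets M" "prob A4 \<le> e / 8"
  proof -
    have "{w \<in> space M. \<delta> / 2 < norm (simple_integral W m p \<xi> u w - I u w)} \<in> sets M" if "u \<in> t ` {..L}" for u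
    proof -
      have "0 \<le> u" using that tj by auto
      then have m: "simple_integral W m p \<xi> u \<in> borel_measurable M" "I u \<in> borel_measurable M"
        using simple_integral_measurable[OF S] I F_measurable_M unfolding has_ito_integral_def by blast+
      have "(\<lambda>w. norm (simple_integral W m p \<xi> u w - I u w)) \<in> borel_measurable M"
        by (rule measurable_compose[OF borel_measurable_diff[OF m] borel_measurable_norm])
      then show ?thesis by (intro borel_measurable_less borel_measurable_const)
    qed
    then show "A4 \<in> sets M" unfolding A4_def by (intro sets.sets_Collect_finite_Ex) auto
    show "prob A4 \<le> e / 8" unfolding A4_def using tj by (intro ucp[rule_format]) auto
  qed
  \<comment> \<open>Four exceptional sets of probability at most \<open>e / 8\<close> each, and a
    null set.\<close>
  define A where "A = (((A1 \<union> A2) \<union> A3) \<union> A4) \<union> N0"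
  have A: "A \<in> sets M" "prob A \<le> e"
  proof -
    show "A \<in> sets M" unfolding A_def using A1(1) A2(1) A3(1) A4(1) N0(1) by auto
    have "prob A = prob (((A1 \<union> A2) \<union> A3) \<union> A4)"
      unfolding A_def using A1(1) A2(1) A3(1) A4(1) N0(1) by (intro measure_Un_null_set) auto
    also have "\<dots> \<le> prob ((A1 \<union> A2) \<union> A3) + prob A4" using A1(1) A2(1) A3(1) A4(1) by (intro measure_Un_le) auto
    also have "prob ((A1 \<union> A2) \<union> A3) \<le> prob (A1 \<union> A2) + prob A3" using A1(1) A2(1) A3(1) by (intro measure_Un_le) auto
    also have "prob (A1 \<union> A2) \<le> prob A1 + prob A2" using A1(1) A2(1) by (intro measure_Un_le)
    finally show "prob A \<le> e" using A1(2) A2(2) A3(2) A4(2) e by simp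
  qed
  have UJ: "U j w = x0 + (\<Sum>i<j. (t (Suc i) - t i) *\<^sub>R b (Y i w)) + simple_integral W m p \<xi> (t j) w" if "j \<le> L" for j w
    using that
  proof (induction j)
    case 0
    then show ?case using simple_integral_0[of p m W \<xi> w] S U0 t0 unfolding simple_process_def by simp
  next
    case (Suc j)
    then have "simple_integral W m p \<xi> (t (Suc j)) w = simple_integral W m p \<xi> (t j) w + x j w *v (W (t (Suc j)) w - W (t j) w)"
      using S unfolding x_def simple_process_def by (intro step_coeff_integral nob tS) auto
    then show ?case using Suc by (simp add: US)
  qed
  show thesis
  proof (rule that[OF Vm _ EV A])
    show "\<forall>w\<in>space M. \<bar>V w\<bar> \<le> B" using VB by blast
    show "\<forall>w\<in>space M - A. \<exists>t\<in>{0..T}. (t = 0 \<or> t < \<tau> w) \<and> (\<forall>r\<in>{0..t}. X r w \<in> C) \<and> \<bar>V w - v t (X t w)\<bar> \<le> e \<and>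
        (T - e \<le> t \<or> \<tau> w - e \<le> t \<or> infdist (X t w) (- C) \<le> e)"
    proof
      fix w assume "w \<in> space M - A"
      then have w: "w \<in> space M" "w \<notin> A1" "w \<notin> A2" "w \<notin> A3" "w \<notin> A4" "w \<notin> N0" by (auto simp: A_def)
      have X0w: "X 0 w = x0" and \<tau>w: "0 \<le> \<tau> w" "ereal (\<tau> w) < \<zeta> w"
        and eqw: "\<And>s. 0 \<le> s \<Longrightarrow> s \<le> \<tau> w \<Longrightarrow> X s w = x0 + integral {0..s} (\<lambda>s. b (X s w)) + I s w"
        using N0(2)[of w] w by (auto simp: min_def split: if_splits)
      have alive: "ereal s < \<zeta> w" if "s \<le> \<tau> w" for s
        using that \<tau>w(2) order_le_less_trans[of "ereal s" "ereal (\<tau> w)"] by simp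
      have Xh: "Xh s w = X s w" if "s \<le> \<tau> w" for s using alive[OF that] by (simp add: Xh_def)
      have Zd: "dist (Z s w) (Z r w) \<le> \<omega>" if "0 \<le> s" "s \<le> T" "s < \<tau> w" "0 \<le> r" "r \<le> T" "r < \<tau> w" "\<bar>s - r\<bar> \<le> h" for s r
        using A2(3) w that h(2) by auto
      have near: "norm (X s w - X r w) \<le> \<omega>" "norm (b (X s w) - b (X r w)) \<le> \<omega>" "norm (\<sigma> (X s w) - \<sigma> (X r w)) \<le> \<omega>"
        if "0 \<le> s" "s \<le> T" "s < \<tau> w" "0 \<le> r" "r \<le> T" "r < \<tau> w" "\<bar>s - r\<bar> \<le> h" for s r
      proof -
        have Z: "Z s w = (X s w, b (X s w), \<sigma> (X s w))" "Z r w = (X r w, b (X r w), \<sigma> (X r w))"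
          using Xh[of s] Xh[of r] that by (simp_all add: Z_def)
        note d = Zd[OF that]
        show "norm (X s w - X r w) \<le> \<omega>"
          using order_trans[OF dist_fst_le d] by (simp add: Z dist_norm)
        have d2: "dist (snd (Z s w)) (snd (Z r w)) \<le> \<omega>" by (rule order_trans[OF dist_snd_le d])
        show "norm (b (X s w) - b (X r w)) \<le> \<omega>"
          using order_trans[OF dist_fst_le d2] by (simp add: Z dist_norm)
        show "norm (\<sigma> (X s w) - \<sigma> (X r w)) \<le> \<omega>"
          using order_trans[OF dist_snd_le d2] by (simp add: Z dist_norm)
      qed
      have inf_near: "infdist (X s w) (- C) \<le> infdist (X r w) (- C) + \<omega>"
        if "0 \<le> s" "s \<le> T" "s < \<tau> w" "0 \<le> r" "r \<le> T" "r < \<tau> w" "\<bar>s - r\<bar> \<le> h" for s r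
        using infdist_triangle[of "X s w" "- C" "X r w"] near(1)[OF that] by (simp add: dist_norm)
      obtain \<kappa> where \<kappa>: "\<kappa> \<le> L" "\<forall>j<\<kappa>. cond w j" "\<kappa> = L \<or> \<not> cond w \<kappa>" "V w = f w \<kappa>" using path by blast
      \<comment> \<open>A stop at \<open>\<kappa>\<close> whose following cell ends by
        \<open>\<tau> w\<close> must be caused by the distance to the complement of
        \<open>C\<close>: the equation controls the scheme up to \<open>t \<kappa>\<close>, and the
        integrand equals \<open>\<sigma>\<close> along the path in all cells counted by the
        budget.\<close>
      have bad: "infdist (X (t \<kappa>) w) (- C) \<le> e / 2" if \<kappa>L: "\<kappa> < L" and \<kappa>\<tau>: "t (Suc \<kappa>) \<le> \<tau> w"
      proof -
        have lt: "t j < \<tau> w" "t j \<le> T" "0 \<le> t j" if "j \<le> \<kappa>" for j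
          using grid_mono[OF g that \<kappa>(1)] tS[OF \<kappa>L] \<kappa>\<tau> tj[of j] that \<kappa>(1) by auto
        have YX: "Y j w = X (t j) w" if "j \<le> \<kappa>" for j unfolding Y_def using lt[OF that] by (intro Xh) simp
        have cell: "s < \<tau> w" "0 \<le> s" "s \<le> T" "\<bar>s - t j\<bar> \<le> h" if "j \<le> \<kappa>" "s \<in> {t j..t (Suc j)}" "s < t (Suc j) \<or> j < \<kappa>" for s j
        proof -
          have "t (Suc j) \<le> t (Suc \<kappa>)" using grid_mono[OF g, of "Suc j" "Suc \<kappa>"] that(1) \<kappa>L by simp
          moreover have "t (Suc j) < \<tau> w" if "j < \<kappa>" using lt[of "Suc j"] that by simp
          ultimately show "s < \<tau> w" using that \<kappa>\<tau> by auto
          show "0 \<le> s" "s \<le> T" "\<bar>s - t j\<bar> \<le> h" using that tj[of j] tj[of "Suc j"] mesh[of j] \<kappa>L by auto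
        qed
        have c3: "norm (U \<kappa> w - Y \<kappa> w) \<le> \<delta>"
        proof -
          have cX: "continuous_on {0..t \<kappa>} (\<lambda>s. X s w)"
            using alive lt[of \<kappa>] by (intro continuous_on_subset[OF Xc[OF w(1)]]) auto
          have "norm (integral {0..t \<kappa>} (\<lambda>s. b (X s w)) - (\<Sum>i<\<kappa>. (t (Suc i) - t i) *\<^sub>R b (X (t i) w))) \<le> \<omega> * t \<kappa>"
          proof (rule riemann_sum_error[OF g \<kappa>(1)])
            show "continuous_on {0..t \<kappa>} (\<lambda>s. b (X s w))" by (rule continuous_on_compose2[OF bc cX]) simp
            fix i s assume "i < \<kappa>" "s \<in> {t i..t (Suc i)}"
            then show "norm (b (X s w) - b (X (t i) w)) \<le> \<omega>"
              using cell[of i s] lt[of i] by (intro near) auto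
          qed
          also have "\<omega> * t \<kappa> \<le> \<omega> * T" using \<omega>(1) lt(2)[of \<kappa>] by (intro mult_left_mono) auto
          also have "\<dots> \<le> \<delta> / 2" by (rule \<omega>(3))
          finally have 1: "norm (integral {0..t \<kappa>} (\<lambda>s. b (X s w)) - (\<Sum>i<\<kappa>. (t (Suc i) - t i) *\<^sub>R b (X (t i) w))) \<le> \<delta> / 2" .
          have 2: "norm (simple_integral W m p \<xi> (t \<kappa>) w - I (t \<kappa>) w) \<le> \<delta> / 2"
            using w(1,5) \<kappa>(1) unfolding A4_def by force
          \<comment> \<open>The difference of the closed form of the scheme and the integral
            equation for the path: one stochastic and one drift error, each at most
            \<open>\<delta> / 2\<close>.\<close>
          have diff: "U \<kappa> w - Y \<kappa> w = (simple_integral W m p \<xi> (t \<kappa>) w - I (t \<kappa>) w)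
            - (integral {0..t \<kappa>} (\<lambda>s. b (X s w)) - (\<Sum>i<\<kappa>. (t (Suc i) - t i) *\<^sub>R b (X (t i) w)))"
            using UJ[OF \<kappa>(1), of w] YX eqw[of "t \<kappa>"] lt[of \<kappa>] by simp
          show ?thesis unfolding diff
            by (rule order_trans[OF norm_triangle_ineq4 order_trans[OF add_mono[OF 2 1]]]) simp
        qed
        have c4: "(\<Sum>l\<le>\<kappa>. (norm (x l w - \<sigma> (Y l w)))\<^sup>2 * (t (Suc l) - t l)) \<le> \<gamma>"
        proof -
          \<comment> \<open>A lower bound for the squared error against \<open>H\<close> throughout
            a cell, from \<open>norm_diff_sq_le\<close> and the modulus of \<open>\<sigma>\<close>.
            It is 0 beyond \<open>\<kappa>\<close>, where cells may pass \<open>\<tau> w\<close>.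
            Solving for the budget gives at most
            \<open>2 * (\<gamma> / 4) + 2 * \<omega>\<^sup>2 * T\<close>, hence at most
            \<open>\<gamma>\<close>.\<close>
          define a where "a = (\<lambda>j. if j \<le> \<kappa> then max 0 ((norm (x j w - \<sigma> (Y j w)))\<^sup>2 / 2 - \<omega>\<^sup>2) else 0)"
          have "ennreal (\<Sum>j<L. a j * (t (Suc j) - t j)) \<le> l2_error T m p \<xi> H w"
          proof (rule grid_sum_le_nn_integral[OF g])
            fix j s assume j: "j < L" and s: "s \<in> {t j<..<t (Suc j)}"
            show "ennreal (a j) \<le> ennreal ((norm (simple_value m p \<xi> s w - H s w))\<^sup>2)"
            proof (rule ennreal_leI, cases "j \<le> \<kappa>")
              case True
              have sv: "simple_value m p \<xi> s w = x j w"
                unfolding x_def using s by (intro step_coeff_value nob j) auto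
              have s\<tau>: "s < \<tau> w" "0 \<le> s" "s \<le> T" "\<bar>s - t j\<bar> \<le> h" using cell[OF True, of s] s by auto
              then have H: "H s w = \<sigma> (X s w)" using alive[of s] by (simp add: H_def)
              have "norm (\<sigma> (Y j w) - \<sigma> (X s w)) \<le> \<omega>"
                unfolding YX[OF True] using lt[OF True] s\<tau> by (intro near(3)) auto
              then have "(norm (\<sigma> (Y j w) - \<sigma> (X s w)))\<^sup>2 \<le> \<omega>\<^sup>2" by (intro power_mono) auto
              then have "(norm (x j w - \<sigma> (Y j w)))\<^sup>2 \<le> 2 * (norm (x j w - \<sigma> (X s w)))\<^sup>2 + 2 * \<omega>\<^sup>2"
                using norm_diff_sq_le[of "x j w" "\<sigma> (Y j w)" "\<sigma> (X s w)"] by simp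
              then show "a j \<le> (norm (simple_value m p \<xi> s w - H s w))\<^sup>2"
                unfolding sv H a_def if_P[OF True] by (intro max.boundedI) auto
            next
              case False
              then show "a j \<le> (norm (simple_value m p \<xi> s w - H s w))\<^sup>2" by (simp add: a_def)
            qed
          qed (simp add: a_def)
          also have "\<dots> \<le> ennreal (\<gamma> / 4)" using A1(3) w by blast
          finally have a_le: "(\<Sum>j<L. a j * (t (Suc j) - t j)) \<le> \<gamma> / 4" using \<gamma>(1) by simp
          have "(\<Sum>l\<le>\<kappa>. (norm (x l w - \<sigma> (Y l w)))\<^sup>2 * (t (Suc l) - t l)) \<le> (\<Sum>l\<le>\<kappa>. (2 * a l + 2 * \<omega>\<^sup>2) * (t (Suc l) - t l))"
          proof (rule sum_mono)
            fix l assume "l \<in> {..\<kappa>}"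
            then have "(norm (x l w - \<sigma> (Y l w)))\<^sup>2 \<le> 2 * a l + 2 * \<omega>\<^sup>2" "0 \<le> t (Suc l) - t l"
              using tS[of l] \<kappa>L by (auto simp: a_def max_def)
            then show "(norm (x l w - \<sigma> (Y l w)))\<^sup>2 * (t (Suc l) - t l) \<le> (2 * a l + 2 * \<omega>\<^sup>2) * (t (Suc l) - t l)"
              by (rule mult_right_mono)
          qed
          also have "\<dots> \<le> (\<Sum>l<L. (2 * a l + 2 * \<omega>\<^sup>2) * (t (Suc l) - t l))"
          proof (rule sum_mono2)
            show "{..\<kappa>} \<subseteq> {..<L}" using \<kappa>L by auto
            fix l assume "l \<in> {..<L} - {..\<kappa>}"
            then show "0 \<le> (2 * a l + 2 * \<omega>\<^sup>2) * (t (Suc l) - t l)"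
              using tS[of l] by (intro mult_nonneg_nonneg) (auto simp: a_def)
          qed simp
          also have "\<dots> = 2 * (\<Sum>l<L. a l * (t (Suc l) - t l)) + 2 * \<omega>\<^sup>2 * (\<Sum>l<L. t (Suc l) - t l)"
            unfolding sum_distrib_left sum.distrib[symmetric] by (intro sum.cong refl) (simp add: algebra_simps)
          also have "(\<Sum>l<L. t (Suc l) - t l) = T" using sum_lessThan_telescope[of t L] t0 by simp
          finally show ?thesis using a_le \<omega>(4) by simp
        qed
        have "\<not> cond w \<kappa>" using \<kappa>(3) \<kappa>L by simp
        then have "\<not> e / 2 < infdist (Y \<kappa> w) (- C)" using c3 c4 lt[of \<kappa>] unfolding cond_def by blast
        then show ?thesis using YX[of \<kappa>] by simp
      qed
      show "\<exists>t\<in>{0..T}. (t = 0 \<or> t < \<tau> w) \<and> (\<forall>r\<in>{0..t}. X r w \<in> C) \<and> \<bar>V w - v t (X t w)\<bar> \<le> e \<and>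
        (T - e \<le> t \<or> \<tau> w - e \<le> t \<or> infdist (X t w) (- C) \<le> e)"
      proof (cases \<kappa>)
        \<comment> \<open>The scheme never moves, and time 0 is the witness; this is why
          \<open>t = 0\<close> is allowed beside \<open>t < \<tau> w\<close>.\<close>
        case 0
        have "V w = v 0 (X 0 w)" using \<kappa>(4) 0 C[OF x0] X0w by (simp add: f_def U0 t0 truncate_def)
        moreover have "\<tau> w - e \<le> 0 \<or> infdist (X 0 w) (- C) \<le> e"
        proof (cases "t (Suc 0) \<le> \<tau> w")
          case True
          then show ?thesis using bad 0 L t0 e by auto
        next
          case False
          then show ?thesis using mesh[OF L] t0 h(7) e by auto
        qed
        ultimately show ?thesis using X0w x0 T e by (intro bexI[of _ 0]) auto
      next
        case (Suc i)
        \<comment> \<open>The witness is \<open>t i\<close>, the last time at which all conditions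
          hold. At \<open>t \<kappa>\<close>, one step later, the path may already have left
          \<open>C\<close>.\<close>
        then have i: "i < L" "cond w i" "\<forall>j\<le>i. cond w j" using \<kappa>(1,2) by auto
        have t\<tau>: "t j < \<tau> w" "e / 2 < infdist (X (t j) w) (- C)" if "j \<le> i" for j
          using i(3) that Xh[of "t j"] by (auto simp: cond_def Y_def)
        have Yi: "Y i w = X (t i) w" using Xh t\<tau>[of i] by (simp add: Y_def)
        \<comment> \<open>At grid points the distance to the complement exceeds
          \<open>e / 2\<close>, and within a cell it changes by at most \<open>\<omega>\<close>,
          which is no more than \<open>e / 2\<close>.\<close>
        have XC: "X r w \<in> C" if r: "r \<in> {0..t i}" for r
        proof -
          obtain l where l: "l \<le> i" "t l \<le> r" "l = i \<or> r < t (Suc l)"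
            using grid_locate[OF g _ _ _, of i r] i r by auto
          have "\<bar>t l - r\<bar> \<le> h" using l r mesh[of l] i(1) h(1) by auto
          then have "infdist (X (t l) w) (- C) \<le> infdist (X r w) (- C) + \<omega>"
            using t\<tau>[OF l(1)] t\<tau>(1)[of i] tj[of l] tj[of i] l(1) i(1) r by (intro inf_near) auto
          then have "0 < infdist (X r w) (- C)" using t\<tau>(2)[OF l(1)] \<omega>(2) by simp
          then show ?thesis by (rule inC)
        qed
        \<comment> \<open>The distance \<open>\<delta>\<close> at \<open>t i\<close>, plus a drift
          step and a noise step of at most \<open>\<delta> / 2\<close> each.\<close>
        have dU: "norm (U \<kappa> w - X (t i) w) \<le> 2 * \<delta>"
        proof -
          have 1: "norm (U i w - X (t i) w) \<le> \<delta>" using i(2) Yi by (simp add: cond_def)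
          have "norm ((t (Suc i) - t i) *\<^sub>R b (Y i w)) \<le> h * B'"
            using mesh[OF i(1)] tS[OF i(1)] B'(2)[OF C[OF XC[of "t i"]]] Yi tj[of i] i(1) h(1)
            by (auto intro!: mult_mono)
          then have 2: "norm ((t (Suc i) - t i) *\<^sub>R b (Y i w)) \<le> \<delta> / 2" using hB' by simp
          have "norm (x i w *v (W (t (Suc i)) w - W (t i) w)) \<le> norm (x i w) * norm (W (t (Suc i)) w - W (t i) w)"
            by (rule norm_matrix_vector_mult_le)
          also have "\<dots> \<le> N * (\<delta> / (2 * (N + 1)))"
          proof (intro mult_mono N(1))
            show "norm (x i w) \<le> N" unfolding x_def by (rule N(2)[OF w(1)])
            have "\<bar>t (Suc i) - t i\<bar> \<le> h2" using mesh[OF i(1)] tS[OF i(1)] h(3) by simp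
            then show "norm (W (t (Suc i)) w - W (t i) w) \<le> \<delta> / (2 * (N + 1))"
              using A3(3) w tj[of i] tj[of "Suc i"] i(1) by (simp add: dist_norm)
          qed simp
          also have "\<dots> \<le> (N + 1) * (\<delta> / (2 * (N + 1)))" using e2 by (intro mult_right_mono) auto
          also have "\<dots> = \<delta> / 2" using N(1) by (simp add: divide_simps)
          finally have 3: "norm (x i w *v (W (t (Suc i)) w - W (t i) w)) \<le> \<delta> / 2" .
          have "U \<kappa> w - X (t i) w = (U i w - X (t i) w) + ((t (Suc i) - t i) *\<^sub>R b (Y i w) + x i w *v (W (t (Suc i)) w - W (t i) w))"
            using Suc US by simp
          also have "norm \<dots> \<le> \<delta> + (\<delta> / 2 + \<delta> / 2)"
            by (intro norm_triangle_mono 1 2 3)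
          finally show ?thesis by simp
        qed
        have nX: "norm (X (t i) w) \<le> R" using C XC[of "t i"] tj[of i] i(1) by auto
        have nU: "norm (U \<kappa> w) \<le> R + 2"
          using norm_triangle_ineq[of "X (t i) w" "U \<kappa> w - X (t i) w"] nX dU \<delta>(3) by simp
        have "\<bar>v (t \<kappa>) (U \<kappa> w) - v (t i) (X (t i) w)\<bar> \<le> e"
        proof -
          have "\<bar>t \<kappa> - t i\<bar> \<le> \<delta>v" using Suc mesh[OF i(1)] tS[OF i(1)] h(4) \<delta>(1,4) by simp
          then show ?thesis
            using \<delta>v(2)[of "t \<kappa>" "t i" "U \<kappa> w" "X (t i) w"] tj(3)[OF \<kappa>(1)] tj(3)[of i] i(1) nU nX dU \<delta>(4) by auto
        qed
        moreover have "V w = v (t \<kappa>) (U \<kappa> w)" using \<kappa>(4) nU by (simp add: f_def truncate_def)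
        \<comment> \<open>Three ways to stop: the grid ends, one cell after \<open>t i\<close>; the
          distance test fails one cell later, costing \<open>\<omega>\<close>; or the cell after
          \<open>t \<kappa>\<close> passes \<open>\<tau> w\<close>, so \<open>\<tau> w\<close> is
          within two cells of \<open>t i\<close>.\<close>
        moreover have "T - e \<le> t i \<or> \<tau> w - e \<le> t i \<or> infdist (X (t i) w) (- C) \<le> e"
        proof (cases "\<kappa> = L")
          case True
          then show ?thesis using mesh[OF i(1)] Suc t0(2) h(7) e by auto
        next
          case False
          then have \<kappa>L: "\<kappa> < L" using \<kappa>(1) by simp
          show ?thesis
          proof (cases "t (Suc \<kappa>) \<le> \<tau> w")
            case True
            have "t \<kappa> < \<tau> w" using tS[OF \<kappa>L] True by simp
            then have "infdist (X (t i) w) (- C) \<le> infdist (X (t \<kappa>) w) (- C) + \<omega>"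
              using t\<tau>[of i] tj[of i] tj[of \<kappa>] i(1) \<kappa>(1) mesh[OF i(1)] tS[OF i(1)] Suc by (intro inf_near) auto
            then show ?thesis using bad[OF \<kappa>L True] \<omega>(2) by simp
          next
            case False
            then show ?thesis using mesh[OF i(1)] mesh[OF \<kappa>L] Suc h(7) by simp
          qed
        qed
        ultimately show ?thesis
          using XC t\<tau>[of i] tj[of i] i(1) by (intro bexI[of _ "t i"]) auto
      qed
    qed
  qed
qed

end

section \<open>The reach-avoid probability\<close>

text \<open>Closedness of \<open>S\<close> makes the hitting times compact, so there is a first one.
  It is positive, and the path just before it lies outside \<open>S\<close>, which places the
  hitting point on the frontier.\<close>

lemma first_hit:
  fixes x :: "real \<Rightarrow> 'a::metric_space"
  assumes x: "continuous_on {0..t1} x" and S: "closed S" and t1: "0 \<le> t1" "x t1 \<in> S"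
    and D: "\<forall>r\<in>{0..<t1}. x r \<in> D" and x0: "x 0 \<notin> S"
  obtains \<theta> where "\<theta> \<in> {0..t1}" "x \<theta> \<in> frontier S" "x \<theta> \<in> S" "\<forall>r\<in>{0..<\<theta>}. x r \<in> D - S"
proof -
  let ?H = "{0..t1} \<inter> x -` S"
  have cl: "closed ?H" by (rule continuous_closed_preimage[OF x _ S]) simp
  have "{0..t1} \<inter> ?H = ?H" by blast
  then have cp: "compact ?H" using compact_Int_closed[OF compact_Icc cl, of 0 t1] by metis
  have "?H \<noteq> {}" using t1 by auto
  from compact_attains_inf[OF cp this]
  obtain \<theta> where \<theta>: "\<theta> \<in> ?H" "\<forall>s\<in>?H. \<theta> \<le> s" by (rule bexE)
  have before: "x r \<in> D - S" if "r \<in> {0..<\<theta>}" for r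
    using \<theta> D that by force
  have pos: "0 < \<theta>" using \<theta>(1) x0 by (cases "\<theta> = 0") auto
  have "x \<theta> \<in> closure (- S)"
    unfolding closure_approachable
  proof (intro allI impI)
    fix e :: real assume "0 < e"
    then obtain d where d: "d > 0" "\<forall>r\<in>{0..t1}. dist r \<theta> < d \<longrightarrow> dist (x r) (x \<theta>) < e"
      using x \<theta>(1) unfolding continuous_on_iff by (metis IntD1)
    let ?r = "max 0 (\<theta> - d / 2)"
    have "?r \<in> {0..<\<theta>}" "dist ?r \<theta> < d" using pos d(1) by (auto simp: dist_real_def)
    then show "\<exists>y\<in>- S. dist y (x \<theta>) < e"
      using before[of ?r] d(2) \<theta>(1) by (intro bexI[of _ "x ?r"]) auto
  qed
  then have "x \<theta> \<in> frontier S" using \<theta>(1) S by (simp add: frontier_closures)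
  with \<theta> before show thesis by (intro that[of \<theta>]) auto
qed

text \<open>While the path is in \<open>C\<close> the time \<open>s\<close> is before
  \<open>\<theta>\<close>. On \<open>{0..\<theta> - d}\<close> the distance to the complement has a
  positive minimum, so for small \<open>\<eta>\<close> none of the three reasons to stop can occur
  there; the remaining times are close to \<open>\<theta>\<close>, and continuity applies.\<close>

lemma exit_value_limit:
  fixes x :: "real \<Rightarrow> 'a::metric_space" and v :: "real \<Rightarrow> 'a \<Rightarrow> real"
  assumes x: "continuous_on {0..\<theta>} x" and \<theta>: "0 \<le> \<theta>" "\<theta> \<le> T"
    and C: "open C" "x \<theta> \<notin> C" "\<forall>r\<in>{0..<\<theta>}. x r \<in> C"
    and v: "continuous_on ({0..T} \<times> UNIV) (\<lambda>(t, x). v t x)" and \<epsilon>: "0 < \<epsilon>"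
  obtains \<eta> where "0 < \<eta>"
    "\<forall>s\<in>{0..T}. (\<forall>r\<in>{0..s}. x r \<in> C) \<longrightarrow> T - \<eta> \<le> s \<or> \<theta> - \<eta> \<le> s \<or> infdist (x s) (- C) \<le> \<eta> \<longrightarrow>
      \<bar>v s (x s) - v \<theta> (x \<theta>)\<bar> < \<epsilon>"
proof -
  have "continuous_on {0..\<theta>} (\<lambda>s. (\<lambda>(t, x). v t x) (s, x s))"
    by (rule continuous_on_compose2[OF v]) (use x \<theta> in \<open>auto intro!: continuous_intros\<close>)
  then obtain d where d: "d > 0" "\<forall>s\<in>{0..\<theta>}. dist s \<theta> < d \<longrightarrow> dist (v s (x s)) (v \<theta> (x \<theta>)) < \<epsilon>"
    using \<theta> \<epsilon> unfolding continuous_on_iff by (metis atLeastAtMost_iff case_prod_conv order_refl)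
  have ne: "- C \<noteq> {}" using C(2) by auto
  have "\<exists>c>0. \<forall>s\<in>{0..\<theta> - d}. c \<le> infdist (x s) (- C)"
  proof (cases "{0..\<theta> - d} = {}")
    case False
    have "continuous_on {0..\<theta> - d} (\<lambda>s. infdist (x s) (- C))"
      using d(1) by (intro continuous_on_infdist continuous_on_subset[OF x]) auto
    then obtain s0 where s0: "s0 \<in> {0..\<theta> - d}" "\<forall>s\<in>{0..\<theta> - d}. infdist (x s0) (- C) \<le> infdist (x s) (- C)"
      using continuous_attains_inf[OF compact_Icc False] by blast
    have "x s0 \<notin> - C" using C(3) s0(1) d(1) by auto
    then have "infdist (x s0) (- C) \<noteq> 0"
      using in_closed_iff_infdist_zero[of "- C" "x s0"] C(1) ne by (simp add: closed_Compl)
    then have "0 < infdist (x s0) (- C)" using infdist_nonneg[of "x s0" "- C"] by simp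
    then show ?thesis using s0(2) by blast
  qed (auto intro: exI[of _ 1])
  then obtain c where c: "c > 0" "\<forall>s\<in>{0..\<theta> - d}. c \<le> infdist (x s) (- C)" by blast
  show thesis
  proof (rule that[of "min (c / 2) (d / 2)"])
    show "0 < min (c / 2) (d / 2)" using c d by simp
    show "\<forall>s\<in>{0..T}. (\<forall>r\<in>{0..s}. x r \<in> C) \<longrightarrow>
      T - min (c / 2) (d / 2) \<le> s \<or> \<theta> - min (c / 2) (d / 2) \<le> s \<or> infdist (x s) (- C) \<le> min (c / 2) (d / 2) \<longrightarrow>
      \<bar>v s (x s) - v \<theta> (x \<theta>)\<bar> < \<epsilon>"
    proof (intro ballI impI)
      fix s assume s: "s \<in> {0..T}" "\<forall>r\<in>{0..s}. x r \<in> C"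
        and reason: "T - min (c / 2) (d / 2) \<le> s \<or> \<theta> - min (c / 2) (d / 2) \<le> s \<or> infdist (x s) (- C) \<le> min (c / 2) (d / 2)"
      have lt: "s < \<theta>"
      proof (rule ccontr)
        assume "\<not> s < \<theta>"
        then have "\<theta> \<in> {0..s}" using \<theta>(1) by simp
        with s(2) have "x \<theta> \<in> C" by (rule bspec)
        with C(2) show False ..
      qed
      have "\<theta> - d < s"
      proof (rule ccontr)
        assume "\<not> \<theta> - d < s"
        then have "s \<in> {0..\<theta> - d}" using s(1) by auto
        then have "c \<le> infdist (x s) (- C)" using c(2) by blast
        then show False using reason c(1) d(1) \<theta>(2) \<open>\<not> \<theta> - d < s\<close> by (auto simp: min_def split: if_splits)
      qed
      then have "dist s \<theta> < d" "s \<in> {0..\<theta>}" using lt s(1) by (auto simp: dist_real_def)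
      then show "\<bar>v s (x s) - v \<theta> (x \<theta>)\<bar> < \<epsilon>" using d(2) by (auto simp: dist_real_def)
    qed
  qed
qed

lemma C12_time_antimono:
  assumes v: "C12 T v" and \<theta>: "0 \<le> \<theta>" "\<theta> \<le> T" and neg: "\<And>t. t \<in> {0..T} \<Longrightarrow> time_deriv T v t y \<le> 0"
  shows "v T y \<le> v \<theta> y"
proof (cases "\<theta> = T")
  case False
  then have lt: "\<theta> < T" using \<theta> by simp
  have "((\<lambda>s. v s y) has_derivative (\<lambda>h. h * time_deriv T v s y)) (at s within {\<theta>..T})" if "\<theta> \<le> s" "s \<le> T" for s
    using C12D(1)[OF v, of s y] that \<theta>
    by (auto simp: has_field_derivative_def mult.commute[of _ "time_deriv _ _ _ _"] elim!: has_derivative_subset)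
  from mvt_simple[OF lt this]
  obtain s where "s \<in> {\<theta><..<T}" "v T y - v \<theta> y = (T - \<theta>) * time_deriv T v s y" by blast
  moreover have "(T - \<theta>) * time_deriv T v s y \<le> 0"
    using neg[of s] \<theta> lt calculation(1) by (intro mult_nonneg_nonpos) auto
  ultimately show ?thesis by simp
qed simp

text \<open>Fatou's lemma for the nonnegative variables \<open>V m w + B\<close>; the hypothesis
  \<open>lim\<close> says that their lower limit is at least the indicator of \<open>E\<close> plus
  \<open>B\<close>.\<close>

lemma (in prob_space) fatou_prob_le:
  fixes V :: "nat \<Rightarrow> 'a \<Rightarrow> real"
  assumes E: "E \<in> sets M" and V: "\<And>m. V m \<in> borel_measurable M" "\<And>m w. w \<in> space M \<Longrightarrow> \<bar>V m w\<bar> \<le> B"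
    and EV: "\<And>m. expectation (V m) \<le> a + e m" and e: "e \<longlonglongrightarrow> 0" and a: "0 \<le> a"
    and lim: "AE w in M. \<forall>\<epsilon>>0. \<forall>\<^sub>F m in sequentially. indicator E w - \<epsilon> \<le> V m w"
  shows "prob E \<le> a"
proof -
  obtain w0 where "w0 \<in> space M" using not_empty by blast
  then have B: "0 \<le> B" using V(2)[of w0 0] by simp
  have iV: "integrable M (V m)" for m by (rule integrable_const_bound[of _ B]) (use V in auto)
  have iE: "integrable M (indicator E :: 'a \<Rightarrow> real)"
    using E by (intro integrable_real_indicator) (auto simp: less_top[symmetric])
  have "ennreal (prob E + B) = (\<integral>\<^sup>+w. ennreal (indicator E w + B) \<partial>M)"
    using iE E B by (subst nn_integral_eq_integral) (auto simp: prob_space)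
  also have "\<dots> \<le> (\<integral>\<^sup>+w. liminf (\<lambda>m. ennreal (V m w + B)) \<partial>M)"
  proof (rule nn_integral_mono_AE)
    show "AE w in M. ennreal (indicator E w + B) \<le> liminf (\<lambda>m. ennreal (V m w + B))"
      using lim
    proof eventually_elim
      case (elim w)
      show ?case
        unfolding le_Liminf_iff
      proof (intro allI impI)
        fix y assume y: "y < ennreal (indicator E w + B)"
        then have "y \<noteq> top" by auto
        then obtain r where r: "y = ennreal r" "0 \<le> r" by (cases y) auto
        have lt: "r < indicator E w + B" using y r by (simp add: ennreal_less_iff)
        let ?\<epsilon> = "(indicator E w + B - r) / 2"
        have "0 < ?\<epsilon>" using lt by simp
        with elim have "\<forall>\<^sub>F m in sequentially. indicator E w - ?\<epsilon> \<le> V m w" by blast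
        then show "\<forall>\<^sub>F m in sequentially. y < ennreal (V m w + B)"
        proof eventually_elim
          case (elim m)
          have "r < V m w + B" using elim lt by (simp add: field_simps)
          then show ?case using r by (simp add: ennreal_less_iff)
        qed
      qed
    qed
  qed
  also have "\<dots> \<le> liminf (\<lambda>m. \<integral>\<^sup>+w. ennreal (V m w + B) \<partial>M)"
    using V(1) by (intro nn_integral_liminf) simp
  also have "\<dots> \<le> liminf (\<lambda>m. ennreal (a + e m + B))"
  proof (rule Liminf_mono, rule always_eventually, rule allI)
    fix m
    have "(\<integral>\<^sup>+w. ennreal (V m w + B) \<partial>M) = ennreal (expectation (\<lambda>w. V m w + B))"
    proof (rule nn_integral_eq_integral)
      show "AE w in M. 0 \<le> V m w + B"
      proof (rule AE_I2)
        fix w assume "w \<in> space M"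
        from V(2)[OF this, of m] show "0 \<le> V m w + B" by linarith
      qed
    qed (use iV[of m] in simp)
    also have "expectation (\<lambda>w. V m w + B) = expectation (V m) + B" using iV[of m] by (simp add: prob_space)
    also have "ennreal (expectation (V m) + B) \<le> ennreal (a + e m + B)" using EV[of m] by (intro ennreal_leI) simp
    finally show "(\<integral>\<^sup>+w. ennreal (V m w + B) \<partial>M) \<le> ennreal (a + e m + B)" .
  qed
  also have "liminf (\<lambda>m. ennreal (a + e m + B)) = ennreal (a + 0 + B)"
    by (intro lim_imp_Liminf tendsto_ennrealI tendsto_intros e) simp
  finally show ?thesis using a B by simp
qed

section \<open>Passage to the limit along the localizing sequence\<close>

context wiener
begin

lemma reach_avoid_prob_le:
  fixes v :: "real \<Rightarrow> real ^ 'n \<Rightarrow> real" and b :: "real ^ 'n \<Rightarrow> real ^ 'n" and \<sigma> :: "real ^ 'n \<Rightarrow> real ^ 'k ^ 'n"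
  assumes bc: "continuous_on UNIV b" and sc: "continuous_on UNIV \<sigma>"
    and sol: "local_strong_solution M W b \<sigma> x0 X \<zeta>"
    and D: "open D" "bounded D" and S: "closed S" and T: "0 < T" and v: "C12 T v"
    and gen: "\<And>t x. t \<in> {0..T} \<Longrightarrow> x \<in> D - S \<Longrightarrow> generator T b \<sigma> v t x \<le> 0"
    and bd: "\<And>t x. t \<in> {0..T} \<Longrightarrow> x \<in> frontier D \<union> frontier S \<Longrightarrow> time_deriv T v t x \<le> 0"
    and fin: "\<And>x. x \<in> closure (D - S) \<Longrightarrow> v T x \<ge> indicator (frontier S) x"
    and x0: "x0 \<in> D - S"
  shows "reach_avoid_prob M X \<zeta> D S T \<le> v 0 x0"
proof -
  define C where "C = D - S"
  have Co: "open C" using D S by (simp add: C_def open_Diff)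
  obtain R where R: "\<And>y. y \<in> D \<Longrightarrow> norm y \<le> R" using D(2) bounded_iff by metis
  have CR: "norm y \<le> R" if "y \<in> C" for y using R that by (simp add: C_def)
  \<comment> \<open>Distances to \<open>- C\<close> are meaningful only then: \<open>infdist\<close>
    to the empty set is 0 by convention.\<close>
  have Cne: "- C \<noteq> {}"
  proof
    assume "- C = {}"
    then have "UNIV \<subseteq> D" by (auto simp: C_def)
    then show False using D(2) bounded_subset not_bounded_UNIV by blast
  qed
  have nonneg: "0 \<le> v t y" if "t \<in> {0..T}" "y \<in> closure C" for t y
  proof (rule supersolution_nonneg[OF v T _ Co closure_subset _ _ _ that])
    show "compact (closure C)" using D(2) bounded_subset[of D C] by (simp add: C_def compact_closure Diff_subset)
    show "generator T b \<sigma> v t x \<le> 0" if "t \<in> {0..T}" "x \<in> C" for t x using gen that by (simp add: C_def)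
    show "time_deriv T v t x \<le> 0" if "t \<in> {0..T}" "x \<in> closure C - C" for t x
    proof (rule bd[OF that(1)])
      \<comment> \<open>A point of the closure outside the open set \<open>C\<close> either lies in
        \<open>S\<close>, and is then a limit of points outside \<open>S\<close>, or lies outside
        \<open>D\<close> and is a limit of points of \<open>D\<close>.\<close>
      have x: "x \<in> closure D" "x \<in> closure (- S)" "x \<notin> D \<or> x \<in> S"
        using that(2) closure_mono[of C D] closure_mono[of C "- S"] by (auto simp: C_def)
      show "x \<in> frontier D \<union> frontier S"
      proof (cases "x \<in> S")
        case True
        then show ?thesis using x(2) S by (simp add: frontier_closures)
      next
        case False
        then show ?thesis using x(1,3) D(1) by (simp add: frontier_def interior_open)
      qed
    qed
    show "0 \<le> v T x" if "x \<in> closure C" for x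
      using order_trans[OF indicator_pos_le fin[of x]] that by (simp add: C_def)
  qed
  obtain B where B0: "0 < B" "C12_bound T v (R + 2) B"
    by (rule C12_bounded[OF v])
  note B = B0(1) C12_boundD[OF B0(2)]
  note sol = sol[unfolded local_strong_solution_def]
  have Xm: "(\<lambda>w. if ereal t < \<zeta> w then X t w else 0) \<in> borel_measurable (F t)" if "0 \<le> t" for t
    using sol that by blast
  have Xc: "continuous_on {t. 0 \<le> t \<and> ereal t < \<zeta> w} (\<lambda>t. X t w)" if "w \<in> space M" for w using sol that by blast
  have X0: "AE w in M. X 0 w = x0" using sol by blast
  obtain \<tau> where \<tau>1: "\<forall>m. stopping_time F (\<tau> m)"
    and \<tau>2: "AE w in M. (\<forall>m. 0 \<le> \<tau> m w \<and> \<tau> m w \<le> \<tau> (Suc m) w \<and> ereal (\<tau> m w) < \<zeta> w) \<and> (\<lambda>m. ereal (\<tau> m w)) \<longlonglongrightarrow> \<zeta> w"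
    and \<tau>3: "\<forall>m. \<exists>I. has_ito_integral M W (\<lambda>s w. if s \<le> \<tau> m w \<and> ereal s < \<zeta> w then \<sigma> (X s w) else 0) I \<and>
      (AE w in M. \<forall>t\<ge>0. X (min t (\<tau> m w)) w = x0 + integral {0..min t (\<tau> m w)} (\<lambda>s. b (X s w)) + I t w)"
    using sol[THEN conjunct2, THEN conjunct2, THEN conjunct2, THEN conjunct2, THEN conjunct2] by blast
  \<comment> \<open>Summable, so that by Borel-Cantelli almost every path avoids all but finitely
    many exceptional sets.\<close>
  define e where "e m = (1 / 2 :: real) ^ m" for m
  have e: "0 < e m" for m by (simp add: e_def)
  have "\<exists>V A. V \<in> borel_measurable M \<and> (\<forall>w\<in>space M. \<bar>V w\<bar> \<le> B) \<and> expectation V \<le> v 0 x0 + e m \<and> A \<in> sets M \<and> prob A \<le> e m \<and>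
    (\<forall>w\<in>space M - A. \<exists>t\<in>{0..T}. (t = 0 \<or> t < \<tau> m w) \<and> (\<forall>r\<in>{0..t}. X r w \<in> C) \<and> \<bar>V w - v t (X t w)\<bar> \<le> e m \<and>
        (T - e m \<le> t \<or> \<tau> m w - e m \<le> t \<or> infdist (X t w) (- C) \<le> e m))" for m
  proof -
    obtain I where I: "has_ito_integral M W (\<lambda>s w. if s \<le> \<tau> m w \<and> ereal s < \<zeta> w then \<sigma> (X s w) else 0) I"
      "AE w in M. \<forall>t\<ge>0. X (min t (\<tau> m w)) w = x0 + integral {0..min t (\<tau> m w)} (\<lambda>s. b (X s w)) + I t w"
      using \<tau>3 by blast
    have \<tau>2': "AE w in M. 0 \<le> \<tau> m w \<and> ereal (\<tau> m w) < \<zeta> w" using \<tau>2 by eventually_elim blast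
    show ?thesis
    proof (rule stopped_supersolution[OF bc sc T v _ _ _ Cne _ _ Xm Xc X0 \<tau>1[rule_format] \<tau>2' I e])
      show "\<bar>v t y\<bar> \<le> B" if "t \<in> {0..T}" "norm y \<le> R + 2" for t y using B(2)[OF that] by blast
      show "0 \<le> B" using B(1) by simp
      show "norm y \<le> R" if "y \<in> C" for y using CR that .
      show "x0 \<in> C" using x0 by (simp add: C_def)
      show "generator T b \<sigma> v t y \<le> 0" if "t \<in> {0..T}" "y \<in> C" for t y using gen that by (simp add: C_def)
    qed (assumption | rule exI conjI)+
  qed
  then obtain V A where V: "\<And>m. V m \<in> borel_measurable M" "\<And>m w. w \<in> space M \<Longrightarrow> \<bar>V m w\<bar> \<le> B" "\<And>m. expectation (V m) \<le> v 0 x0 + e m"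
    and A: "\<And>m. A m \<in> sets M" "\<And>m. prob (A m) \<le> e m"
    and VA: "\<And>m w. w \<in> space M - A m \<Longrightarrow> \<exists>t\<in>{0..T}. (t = 0 \<or> t < \<tau> m w) \<and> (\<forall>r\<in>{0..t}. X r w \<in> C) \<and> \<bar>V m w - v t (X t w)\<bar> \<le> e m \<and>
        (T - e m \<le> t \<or> \<tau> m w - e m \<le> t \<or> infdist (X t w) (- C) \<le> e m)"
    by metis
  have e_lim: "e \<longlonglongrightarrow> 0" unfolding e_def by (rule LIMSEQ_realpow_zero) auto
  have BC: "AE w in M. \<forall>\<^sub>F m in sequentially. w \<in> space M - A m"
  proof (rule borel_cantelli_AE1)
    show "summable (\<lambda>m. prob (A m))"
    proof (rule summable_comparison_test')
      show "summable e" unfolding e_def by (rule summable_geometric) simp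
    qed (use A(2) in auto)
  qed (use A(1) in \<open>auto simp: less_top[symmetric]\<close>)
  define E where "E = {w \<in> space M. \<exists>t\<in>{0..T}. ereal t < \<zeta> w \<and> X t w \<in> S \<and> (\<forall>r\<in>{0..<t}. X r w \<in> D)}"
  have lim: "AE w in M. \<forall>\<epsilon>>0. \<forall>\<^sub>F m in sequentially. indicator E w - \<epsilon> \<le> V m w"
    using BC X0 \<tau>2 AE_space
  proof eventually_elim
    case (elim w)
    show ?case
    proof (intro allI impI)
      fix \<epsilon> :: real assume \<epsilon>: "0 < \<epsilon>"
      have small: "\<forall>\<^sub>F m in sequentially. e m < \<eta>" if "0 < \<eta>" for \<eta>
        using order_tendstoD(2)[OF e_lim that] .
      show "\<forall>\<^sub>F m in sequentially. indicator E w - \<epsilon> \<le> V m w"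
      proof (cases "w \<in> E")
        case False
        show ?thesis
          using elim(1) small[OF \<epsilon>]
        proof eventually_elim
          case (elim m)
          obtain t where t: "t \<in> {0..T}" "\<forall>r\<in>{0..t}. X r w \<in> C" "\<bar>V m w - v t (X t w)\<bar> \<le> e m"
            using VA[OF elim(1)] by blast
          have "X t w \<in> closure C" using t closure_subset by force
          then have "0 \<le> v t (X t w)" by (rule nonneg[OF t(1)])
          then show ?case using t(3) elim(2) False by simp
        qed
      next
        case True
        then obtain t1 where t1: "t1 \<in> {0..T}" "ereal t1 < \<zeta> w" "X t1 w \<in> S" "\<forall>r\<in>{0..<t1}. X r w \<in> D"
          by (auto simp: E_def)
        have alive: "ereal s < \<zeta> w" if "s \<le> t1" for s
          using that t1(2) order_le_less_trans[of "ereal s" "ereal t1"] by simp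
        have Xct: "continuous_on {0..t1} (\<lambda>t. X t w)"
          using alive by (intro continuous_on_subset[OF Xc[OF elim(4)]]) auto
        obtain \<theta> where \<theta>: "\<theta> \<in> {0..t1}" "X \<theta> w \<in> frontier S" "X \<theta> w \<in> S" "\<forall>r\<in>{0..<\<theta>}. X r w \<in> D - S"
        proof (rule first_hit[OF Xct S _ t1(3,4)])
          show "0 \<le> t1" "X 0 w \<notin> S" using t1(1) elim(2) x0 by auto
        qed (rule that)
        have \<theta>T: "0 \<le> \<theta>" "\<theta> \<le> T" using \<theta>(1) t1(1) by auto
        \<comment> \<open>Needed because the terminal condition is imposed on the closure of
          \<open>D - S\<close> only; the path reaches the hitting point through
          \<open>C\<close>.\<close>
        have "X \<theta> w \<in> closure C"
        proof -
          have pos: "0 < \<theta>" using \<theta>(1,3) elim(2) x0 by (cases "\<theta> = 0") auto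
          have "closure {0..<\<theta>} = {0..\<theta>}" using pos by simp
          moreover have "continuous_on {0..\<theta>} (\<lambda>t. X t w)" using \<theta>(1) by (intro continuous_on_subset[OF Xct]) auto
          ultimately have "(\<lambda>t. X t w) ` {0..\<theta>} \<subseteq> closure ((\<lambda>t. X t w) ` {0..<\<theta>})"
            using image_closure_subset[of "{0..<\<theta>}" "\<lambda>t. X t w" "closure ((\<lambda>t. X t w) ` {0..<\<theta>})"]
              closure_subset[of "(\<lambda>t. X t w) ` {0..<\<theta>}"] by simp
          also have "\<dots> \<subseteq> closure C" using \<theta>(4) by (intro closure_mono) (auto simp: C_def)
          finally show ?thesis using \<theta>T by auto
        qed
        then have one: "1 \<le> v T (X \<theta> w)" using fin[of "X \<theta> w"] \<theta>(2) by (simp add: C_def)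
        have v1: "1 \<le> v \<theta> (X \<theta> w)"
          by (rule order_trans[OF one C12_time_antimono[OF v \<theta>T]]) (use bd \<theta>(2) in auto)
        obtain \<eta> where \<eta>: "0 < \<eta>"
          "\<forall>s\<in>{0..T}. (\<forall>r\<in>{0..s}. X r w \<in> C) \<longrightarrow> T - \<eta> \<le> s \<or> \<theta> - \<eta> \<le> s \<or> infdist (X s w) (- C) \<le> \<eta> \<longrightarrow>
            \<bar>v s (X s w) - v \<theta> (X \<theta> w)\<bar> < \<epsilon> / 2"
        proof (rule exit_value_limit[of \<theta> "\<lambda>t. X t w" T C v "\<epsilon> / 2"])
          show "continuous_on {0..\<theta>} (\<lambda>t. X t w)" using \<theta>(1) by (intro continuous_on_subset[OF Xct]) auto
          show "continuous_on ({0..T} \<times> UNIV) (\<lambda>(t, x). v t x)" using v unfolding C12_def by blast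
        qed (use \<theta>T Co \<theta>(3,4) \<epsilon> in \<open>auto simp: C_def intro: that\<close>)
        \<comment> \<open>The stopping times tend to the lifetime, which exceeds
          \<open>\<theta>\<close>. This converts the alternative
          \<open>\<tau> m w - e m \<le> t\<close> into the one about \<open>\<theta>\<close> in
          \<open>exit_value_limit\<close>.\<close>
        have "\<forall>\<^sub>F m in sequentially. ereal \<theta> < ereal (\<tau> m w)"
          using elim(3) alive[of \<theta>] \<theta>(1) by (intro order_tendstoD(1)) auto
        moreover have "\<forall>\<^sub>F m in sequentially. e m < min \<eta> (\<epsilon> / 2)" using \<eta>(1) \<epsilon> by (intro small) simp
        ultimately show ?thesis
          using elim(1)
        proof eventually_elim
          case (elim m)
          obtain t where t: "t \<in> {0..T}" "\<forall>r\<in>{0..t}. X r w \<in> C" "\<bar>V m w - v t (X t w)\<bar> \<le> e m"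
            "T - e m \<le> t \<or> \<tau> m w - e m \<le> t \<or> infdist (X t w) (- C) \<le> e m"
            using VA[OF elim(3)] by blast
          have "T - \<eta> \<le> t \<or> \<theta> - \<eta> \<le> t \<or> infdist (X t w) (- C) \<le> \<eta>"
            using t(4) elim(1,2) by auto
          then have "\<bar>v t (X t w) - v \<theta> (X \<theta> w)\<bar> < \<epsilon> / 2" using \<eta>(2) t(1,2) by blast
          moreover have "e m < \<epsilon> / 2" using elim(2) by simp
          ultimately have "1 - \<epsilon> \<le> V m w" using t(3) v1 by linarith
          then show ?case using True by simp
        qed
      qed
    qed
  qed
  have v0: "0 \<le> v 0 x0" using nonneg[of 0 x0] T x0 closure_subset[of C] by (auto simp: C_def)
  show ?thesis
  proof (cases "E \<in> sets M")
    case True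
    have "prob E \<le> v 0 x0" by (rule fatou_prob_le[OF True V e_lim v0 lim])
    then show ?thesis by (simp add: reach_avoid_prob_def E_def)
  next
    case False \<comment> \<open>then \<open>measure M E\<close> is the junk value 0\<close>
    then show ?thesis using v0 by (simp add: reach_avoid_prob_def E_def[symmetric] measure_notin_sets)
  qed
qed

end

theorem corollary1:
  fixes M :: "'w measure"
    and W :: "real \<Rightarrow> 'w \<Rightarrow> real ^ 'k"
    and b :: "real ^ 'n \<Rightarrow> real ^ 'n"
    and \<sigma> :: "real ^ 'n \<Rightarrow> real ^ 'k ^ 'n"
    and X :: "real ^ 'n \<Rightarrow> real \<Rightarrow> 'w \<Rightarrow> real ^ 'n"
    and \<zeta> :: "real ^ 'n \<Rightarrow> 'w \<Rightarrow> ereal"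
    and D S :: "(real ^ 'n) set"
    and T :: real
    and v :: "real \<Rightarrow> real ^ 'n \<Rightarrow> real"
  assumes "local_lipschitz (UNIV :: real set) UNIV (\<lambda>_. b)"
    and "local_lipschitz (UNIV :: real set) UNIV (\<lambda>_. \<sigma>)"
    and "wiener_process M W"
    and "\<And>x0. maximal_local_strong_solution M W b \<sigma> x0 (X x0) (\<zeta> x0)"
    and "open D" and "bounded D" and "closed S" and "S \<subseteq> D" and "0 < T"
    and "C12 T v"
    and "\<And>t x. t \<in> {0..T} \<Longrightarrow> x \<in> D - S \<Longrightarrow> generator T b \<sigma> v t x \<le> 0"
    and "\<And>t x. t \<in> {0..T} \<Longrightarrow> x \<in> frontier D \<union> frontier S \<Longrightarrow> time_deriv T v t x \<le> 0"
    and "\<And>x. x \<in> closure (D - S) \<Longrightarrow> v T x \<ge> indicator (frontier S) x"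
  shows "\<forall>x0 \<in> D - S. reach_avoid_prob M (X x0) (\<zeta> x0) D S T \<le> v 0 x0"
proof
  fix x0 assume "x0 \<in> D - S"
  interpret wiener M W
    using assms(3) by (intro wiener.intro wiener_axioms.intro) (simp_all add: wiener_process_def)
  have "continuous_on UNIV b" "continuous_on UNIV \<sigma>"
    using local_lipschitz_continuous_on[OF assms(1), of 0] local_lipschitz_continuous_on[OF assms(2), of 0] by simp_all
  moreover have "local_strong_solution M W b \<sigma> x0 (X x0) (\<zeta> x0)"
    using assms(4)[of x0] by (simp add: maximal_local_strong_solution_def)
  ultimately show "reach_avoid_prob M (X x0) (\<zeta> x0) D S T \<le> v 0 x0"
    using assms(5-7,9-) \<open>x0 \<in> D - S\<close> by (intro reach_avoid_prob_le) auto
qed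

end
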